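(* Assume the setting of Lemma 4.3: $\Theta\subseteq\mathbb{R}^d$, functions $f_\theta\colon[0,\infty)\times\mathbb{N}_0\to[0,\infty)$, $\theta_0\in\Theta$, constants $\delta>0$, $C<\infty$, $\kappa_1,\kappa_2\ge0$ with $\kappa_1+\kappa_2<1$ such that for all $\theta'\in\Theta$ with $\|\theta'-\theta_0\|\le\delta$: $|f_{\theta'}(\lambda,y)-f_{\theta_0}(\lambda,y)|\le C\|\theta'-\theta_0\|(\lambda+y+1)$ and $|f_{\theta'}(\lambda,y)-f_{\theta'}(\tilde\lambda,\tilde y)|\le\kappa_1|\lambda-\tilde\lambda|+\kappa_2|y-\tilde y|$ for all $\lambda,\tilde\lambda\ge0$, $y,\tilde y\in\mathbb{N}_0$; a strictly stationary process $((N_t,\lambda_t))_{t\in\mathbb{Z}}$ with $N_t\mid\sigma(\lambda_s,N_s:s\le t-1)\sim\mathrm{Poisson}(\lambda_t)$ and $\lambda_t=f_{\theta_0}(\lambda_{t-1},N_{t-1})$; estimators $\widehat\theta_n-\theta_0=O_P(n^{-1/2})$; an arbitrary a.s. finite $\widehat\lambda_1\ge0$ and $\widehat\lambda_t=f_{\widehat\theta_n}(\widehat\lambda_{t-1},N_{t-1})$, $t=2,\dots,n$. Assume moreover $f_{\theta_0}(0,0)>0$. Let $\widehat T_n=n^{-1/2}\sum_{t=1}^n\{(N_t-\widehat\lambda_t)^2-N_t\}$. Then $$\Big((2/n)\sum_{t=1}^n\widehat\lambda_t^2\Big)^{-1/2}\widehat T_n\xrightarrow{d}\mathcal{N}(0,1),$$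 and consequently, for $\alpha\in(0,1)$, $u_\alpha=\Phi^{-1}(1-\alpha)$, and the test $\varphi_n=I\big(((2/n)\sum_{t=1}^n\widehat\lambda_t^2)^{-1/2}\widehat T_n>u_\alpha\big)$, we have $P(\varphi_n=1)\to\alpha$ as $n\to\infty$.
   Context: $\Phi$ is the standard normal distribution function and $I(\cdot)$ the indicator function. *)

theory Defs
  imports "HOL-Probability.Probability"
begin

definition Phi :: "real \<Rightarrow> real" where
  "Phi x = cdf std_normal_distribution x"

definition Phi_inv :: "real \<Rightarrow> real" where
  "Phi_inv p = (THE u. Phi u = p)"

definition poisson_prob :: "real \<Rightarrow> nat \<Rightarrow> real" where
  "poisson_prob l k = exp (- l) * l ^ k / fact k"

definition strictly_stationary ::
  "'w measure \<Rightarrow> (int \<Rightarrow> 'w \<Rightarrow> 'b::topological_space) \<Rightarrow> bool" where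
  "strictly_stationary M X \<longleftrightarrow>
     (\<forall>I k. finite I \<longrightarrow>
        distr M (PiM I (\<lambda>_. borel)) (\<lambda>w. \<lambda>i\<in>I. X (i + k) w)
      = distr M (PiM I (\<lambda>_. borel)) (\<lambda>w. \<lambda>i\<in>I. X i w))"

definition past_sets ::
  "'w measure \<Rightarrow> (int \<Rightarrow> 'w \<Rightarrow> real) \<Rightarrow> (int \<Rightarrow> 'w \<Rightarrow> nat) \<Rightarrow> int \<Rightarrow> 'w set set" where
  "past_sets M lam N t = sigma_sets (space M)
     (\<Union>s\<in>{..t - 1}. {lam s -` B \<inter> space M | B. B \<in> sets borel}
                   \<union> {N s -` B \<inter> space M | B. B \<subseteq> (UNIV :: nat set)})"

definition bounded_in_prob :: "'w measure \<Rightarrow> (nat \<Rightarrow> 'w \<Rightarrow> real) \<Rightarrow> bool" where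
  "bounded_in_prob M X \<longleftrightarrow>
     (\<forall>\<epsilon>>0. \<exists>K n0. \<forall>n\<ge>n0. measure M {w \<in> space M. \<bar>X n w\<bar> > K} < \<epsilon>)"

text \<open>Plug-in intensities: lhat f th l1 Ns t is lambda-hat_t for t >= 1
  (lambda-hat_1 = l1, lambda-hat_t = f th (lambda-hat_(t-1)) (N_(t-1)));
  the value at t = 0 is an unused junk value.\<close>
fun lhat :: "('a \<Rightarrow> real \<Rightarrow> nat \<Rightarrow> real) \<Rightarrow> 'a \<Rightarrow> real \<Rightarrow> (int \<Rightarrow> nat) \<Rightarrow> nat \<Rightarrow> real" where
  "lhat f th l1 Ns 0 = 0"
| "lhat f th l1 Ns (Suc 0) = l1"
| "lhat f th l1 Ns (Suc (Suc k)) = f th (lhat f th l1 Ns (Suc k)) (Ns (int (Suc k)))"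

definition That :: "nat \<Rightarrow> (int \<Rightarrow> nat) \<Rightarrow> (nat \<Rightarrow> real) \<Rightarrow> real" where
  "That n Ns lh = (\<Sum>t=1..n. (real (Ns (int t)) - lh t)\<^sup>2 - real (Ns (int t))) / sqrt (real n)"

definition Shat :: "nat \<Rightarrow> (int \<Rightarrow> nat) \<Rightarrow> (nat \<Rightarrow> real) \<Rightarrow> real" where
  "Shat n Ns lh = ((2 / real n) * (\<Sum>t=1..n. (lh t)\<^sup>2)) powr (-1/2) * That n Ns lh"

end

theory Submission
  imports Defs "HOL-Real_Asymp.Real_Asymp"
begin

text \<open>Write \<open>X t = (N t - \<lambda> t)\<^sup>2 - N t\<close>. Given the past, \<open>X t\<close> has mean \<open>0\<close> and variance \<open>2 (\<lambda> t)\<^sup>2\<close>, so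
  \<open>n\<^sup>-\<^sup>1\<^sup>/\<^sup>2 \<Sum> X t\<close> obeys a martingale central limit theorem. An exponential drift condition gives all
  moments, and contraction of the transition operator on Lipschitz functions gives the law of large
  numbers for \<open>(\<lambda> t)\<^sup>2\<close>.

  Replacing \<open>\<lambda> t\<close> by the plug-in intensity produces the cross term
  \<open>n\<^sup>-\<^sup>1\<^sup>/\<^sup>2 \<Sum> (N t - \<lambda> t) (\<lambda>hat t - \<lambda> t)\<close>, which is not a martingale because the estimator looks into
  the future; nor can one take a supremum over a net of parameters, as \<open>f\<close> is Lipschitz in the
  parameter only at \<open>\<theta>0\<close>. Instead, \<open>\<lambda>hat t - \<lambda> t\<close> is, up to small errors, a function of the last \<open>m\<close>
  counts and of the intensity \<open>m\<close> steps back rounded to a grid of mesh \<open>\<eta> / \<surd>n\<close>. This function is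
  \<open>O(n\<^sup>-\<^sup>1\<^sup>/\<^sup>2)\<close> and may depend on everything; the sum becomes \<open>n\<^sup>-\<^sup>1\<^sup>/\<^sup>2 \<Sum>\<^sub>c G c * M c\<close> over
  \<open>O(\<surd>n)\<close> cells \<open>c\<close>, where each \<open>M c\<close> is a martingale and \<open>\<Sum>\<^sub>c (M c)\<^sup>2 = O(n)\<close> in mean, whence
  \<open>\<Sum>\<^sub>c \<bar>M c\<bar> = O(n\<^sup>3\<^sup>/\<^sup>4)\<close> by Cauchy-Schwarz.\<close>

section \<open>Convergence in probability\<close>

text \<open>The estimator is arbitrary apart from its rate, so nothing is known about its dependence
  on the data; of the factor \<open>G c\<close> of a cell only a bound uniform in the cells is used.
  That bound is of order n^(-1/2) because the recursions with the true and the estimated parameter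
  are started from the same grid point and fed the same counts. The mesh must be of order n^(-1/2):
  a rounding error is committed in each of n terms and the sum is divided by sqrt n only. A mesh
  this fine still leaves O(sqrt n) cells, and n^(-1/2) n^(-1/2) n^(3/4) tends to 0. The constants
  are fixed in the order \<open>K\<close> (rate and initial values), \<open>m\<close> (forgetting),
  \<open>L\<close> (truncation, after \<open>m\<close>), \<open>\<eta>\<close> (mesh); n grows last.
  In the central limit theorem the conditional variances are random, so the exponentials are
  compensated by them, and the law of large numbers removes the compensator at the end. The
  condition on f(0,0) enters through the limit variance \<open>v\<close>: it must be positive for
  the normalisation to be continuous there.\<close>

text \<open>Small exceptional sets are used instead of the sets where the bound fails, since the latter need not be
  measurable and \<open>measure\<close> is \<open>0\<close> on nonmeasurable sets.\<close>

definition mostly :: "'w measure \<Rightarrow> real \<Rightarrow> (nat \<Rightarrow> 'w \<Rightarrow> bool) \<Rightarrow> bool" where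
  "mostly M e P \<longleftrightarrow> (\<forall>\<^sub>F n in sequentially. \<exists>B\<in>sets M. measure M B < e \<and> (\<forall>w\<in>space M - B. P n w))"

definition small_in_prob :: "'w measure \<Rightarrow> (nat \<Rightarrow> 'w \<Rightarrow> real) \<Rightarrow> bool" where
  "small_in_prob M X \<longleftrightarrow> (\<forall>e>0. mostly M e (\<lambda>n w. \<bar>X n w\<bar> < e))"

definition tight_in_prob :: "'w measure \<Rightarrow> (nat \<Rightarrow> 'w \<Rightarrow> real) \<Rightarrow> bool" where
  "tight_in_prob M X \<longleftrightarrow> (\<forall>e>0. \<exists>K>0. mostly M e (\<lambda>n w. \<bar>X n w\<bar> \<le> K))"

lemma mostly_mono:
  assumes "mostly M e P" "e \<le> e'" "\<forall>\<^sub>F n in sequentially. \<forall>w\<in>space M. P n w \<longrightarrow> Q n w"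
  shows "mostly M e' Q"
  using assms(1,3) unfolding mostly_def
  by eventually_elim (use assms(2) in \<open>metis DiffD1 order_less_le_trans\<close>)

lemma mostly_imp: "mostly M e P \<Longrightarrow> (\<And>n w. w \<in> space M \<Longrightarrow> P n w \<Longrightarrow> Q n w) \<Longrightarrow> mostly M e Q"
  by (erule mostly_mono) auto

text \<open>The definition ties the size of the variable and that of the exceptional set to one
  \<open>e\<close>; using it at \<open>min e d\<close> separates them.\<close>

lemma small_in_probD:
  assumes "small_in_prob M X" "e > 0" "d > 0"
  shows "mostly M e (\<lambda>n w. \<bar>X n w\<bar> < d)"
proof -
  have "0 < min e d" using assms by simp
  then have "mostly M (min e d) (\<lambda>n w. \<bar>X n w\<bar> < min e d)"
    using assms(1) unfolding small_in_prob_def by blast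
  then show ?thesis by (rule mostly_mono) auto
qed

context prob_space
begin

lemma mostly_conj:
  assumes "mostly M (e / 2) P" "mostly M (e / 2) Q"
  shows "mostly M e (\<lambda>n w. P n w \<and> Q n w)"
  using assms unfolding mostly_def
proof (eventually_elim, elim bexE conjE)
  fix n B B' assume B: "B \<in> events" "B' \<in> events" "prob B < e/2" "prob B' < e/2"
    "\<forall>w\<in>space M - B. P n w" "\<forall>w\<in>space M - B'. Q n w"
  have "prob (B \<union> B') \<le> prob B + prob B'" using B by (intro measure_Un_le) auto
  with B show "\<exists>B\<in>events. prob B < e \<and> (\<forall>w\<in>space M - B. P n w \<and> Q n w)"
    by (intro bexI[of _ "B \<union> B'"]) auto
qed

lemma small_in_prob_add:
  assumes "small_in_prob M X" "small_in_prob M Y"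
  shows "small_in_prob M (\<lambda>n w. X n w + Y n w)"
  unfolding small_in_prob_def
proof (intro allI impI)
  fix e :: real assume "e > 0"
  then have "mostly M e (\<lambda>n w. \<bar>X n w\<bar> < e/2 \<and> \<bar>Y n w\<bar> < e/2)"
    by (intro mostly_conj small_in_probD assms) auto
  then show "mostly M e (\<lambda>n w. \<bar>X n w + Y n w\<bar> < e)" by (rule mostly_imp) auto
qed

lemma small_in_prob_mult_tight:
  assumes "small_in_prob M X" "tight_in_prob M Y"
  shows "small_in_prob M (\<lambda>n w. X n w * Y n w)"
  unfolding small_in_prob_def
proof (intro allI impI)
  fix e :: real assume e: "e > 0"
  then obtain K where K: "K > 0" "mostly M (e / 2) (\<lambda>n w. \<bar>Y n w\<bar> \<le> K)"
    using assms(2) unfolding tight_in_prob_def by (meson half_gt_zero)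
  then have "mostly M e (\<lambda>n w. \<bar>X n w\<bar> < e / K \<and> \<bar>Y n w\<bar> \<le> K)"
    using e by (intro mostly_conj small_in_probD assms) auto
  then show "mostly M e (\<lambda>n w. \<bar>X n w * Y n w\<bar> < e)"
  proof (rule mostly_imp, elim conjE)
    fix n w assume x: "\<bar>X n w\<bar> < e / K" and y: "\<bar>Y n w\<bar> \<le> K"
    have "\<bar>X n w * Y n w\<bar> \<le> \<bar>X n w\<bar> * K" using y by (simp add: abs_mult mult_left_mono)
    also have "\<dots> < e" using x K by (simp add: field_simps)
    finally show "\<bar>X n w * Y n w\<bar> < e" .
  qed
qed

lemma tight_in_prob_small_add:
  assumes "small_in_prob M X" "tight_in_prob M Y"
  shows "tight_in_prob M (\<lambda>n w. X n w + Y n w)"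
  unfolding tight_in_prob_def
proof (intro allI impI)
  fix e :: real assume e: "e > 0"
  then obtain K where K: "K > 0" "mostly M (e / 2) (\<lambda>n w. \<bar>Y n w\<bar> \<le> K)"
    using assms(2) unfolding tight_in_prob_def by (meson half_gt_zero)
  then have "mostly M e (\<lambda>n w. \<bar>X n w\<bar> < 1 \<and> \<bar>Y n w\<bar> \<le> K)"
    using e by (intro mostly_conj small_in_probD assms) auto
  then have "mostly M e (\<lambda>n w. \<bar>X n w + Y n w\<bar> \<le> K + 1)" by (rule mostly_imp) auto
  with K(1) show "\<exists>K>0. mostly M e (\<lambda>n w. \<bar>X n w + Y n w\<bar> \<le> K)" by (intro exI[of _ "K + 1"]) auto
qed

lemma small_in_prob_cmult:
  assumes "small_in_prob M X"
  shows "small_in_prob M (\<lambda>n w. c * X n w)"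
proof -
  have "tight_in_prob M (\<lambda>n w. c)"
    unfolding tight_in_prob_def mostly_def
    by (intro allI impI exI[of _ "\<bar>c\<bar> + 1"] conjI always_eventually bexI[of _ "{}"]) auto
  from small_in_prob_mult_tight[OF assms this] show ?thesis by (simp add: mult.commute)
qed

lemma small_in_prob_mono:
  assumes "small_in_prob M Y" "\<forall>\<^sub>F n in sequentially. \<forall>w\<in>space M. \<bar>X n w\<bar> \<le> \<bar>Y n w\<bar>"
  shows "small_in_prob M X"
  unfolding small_in_prob_def
proof (intro allI impI)
  fix e :: real assume "e > 0"
  from small_in_probD[OF assms(1) this this] order_refl
  show "mostly M e (\<lambda>n w. \<bar>X n w\<bar> < e)"
    by (rule mostly_mono) (use assms(2) in \<open>eventually_elim, auto\<close>)
qed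

lemma small_in_prob_cong:
  assumes "small_in_prob M X" "\<forall>\<^sub>F n in sequentially. \<forall>w\<in>space M. Y n w = X n w"
  shows "small_in_prob M Y"
  by (rule small_in_prob_mono[OF assms(1)]) (use assms(2) in \<open>eventually_elim, auto\<close>)

lemma small_in_prob_continuous:
  fixes g :: "real \<Rightarrow> real"
  assumes "small_in_prob M (\<lambda>n w. X n w - a)" "isCont g a"
  shows "small_in_prob M (\<lambda>n w. g (X n w) - g a)"
  unfolding small_in_prob_def
proof (intro allI impI)
  fix e :: real assume e: "e > 0"
  from assms(2) e obtain d where d: "d > 0" "\<And>x. \<bar>x - a\<bar> < d \<Longrightarrow> \<bar>g x - g a\<bar> < e"
    unfolding continuous_at_eps_delta dist_real_def by metis
  from small_in_probD[OF assms(1) e d(1)] show "mostly M e (\<lambda>n w. \<bar>g (X n w) - g a\<bar> < e)"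
    by (rule mostly_imp) (rule d(2))
qed

lemma small_in_prob_deterministic:
  assumes "(a \<longlongrightarrow> 0) sequentially"
  shows "small_in_prob M (\<lambda>n w. a n)"
  unfolding small_in_prob_def mostly_def
proof (intro allI impI)
  fix e :: real assume e: "e > 0"
  have "\<forall>\<^sub>F n in sequentially. \<bar>a n\<bar> < e"
    using tendstoD[OF assms e] by (simp add: dist_real_def)
  then show "\<forall>\<^sub>F n in sequentially. \<exists>B\<in>events. prob B < e \<and> (\<forall>w\<in>space M - B. \<bar>a n\<bar> < e)"
    by (rule eventually_mono) (use e in \<open>auto intro!: bexI[of _ "{}"]\<close>)
qed

text \<open>\<open>X\<close> itself may be nonmeasurable, so Markov's inequality is applied to the
  dominating \<open>Q\<close>; one \<open>e\<close> pays for the failure of the domination, the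
  other for large values of \<open>Q\<close>.\<close>

lemma mostly_Markov:
  assumes "mostly M e (\<lambda>n w. \<bar>X n w\<bar> \<le> Q n w)"
    and Q: "\<forall>\<^sub>F n in sequentially. integrable M (Q n) \<and> (\<forall>w\<in>space M. 0 \<le> Q n w) \<and> expectation (Q n) \<le> A"
    and "0 < K" "A < e * K"
  shows "mostly M (2 * e) (\<lambda>n w. \<bar>X n w\<bar> < K)"
proof -
  have "mostly M e (\<lambda>n w. Q n w < K)"
    using Q unfolding mostly_def
  proof (eventually_elim, elim conjE)
    fix n assume Q: "integrable M (Q n)" "\<forall>w\<in>space M. 0 \<le> Q n w" "expectation (Q n) \<le> A"
    let ?B = "{w \<in> space M. K \<le> Q n w}"
    have [measurable]: "Q n \<in> borel_measurable M" using Q(1) by simp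
    have "prob ?B \<le> expectation (Q n) / K"
      using Q assms(3) by (intro integral_Markov_inequality_measure[where A="{}"]) (auto intro: AE_I2)
    also have "\<dots> \<le> A / K" using Q assms(3) by (intro divide_right_mono) auto
    also have "\<dots> < e" using assms(3,4) by (simp add: pos_divide_less_eq)
    finally show "\<exists>B\<in>events. prob B < e \<and> (\<forall>w\<in>space M - B. Q n w < K)"
      by (intro bexI[of _ ?B]) auto
  qed
  then have "mostly M (2 * e) (\<lambda>n w. \<bar>X n w\<bar> \<le> Q n w \<and> Q n w < K)"
    using assms(1) by (intro mostly_conj) auto
  then show ?thesis by (rule mostly_imp) auto
qed

text \<open>The dominating \<open>Q\<close> may depend on \<open>e\<close>. This is what the later
  estimates provide: they hold on an event whose constants deteriorate as its probability approaches
  1.\<close>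

lemma small_in_probI:
  assumes "\<And>e. e > 0 \<Longrightarrow> \<exists>Q. mostly M e (\<lambda>n w. \<bar>X n w\<bar> \<le> Q n w) \<and>
      (\<forall>\<^sub>F n in sequentially. integrable M (Q n) \<and> (\<forall>w\<in>space M. 0 \<le> Q n w) \<and> expectation (Q n) \<le> e)"
  shows "small_in_prob M X"
  unfolding small_in_prob_def
proof (intro allI impI)
  fix e :: real assume e: "e > 0"
  \<comment> \<open>Markov's inequality at level \<open>e\<close> with exceptional probability
    \<open>e / 2\<close> needs a mean strictly below \<open>e\<^sup>2 / 2\<close>; a third leaves
    the strictness.\<close>
  define d where "d = min (e / 2) (e\<^sup>2 / 3)"
  have d: "d > 0" "d \<le> e / 2" "d \<le> e\<^sup>2 / 3" using e by (auto simp: d_def)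
  obtain Q where Q: "mostly M d (\<lambda>n w. \<bar>X n w\<bar> \<le> Q n w)"
    "\<forall>\<^sub>F n in sequentially. integrable M (Q n) \<and> (\<forall>w\<in>space M. 0 \<le> Q n w) \<and> expectation (Q n) \<le> d"
    using assms[OF d(1)] by blast
  have "d < (e / 2) * e" using d(3) mult_pos_pos[OF e e] unfolding power2_eq_square by linarith
  with mostly_mono[OF Q(1) d(2)] Q(2) e have "mostly M (2 * (e / 2)) (\<lambda>n w. \<bar>X n w\<bar> < e)"
    by (intro mostly_Markov) auto
  then show "mostly M e (\<lambda>n w. \<bar>X n w\<bar> < e)" by simp
qed

lemma tight_in_probI:
  assumes "\<And>e. e > 0 \<Longrightarrow> \<exists>A Q. mostly M e (\<lambda>n w. \<bar>X n w\<bar> \<le> Q n w) \<and>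
      (\<forall>\<^sub>F n in sequentially. integrable M (Q n) \<and> (\<forall>w\<in>space M. 0 \<le> Q n w) \<and> expectation (Q n) \<le> A)"
  shows "tight_in_prob M X"
  unfolding tight_in_prob_def
proof (intro allI impI)
  fix e :: real assume e: "e > 0"
  then obtain A Q where Q: "mostly M (e / 2) (\<lambda>n w. \<bar>X n w\<bar> \<le> Q n w)"
    "\<forall>\<^sub>F n in sequentially. integrable M (Q n) \<and> (\<forall>w\<in>space M. 0 \<le> Q n w) \<and> expectation (Q n) \<le> A"
    using assms[of "e / 2"] by auto
  define K where "K = (\<bar>A\<bar> + 1) / (e / 2)"
  have K: "0 < K" "A < (e / 2) * K" using e by (auto simp: K_def add_nonneg_pos)
  with Q have "mostly M (2 * (e / 2)) (\<lambda>n w. \<bar>X n w\<bar> < K)" by (intro mostly_Markov)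
  then have "mostly M e (\<lambda>n w. \<bar>X n w\<bar> \<le> K)" by (auto elim: mostly_imp)
  with K(1) show "\<exists>K>0. mostly M e (\<lambda>n w. \<bar>X n w\<bar> \<le> K)" by blast
qed

lemma mostly_always: "0 < e \<Longrightarrow> (\<And>n w. w \<in> space M \<Longrightarrow> P n w) \<Longrightarrow> mostly M e P"
  unfolding mostly_def by (intro always_eventually allI bexI[of _ "{}"]) auto

lemma small_in_prob_L1:
  assumes "\<And>n. integrable M (Q n)" "\<And>n w. w \<in> space M \<Longrightarrow> \<bar>X n w\<bar> \<le> Q n w" "(\<lambda>n. expectation (Q n)) \<longlonglongrightarrow> 0"
  shows "small_in_prob M X"
proof (rule small_in_probI)
  fix e :: real assume e: "e > 0"
  have "\<forall>\<^sub>F n in sequentially. integrable M (Q n) \<and> (\<forall>w\<in>space M. 0 \<le> Q n w) \<and> expectation (Q n) \<le> e"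
    by (rule eventually_mono[OF order_tendstoD(2)[OF assms(3) e]])
       (use assms(1,2) in \<open>auto intro: order_trans[OF abs_ge_zero]\<close>)
  with assms(2) e show "\<exists>Q. mostly M e (\<lambda>n w. \<bar>X n w\<bar> \<le> Q n w) \<and>
      (\<forall>\<^sub>F n in sequentially. integrable M (Q n) \<and> (\<forall>w\<in>space M. 0 \<le> Q n w) \<and> expectation (Q n) \<le> e)"
    by (intro exI[of _ Q] conjI mostly_always)
qed

lemma tight_in_prob_L1:
  assumes "\<And>n. integrable M (Q n)" "\<And>n w. w \<in> space M \<Longrightarrow> \<bar>X n w\<bar> \<le> Q n w" "\<And>n. expectation (Q n) \<le> c"
  shows "tight_in_prob M X"
proof (rule tight_in_probI)
  fix e :: real assume e: "e > 0"
  have "\<forall>\<^sub>F n in sequentially. integrable M (Q n) \<and> (\<forall>w\<in>space M. 0 \<le> Q n w) \<and> expectation (Q n) \<le> c"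
    using assms by (intro always_eventually) (auto intro: order_trans[OF abs_ge_zero])
  with assms(2) e show "\<exists>A Q. mostly M e (\<lambda>n w. \<bar>X n w\<bar> \<le> Q n w) \<and>
      (\<forall>\<^sub>F n in sequentially. integrable M (Q n) \<and> (\<forall>w\<in>space M. 0 \<le> Q n w) \<and> expectation (Q n) \<le> A)"
    by (intro exI[of _ c] exI[of _ Q] conjI mostly_always)
qed

text \<open>Bounded convergence in probability: the integrand is below \<open>e\<close> off the
  exceptional set and below \<open>c\<close> on it, which costs at most
  \<open>e + c * e\<close>.\<close>

lemma small_in_prob_bounded_expectation:
  fixes D :: "nat \<Rightarrow> 'a \<Rightarrow> complex"
  assumes "small_in_prob M (\<lambda>n w. norm (D n w))" "\<And>n w. w \<in> space M \<Longrightarrow> norm (D n w) \<le> c"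
    "\<And>n. D n \<in> borel_measurable M"
  shows "(\<lambda>n. expectation (D n)) \<longlonglongrightarrow> 0"
proof (rule LIMSEQ_I)
  fix r :: real assume r: "r > 0"
  obtain w0 where "w0 \<in> space M" using not_empty by blast
  then have c: "c \<ge> 0" using order_trans[OF norm_ge_zero assms(2)[of w0 0]] by simp
  define e where "e = r / 2 / (c + 1)"
  have e: "e > 0" using r c by (simp add: e_def)
  have "\<forall>\<^sub>F n in sequentially. norm (expectation (D n)) < r"
  proof (rule eventually_mono[OF small_in_probD[OF assms(1) e e, unfolded mostly_def]], elim bexE conjE)
    fix n B assume B: "B \<in> sets M" "prob B < e" "\<forall>w\<in>space M - B. \<bar>norm (D n w)\<bar> < e"
    have "norm (expectation (D n)) \<le> expectation (\<lambda>w. norm (D n w))"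
      by (rule integral_norm_bound)
    also have "\<dots> \<le> expectation (\<lambda>w. e + c * indicator B w)"
    proof (rule integral_mono)
      show "integrable M (\<lambda>w. norm (D n w))"
        using assms(2,3) by (intro integrable_norm integrable_const_bound[where B=c]) auto
      show "integrable M (\<lambda>w. e + c * indicator B w)" using B by (intro Bochner_Integration.integrable_add) (auto simp: emeasure_eq_measure)
      show "norm (D n w) \<le> e + c * indicator B w" if "w \<in> space M" for w
        using B(3) that assms(2)[OF that, of n] e by (cases "w \<in> B") (auto intro: less_imp_le)
    qed
    also have "\<dots> = e + c * prob B" using B by (simp add: prob_space emeasure_eq_measure Int_absorb2 sets.sets_into_space)
    also have "\<dots> \<le> e + c * e" using B c by (intro add_left_mono mult_left_mono) auto
    also have "e + c * e = e * (c + 1)" by (simp add: algebra_simps)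
    also have "\<dots> = r / 2" using c by (intro iffD1[OF nonzero_eq_divide_eq e_def]) simp
    also have "\<dots> < r" using r by simp
    finally show "norm (expectation (D n)) < r" .
  qed
  then show "\<exists>no. \<forall>n\<ge>no. norm (expectation (D n) - 0) < r"
    by (simp add: eventually_sequentially)
qed

text \<open>Slutsky's argument on the side of characteristic functions: \<open>iexp\<close> is
  1-Lipschitz and bounded, so the two differ by the expectation of something bounded and small in
  probability.\<close>

lemma char_distr_small_diff:
  assumes [measurable]: "\<And>n. X n \<in> borel_measurable M" "\<And>n. Y n \<in> borel_measurable M"
    and "small_in_prob M (\<lambda>n w. X n w - Y n w)"
    and lim: "(\<lambda>n. char (distr M borel (Y n)) t) \<longlonglongrightarrow> l"
  shows "(\<lambda>n. char (distr M borel (X n)) t) \<longlonglongrightarrow> l"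
proof -
  let ?D = "\<lambda>n w. iexp (t * X n w) - iexp (t * Y n w)"
  have b: "norm (?D n w) \<le> \<bar>t * (X n w - Y n w)\<bar>" for n w
  proof -
    have "?D n w = iexp (t * Y n w) * (iexp (t * (X n w - Y n w)) - 1)"
      by (simp add: algebra_simps flip: exp_add)
    then have "norm (?D n w) = norm (iexp (t * (X n w - Y n w)) - 1)"
      by (simp add: norm_mult)
    also have "\<dots> \<le> \<bar>t * (X n w - Y n w)\<bar>"
      using iexp_approx1[of "t * (X n w - Y n w)" 0] by simp
    finally show ?thesis .
  qed
  have "small_in_prob M (\<lambda>n w. norm (?D n w))"
    by (rule small_in_prob_mono[OF small_in_prob_cmult[OF assms(3), of t]]) (use b in auto)
  then have "(\<lambda>n. expectation (?D n)) \<longlonglongrightarrow> 0"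
    by (rule small_in_prob_bounded_expectation[where c=2])
       (auto intro: order_trans[OF norm_triangle_ineq4])
  moreover have "expectation (?D n) = char (distr M borel (X n)) t - char (distr M borel (Y n)) t" for n
    unfolding char_def by (simp add: integral_distr integrable_iexp)
  ultimately have "(\<lambda>n. char (distr M borel (X n)) t - char (distr M borel (Y n)) t) \<longlonglongrightarrow> 0" by simp
  from tendsto_add[OF this lim] show ?thesis by simp
qed

lemma prob_tail_less:
  fixes Z :: "'a \<Rightarrow> real"
  assumes [measurable]: "Z \<in> borel_measurable M" and e: "0 < e"
  obtains K where "0 < K" "prob {w \<in> space M. K < Z w} < e"
proof -
  let ?A = "\<lambda>n. {w \<in> space M. real n < Z w}"
  have "(\<lambda>n. prob (?A n)) \<longlonglongrightarrow> prob (\<Inter>n. ?A n)"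
    by (rule finite_Lim_measure_decseq) (auto simp: decseq_def)
  moreover have "(\<Inter>n. ?A n) = {}"
    by (auto simp: set_eq_iff) (meson not_less real_arch_simple)
  ultimately have "\<forall>\<^sub>F n in sequentially. prob (?A n) < e"
    using e order_tendstoD(2)[of "\<lambda>n. prob (?A n)" 0 sequentially e] by simp
  then obtain n0 where "\<forall>n\<ge>n0. prob (?A n) < e" by (auto simp: eventually_sequentially)
  then have "prob (?A (Suc n0)) < e" by (rule allE[of _ "Suc n0"]) (simp del: of_nat_Suc)
  then show thesis by (intro that[of "real (Suc n0)"]) (auto simp del: of_nat_Suc)
qed

end

section \<open>A martingale central limit theorem\<close>

lemma abs_mult_le_sum_squares:
  fixes x y :: real
  shows "\<bar>x * y\<bar> \<le> x\<^sup>2 + y\<^sup>2"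
proof -
  have "2 * (\<bar>x\<bar> * \<bar>y\<bar>) \<le> x\<^sup>2 + y\<^sup>2"
    using sum_squares_bound[of "\<bar>x\<bar>" "\<bar>y\<bar>"] by (simp add: mult.assoc)
  moreover have "0 \<le> \<bar>x\<bar> * \<bar>y\<bar>" by simp
  ultimately have "\<bar>x\<bar> * \<bar>y\<bar> \<le> x\<^sup>2 + y\<^sup>2" by linarith
  then show ?thesis by (simp add: abs_mult)
qed

text \<open>Here \<open>1 - a\<close> plays the second-order expansion of a conditional
  characteristic function with \<open>a\<close> half the scaled conditional variance, and
  \<open>exp a\<close> its compensator; the estimate says that compensation fails only to second
  order in \<open>a\<close>.\<close>

lemma exp_minus_upper_quadratic:
  fixes a :: real
  assumes "a \<ge> 0"
  shows "\<bar>exp a * (1 - a) - 1\<bar> \<le> exp a * (a\<^sup>2 / 2)"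
proof -
  have u: "exp (-a) \<ge> 1 - a" using exp_ge_add_one_self[of "-a"] by simp
  have l: "exp (-a) \<le> 1 - a + a\<^sup>2 / 2"
  proof -
    let ?h = "\<lambda>x::real. 1 - x + x\<^sup>2 / 2 - exp (-x)"
    have "?h 0 \<le> ?h a"
    proof (rule DERIV_nonneg_imp_nondecreasing[OF assms])
      fix x :: real assume "0 \<le> x" "x \<le> a"
      show "\<exists>y. (?h has_real_derivative y) (at x) \<and> 0 \<le> y"
        using exp_ge_add_one_self[of "-x"]
        by (intro exI[of _ "-1 + x + exp (-x)"]) (auto intro!: derivative_eq_intros)
    qed
    then show ?thesis by simp
  qed
  have "exp a * (1 - a) - 1 = exp a * (1 - a - exp (-a))"
    by (simp add: algebra_simps flip: exp_add)
  then have "\<bar>exp a * (1 - a) - 1\<bar> = exp a * \<bar>1 - a - exp (-a)\<bar>"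
    by (simp add: abs_mult)
  also have "\<dots> \<le> exp a * (a\<^sup>2 / 2)" using u l by (intro mult_left_mono) auto
  finally show ?thesis .
qed

locale filtered_prob_space = prob_space M for M :: "'w measure" +
  fixes F :: "nat \<Rightarrow> 'w measure"
  assumes subalg: "\<And>t. subalgebra M (F t)"
    and filtration_Suc: "\<And>t. sets (F t) \<subseteq> sets (F (Suc t))"
begin

lemma sigma_finite_subalgebra: "sigma_finite_subalgebra M (F t)"
  by (intro finite_measure_subalgebra_is_sigma_finite)
     (simp add: finite_measure_subalgebra_def finite_measure_axioms finite_measure_subalgebra_axioms_def subalg)

lemma filtration_mono: "s \<le> t \<Longrightarrow> sets (F s) \<subseteq> sets (F t)"
  using lift_Suc_mono_le[of "\<lambda>t. sets (F t)"] filtration_Suc by blast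

lemma measurable_filtration_mono:
  "f \<in> measurable (F s) N \<Longrightarrow> s \<le> t \<Longrightarrow> f \<in> measurable (F t) N"
  using filtration_mono[of s t] subalg unfolding measurable_def subalgebra_def by auto

lemma measurable_filtration: "f \<in> measurable (F t) N \<Longrightarrow> f \<in> measurable M N"
  by (rule measurable_from_subalg[OF subalg])

lemma expectation_mult_cond_exp_eq:
  fixes G D E :: "'w \<Rightarrow> real"
  assumes "G \<in> borel_measurable (F t)" "AE w in M. real_cond_exp M (F t) D w = E w"
    "D \<in> borel_measurable M" "E \<in> borel_measurable M"
    "integrable M (\<lambda>w. G w * D w)"
  shows "expectation (\<lambda>w. G w * D w) = expectation (\<lambda>w. G w * E w)"
proof -
  interpret sigma_finite_subalgebra M "F t" by (rule sigma_finite_subalgebra)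
  have [measurable]: "G \<in> borel_measurable M" using assms(1) by (rule measurable_filtration)
  have [measurable]: "real_cond_exp M (F t) D \<in> borel_measurable M" by simp
  have "expectation (\<lambda>w. G w * D w) = expectation (\<lambda>w. G w * real_cond_exp M (F t) D w)"
    using assms by (intro real_cond_exp_intg(2)[symmetric]) auto
  also have "\<dots> = expectation (\<lambda>w. G w * E w)"
    using assms by (intro integral_cong_AE) auto
  finally show ?thesis .
qed

text \<open>\<open>real_cond_exp\<close> acts on real functions, so the bounded complex factor is
  split into its real and imaginary part.\<close>

lemma complex_expectation_mult_cond_exp_eq:
  fixes G :: "'w \<Rightarrow> complex" and D E :: "'w \<Rightarrow> real"
  assumes G: "G \<in> borel_measurable (F t)" "\<And>w. w \<in> space M \<Longrightarrow> norm (G w) \<le> c"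
    and c: "AE w in M. real_cond_exp M (F t) D w = E w"
    and D: "integrable M D" "integrable M E"
  shows "expectation (\<lambda>w. G w * of_real (D w)) = expectation (\<lambda>w. G w * of_real (E w))"
    and "integrable M (\<lambda>w. G w * of_real (D w))" and "integrable M (\<lambda>w. G w * of_real (E w))"
proof -
  have GM [measurable]: "G \<in> borel_measurable M" using G(1) by (rule measurable_filtration)
  have i: "integrable M (\<lambda>w. G w * of_real (D w))" if "integrable M D" for D :: "'w \<Rightarrow> real"
  proof (rule Bochner_Integration.integrable_bound[of M "\<lambda>w. c * D w"])
    show "AE w in M. norm (G w * complex_of_real (D w)) \<le> norm (c * D w)"
    proof (rule AE_I2)
      fix w assume w: "w \<in> space M"
      have "norm (G w) \<le> \<bar>c\<bar>" using G(2)[OF w] by linarith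
      then show "norm (G w * complex_of_real (D w)) \<le> norm (c * D w)"
        by (simp add: norm_mult abs_mult mult_right_mono)
    qed
  qed (use that in auto)
  show I: "integrable M (\<lambda>w. G w * of_real (D w))" "integrable M (\<lambda>w. G w * of_real (E w))"
    using D i by auto
  have r: "expectation (\<lambda>w. Re (G w) * D w) = expectation (\<lambda>w. Re (G w) * E w)"
    using G(1) D c integrable_Re[OF I(1)]
    by (intro expectation_mult_cond_exp_eq[where t=t]) auto
  have m: "expectation (\<lambda>w. Im (G w) * D w) = expectation (\<lambda>w. Im (G w) * E w)"
    using G(1) D c integrable_Im[OF I(1)]
    by (intro expectation_mult_cond_exp_eq[where t=t]) auto
  have "expectation (\<lambda>w. G w * of_real (D w)) =
      Complex (expectation (\<lambda>w. Re (G w) * D w)) (expectation (\<lambda>w. Im (G w) * D w))" if "integrable M (\<lambda>w. G w * of_real (D w))" for D :: "'w \<Rightarrow> real"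
    unfolding complex_eq_iff integral_Re[OF that, symmetric] integral_Im[OF that, symmetric] by simp
  with I r m show "expectation (\<lambda>w. G w * of_real (D w)) = expectation (\<lambda>w. G w * of_real (E w))"
    by simp
qed

text \<open>Orthogonality: the partial sum is known at time \<open>n\<close>, so its product with
  \<open>D n\<close> has mean 0. That product is integrable because it is dominated by the two
  squares.\<close>

lemma martingale_difference_sum_square:
  fixes D :: "nat \<Rightarrow> 'w \<Rightarrow> real"
  assumes meas: "\<And>t. D t \<in> borel_measurable (F (Suc t))"
    and zero: "\<And>t. AE w in M. real_cond_exp M (F t) (D t) w = 0"
    and sq: "\<And>t. integrable M (\<lambda>w. (D t w)\<^sup>2)"
  shows "integrable M (\<lambda>w. (\<Sum>t<n. D t w)\<^sup>2) \<and>
    expectation (\<lambda>w. (\<Sum>t<n. D t w)\<^sup>2) = (\<Sum>t<n. expectation (\<lambda>w. (D t w)\<^sup>2))"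
proof (induction n)
  case (Suc n)
  have [measurable]: "D t \<in> borel_measurable M" for t using meas by (rule measurable_filtration)
  let ?S = "\<lambda>w. \<Sum>t<n. D t w"
  have S: "?S \<in> borel_measurable (F n)"
    by (intro borel_measurable_sum measurable_filtration_mono[OF meas]) auto
  have [measurable]: "?S \<in> borel_measurable M" by simp
  have i: "integrable M (\<lambda>w. ?S w * D n w)"
  proof (rule Bochner_Integration.integrable_bound)
    show "integrable M (\<lambda>w. (?S w)\<^sup>2 + (D n w)\<^sup>2)"
      using Suc.IH sq[of n] by (intro Bochner_Integration.integrable_add) blast+
    show "AE w in M. norm (?S w * D n w) \<le> norm ((?S w)\<^sup>2 + (D n w)\<^sup>2)"
      by (intro AE_I2) (metis abs_mult_le_sum_squares abs_ge_self order_trans real_norm_def)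
  qed measurable
  have "expectation (\<lambda>w. ?S w * D n w) = expectation (\<lambda>w. ?S w * 0)"
    by (rule expectation_mult_cond_exp_eq[OF S zero _ _ i]) auto
  then have z: "expectation (\<lambda>w. ?S w * D n w) = 0" by simp
  have eq: "(\<Sum>t<Suc n. D t w)\<^sup>2 = (?S w)\<^sup>2 + (D n w)\<^sup>2 + 2 * (?S w * D n w)" for w
    by (simp add: power2_sum)
  note I = conjunct1[OF Suc.IH] sq[of n] i
  have "integrable M (\<lambda>w. (?S w)\<^sup>2 + (D n w)\<^sup>2 + 2 * (?S w * D n w))"
    using I by (intro Bochner_Integration.integrable_add integrable_mult_right)
  moreover have "expectation (\<lambda>w. (?S w)\<^sup>2 + (D n w)\<^sup>2 + 2 * (?S w * D n w)) =
      expectation (\<lambda>w. (?S w)\<^sup>2) + expectation (\<lambda>w. (D n w)\<^sup>2)"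
    using I z by simp
  ultimately show ?case unfolding eq using Suc.IH by simp
qed simp


text \<open>The stopped process: an increment \<open>X j\<close> only counts while the accumulated conditional variance
  is below \<open>b\<close>, so that the compensator in the exponential below stays bounded.\<close>

definition active :: "(nat \<Rightarrow> 'w \<Rightarrow> real) \<Rightarrow> real \<Rightarrow> nat \<Rightarrow> 'w \<Rightarrow> real" where
  "active s b j w = of_bool ((\<Sum>i\<le>j. s i w) \<le> b)"

definition stopped_sum :: "(nat \<Rightarrow> 'w \<Rightarrow> real) \<Rightarrow> real \<Rightarrow> (nat \<Rightarrow> 'w \<Rightarrow> real) \<Rightarrow> nat \<Rightarrow> 'w \<Rightarrow> real" where
  "stopped_sum s b X t w = (\<Sum>j<t. active s b j w * X j w)"

text \<open>With \<open>s\<close> the conditional variances, the second factor is the reciprocal of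
  a Gaussian characteristic function at the accumulated variance. The product is therefore nearly a
  martingale, started at 1.\<close>

definition exp_compensated :: "(nat \<Rightarrow> 'w \<Rightarrow> real) \<Rightarrow> real \<Rightarrow> (nat \<Rightarrow> 'w \<Rightarrow> real) \<Rightarrow> real \<Rightarrow> nat \<Rightarrow> 'w \<Rightarrow> complex" where
  "exp_compensated s b X u t w = iexp (u * stopped_sum s b X t w) * of_real (exp (u\<^sup>2 / 2 * stopped_sum s b s t w))"

text \<open>The test in \<open>active\<close> at \<open>j\<close> already includes
  \<open>s j\<close>, so accumulation ends before \<open>b\<close> is crossed and not one step
  later; there is no overshoot although single increments are unbounded.\<close>

lemma stopped_sum_bounds:
  assumes "\<And>j. 0 \<le> s j w" "0 \<le> b"
  shows "0 \<le> stopped_sum s b s t w" "stopped_sum s b s t w \<le> b"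
proof -
  show "0 \<le> stopped_sum s b s t w"
    unfolding stopped_sum_def active_def using assms by (intro sum_nonneg mult_nonneg_nonneg) auto
  show "stopped_sum s b s t w \<le> b"
  proof (induction t)
    case (Suc t)
    show ?case
    proof (cases "(\<Sum>i\<le>t. s i w) \<le> b")
      case True
      have "stopped_sum s b s (Suc t) w \<le> (\<Sum>j<Suc t. 1 * s j w)"
        unfolding stopped_sum_def active_def using assms by (intro sum_mono mult_right_mono) auto
      with True show ?thesis by (simp add: lessThan_Suc_atMost)
    next
      case False
      with Suc.IH show ?thesis by (simp add: stopped_sum_def active_def)
    qed
  qed (use assms in \<open>simp add: stopped_sum_def\<close>)
qed

text \<open>Expand \<open>iexp (u * X t)\<close> to second order. Conditionally on
  \<open>F t\<close> the linear term vanishes and the square may be replaced by \<open>s t\<close>;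
  the Taylor remainder costs a third moment of \<open>X t\<close>, the imperfect compensation a
  second moment of \<open>s t\<close>.\<close>

lemma exp_compensated_step:
  fixes X s :: "nat \<Rightarrow> 'w \<Rightarrow> real"
  assumes X: "\<And>t. X t \<in> borel_measurable (F (Suc t))"
    and s: "\<And>t. s t \<in> borel_measurable (F t)" "\<And>t w. w \<in> space M \<Longrightarrow> 0 \<le> s t w" and b: "0 \<le> b"
    and X3: "integrable M (\<lambda>w. \<bar>X t w\<bar> ^ 3)" "expectation (\<lambda>w. \<bar>X t w\<bar> ^ 3) \<le> B3"
    and s2: "integrable M (\<lambda>w. (s t w)\<^sup>2)" "expectation (\<lambda>w. (s t w)\<^sup>2) \<le> B2"
    and X1i: "integrable M (X t)" and X2i: "integrable M (\<lambda>w. (X t w)\<^sup>2)"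
    and cond: "AE w in M. real_cond_exp M (F t) (X t) w = 0"
      "AE w in M. real_cond_exp M (F t) (\<lambda>w. (X t w)\<^sup>2) w = s t w"
  shows "norm (expectation (exp_compensated s b X u (Suc t)) - expectation (exp_compensated s b X u t))
     \<le> exp (u\<^sup>2 * b / 2) * (\<bar>u\<bar> ^ 3 * B3 / 6 + u ^ 4 * B2 / 8)"
proof -
  define R where "R = exp (u\<^sup>2 * b / 2)"
  have XM [measurable]: "\<And>t. X t \<in> borel_measurable M" using X by (rule measurable_filtration)
  have sM [measurable]: "\<And>t. s t \<in> borel_measurable M" using s(1) by (rule measurable_filtration)
  have acF: "active s b j \<in> borel_measurable (F k)" if "j \<le> k" for j k
  proof -
    have [measurable]: "s i \<in> borel_measurable (F k)" if "i \<le> j" for i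
      using measurable_filtration_mono[OF s(1), of i k] that \<open>j \<le> k\<close> by simp
    have [measurable]: "(\<lambda>w. \<Sum>i\<le>j. s i w) \<in> borel_measurable (F k)"
      by (intro borel_measurable_sum) auto
    show ?thesis unfolding active_def by measurable
  qed
  have [measurable]: "active s b t \<in> borel_measurable (F t)" by (rule acF) simp
  have [measurable]: "s t \<in> borel_measurable (F t)" by (rule s(1))
  have SX [measurable]: "stopped_sum s b X t \<in> borel_measurable (F t)"
    unfolding stopped_sum_def
    by (intro borel_measurable_sum borel_measurable_times acF measurable_filtration_mono[OF X]) auto
  have Ss [measurable]: "stopped_sum s b s t \<in> borel_measurable (F t)"
    unfolding stopped_sum_def
    by (intro borel_measurable_sum borel_measurable_times acF measurable_filtration_mono[OF s(1)]) auto
  let ?I = "active s b t"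
  define Z where "Z = exp_compensated s b X u t"
  define a where "a w = u\<^sup>2 / 2 * s t w" for w
  \<comment> \<open>\<open>G\<close> is the next value without its new oscillating factor, on the
    event that step \<open>t\<close> is active. It is \<open>F t\<close>-measurable since
    \<open>s t\<close> and \<open>active s b t\<close> are.\<close>
  define G where "G w = Z w * of_real (exp (a w) * ?I w)" for w
  have aF [measurable]: "a \<in> borel_measurable (F t)" unfolding a_def by measurable
  have ZF [measurable]: "Z \<in> borel_measurable (F t)"
    unfolding Z_def exp_compensated_def by measurable
  have GF [measurable]: "G \<in> borel_measurable (F t)" unfolding G_def by measurable
  have I01: "?I w = 0 \<or> ?I w = 1" for w by (simp add: active_def)
  have a0: "0 \<le> a w" if "w \<in> space M" for w using s(2)[OF that] by (simp add: a_def)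
  have normZ: "norm (Z w) = exp (u\<^sup>2 / 2 * stopped_sum s b s t w)" for w
    by (simp add: Z_def exp_compensated_def norm_mult)
  \<comment> \<open>\<open>exp (a w)\<close> alone is unbounded; together with \<open>Z\<close> and
    the indicator it is the exponential of the stopped sum one step later, which is still at most
    \<open>b\<close>.\<close>
  have ZI: "norm (Z w) * exp (a w) * ?I w \<le> R" if w: "w \<in> space M" for w
  proof (cases "?I w = 0")
    case False
    then have I: "?I w = 1" using I01 by auto
    have "norm (Z w) * exp (a w) * ?I w = exp (u\<^sup>2 / 2 * stopped_sum s b s (Suc t) w)"
      using I by (simp add: normZ a_def stopped_sum_def algebra_simps flip: exp_add)
    also have "\<dots> \<le> R" unfolding R_def
      using stopped_sum_bounds(2)[of s w b "Suc t"] s(2)[OF w] b by (simp add: mult_left_mono)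
    finally show ?thesis .
  qed (simp add: R_def)
  have G_R: "norm (G w) \<le> R" if w: "w \<in> space M" for w
    using ZI[OF w] I01[of w] by (auto simp: G_def norm_mult)
  have ZR: "norm (Z w) \<le> R" if w: "w \<in> space M" for w
    unfolding normZ R_def
    using stopped_sum_bounds(2)[of s w b t] s(2)[OF w] b by (simp add: mult_left_mono)
  have ZM [measurable]: "Z \<in> borel_measurable M" and GM [measurable]: "G \<in> borel_measurable M" and aM [measurable]: "a \<in> borel_measurable M"
    and IM [measurable]: "?I \<in> borel_measurable M"
    by (rule measurable_filtration[OF ZF] measurable_filtration[OF GF] measurable_filtration[OF aF]
        measurable_filtration[OF acF[OF order_refl]])+
  have Zi: "integrable M Z"
    using ZR by (intro integrable_const_bound[where B=R]) auto
  have si: "integrable M (s t)" by (rule square_integrable_imp_integrable[OF _ s2(1)]) simp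
  define r where "r w = iexp (u * X t w) - (1 + \<i> * u * X t w - (u * X t w)\<^sup>2 / 2)" for w
  have rn: "norm (r w) \<le> \<bar>u\<bar> ^ 3 * \<bar>X t w\<bar> ^ 3 / 6" for w
  proof -
    have "r w = iexp (u * X t w) - (\<Sum>k \<le> 2. (\<i> * of_real (u * X t w)) ^ k / fact k)"
      by (simp add: r_def numeral_2_eq_2 power_mult_distrib power2_eq_square)
    then have "norm (r w) \<le> \<bar>u * X t w\<bar> ^ Suc 2 / fact (Suc 2)"
      using iexp_approx1[of "u * X t w" 2] by simp
    also have "\<dots> = \<bar>u\<bar> ^ 3 * \<bar>X t w\<bar> ^ 3 / 6"
      by (simp add: abs_mult power_mult_distrib fact_numeral flip: numeral_3_eq_3)
    finally show ?thesis .
  qed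
  have step: "exp_compensated s b X u (Suc t) w = Z w + G w * (iexp (u * X t w)) - Z w * ?I w" for w
    using I01[of w]
    by (auto simp: exp_compensated_def Z_def G_def stopped_sum_def a_def algebra_simps simp flip: exp_add of_real_mult)
  \<comment> \<open>What is left when \<open>iexp (u * X t)\<close> is replaced by
    \<open>1 - a\<close>; it factors as \<open>Z\<close> times the indicator times
    \<open>exp a * (1 - a) - 1\<close>.\<close>
  define q where "q w = G w * (1 - a w) - Z w * ?I w" for w
  \<comment> \<open>The middle group has expectation 0 by the two conditional moments, so only
    \<open>G * r\<close> and \<open>q\<close> contribute.\<close>
  have dec: "exp_compensated s b X u (Suc t) w - Z w =
     G w * r w + (\<i> * u * (G w * of_real (X t w)) + (- (u\<^sup>2 / 2)) * (G w * of_real ((X t w)\<^sup>2) - G w * of_real (s t w))) + q w" for w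
    unfolding step r_def q_def a_def by (simp add: algebra_simps power_mult_distrib)
  have qn: "norm (q w) \<le> R * (u ^ 4 / 8 * (s t w)\<^sup>2)" if w: "w \<in> space M" for w
  proof -
    have "q w = Z w * of_real (?I w) * of_real (exp (a w) * (1 - a w) - 1)"
      by (simp add: q_def G_def algebra_simps)
    then have "norm (q w) = norm (Z w) * ?I w * \<bar>exp (a w) * (1 - a w) - 1\<bar>"
      using I01[of w] by (auto simp only: norm_mult norm_of_real abs_zero abs_one)
    also have "\<dots> \<le> norm (Z w) * ?I w * (exp (a w) * ((a w)\<^sup>2 / 2))"
      using I01[of w] by (intro mult_left_mono exp_minus_upper_quadratic a0 w) auto
    also have "\<dots> = (norm (Z w) * exp (a w) * ?I w) * ((a w)\<^sup>2 / 2)" by simp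
    also have "\<dots> \<le> R * ((a w)\<^sup>2 / 2)" using ZI[OF w] by (intro mult_right_mono) auto
    also have "(a w)\<^sup>2 / 2 = u ^ 4 / 8 * (s t w)\<^sup>2" by (simp add: a_def power_mult_distrib power2_eq_square power4_eq_xxxx)
    finally show ?thesis .
  qed
  have Grn: "norm (G w * r w) \<le> R * (\<bar>u\<bar> ^ 3 * \<bar>X t w\<bar> ^ 3 / 6)" if "w \<in> space M" for w
    unfolding norm_mult using G_R[OF that] rn[of w] by (intro mult_mono) (auto simp: R_def)
  have iGr: "integrable M (\<lambda>w. G w * r w)"
  proof (rule Bochner_Integration.integrable_bound[of M "\<lambda>w. R * (\<bar>u\<bar> ^ 3 * \<bar>X t w\<bar> ^ 3 / 6)"])
    show "AE w in M. norm (G w * r w) \<le> norm (R * (\<bar>u\<bar> ^ 3 * \<bar>X t w\<bar> ^ 3 / 6))"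
      using Grn by (intro AE_I2) (auto intro: order_trans[OF _ abs_ge_self] simp only: real_norm_def)
    show "(\<lambda>w. G w * r w) \<in> borel_measurable M" unfolding r_def by measurable
  qed (use X3 in simp)
  have iq: "integrable M q"
  proof (rule Bochner_Integration.integrable_bound[of M "\<lambda>w. R * (u ^ 4 / 8 * (s t w)\<^sup>2)"])
    show "AE w in M. norm (q w) \<le> norm (R * (u ^ 4 / 8 * (s t w)\<^sup>2))"
      using qn by (intro AE_I2) (auto intro: order_trans[OF _ abs_ge_self])
    show "q \<in> borel_measurable M" unfolding q_def by measurable
  qed (use s2 in simp)
  note c1 = complex_expectation_mult_cond_exp_eq[OF GF G_R cond(1) X1i integrable_zero]
  note c2 = complex_expectation_mult_cond_exp_eq[OF GF G_R cond(2) X2i si]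
  have Zsi: "integrable M (exp_compensated s b X u (Suc t))"
  proof -
    have "integrable M (\<lambda>w. Z w + G w * (iexp (u * X t w)) - Z w * ?I w)"
    proof (rule integrable_const_bound[where B="3*R"])
      show "AE w in M. norm (Z w + G w * (iexp (u * X t w)) - Z w * ?I w) \<le> 3 * R"
      proof (rule AE_I2)
        fix w assume w: "w \<in> space M"
        have "norm (Z w + G w * (iexp (u * X t w)) - Z w * ?I w) \<le> norm (Z w) + norm (G w * (iexp (u * X t w))) + norm (Z w * ?I w)"
          by (intro order_trans[OF norm_triangle_ineq4] add_right_mono norm_triangle_ineq)
        also have "\<dots> \<le> R + R + R" using ZR[OF w] G_R[OF w] I01[of w]
          by (intro add_mono) (auto simp: norm_mult R_def)
        finally show "norm (Z w + G w * (iexp (u * X t w)) - Z w * ?I w) \<le> 3 * R" by simp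
      qed
    qed measurable
    then show ?thesis by (simp add: step[abs_def])
  qed
  have "expectation (exp_compensated s b X u (Suc t)) - expectation Z =
     expectation (\<lambda>w. exp_compensated s b X u (Suc t) w - Z w)"
    using Zsi Zi by simp
  also have "\<dots> = expectation (\<lambda>w. G w * r w) + expectation q"
    unfolding dec using iGr iq c1 c2 by simp
  finally have "norm (expectation (exp_compensated s b X u (Suc t)) - expectation Z)
     \<le> norm (expectation (\<lambda>w. G w * r w)) + norm (expectation q)"
    by (metis norm_triangle_ineq)
  also have "norm (expectation (\<lambda>w. G w * r w)) \<le> expectation (\<lambda>w. R * (\<bar>u\<bar> ^ 3 * \<bar>X t w\<bar> ^ 3 / 6))"
  proof (rule order_trans[OF integral_norm_bound integral_mono])
    show "norm (G w * r w) \<le> R * (\<bar>u\<bar> ^ 3 * \<bar>X t w\<bar> ^ 3 / 6)" if "w \<in> space M" for w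
      using Grn[OF that] .
  qed (use iGr X3 in auto)
  also have "\<dots> \<le> R * (\<bar>u\<bar> ^ 3 * B3 / 6)"
    using X3 by (simp add: R_def mult_left_mono)
  also have "norm (expectation q) \<le> expectation (\<lambda>w. R * (u ^ 4 / 8 * (s t w)\<^sup>2))"
    by (rule order_trans[OF integral_norm_bound integral_mono]) (use iq s2 qn in auto)
  also have "\<dots> \<le> R * (u ^ 4 / 8 * B2)"
    using s2 by (simp add: R_def mult_left_mono)
  finally show ?thesis unfolding Z_def R_def by (simp add: algebra_simps)
qed

text \<open>At frequency \<open>u / sqrt n\<close> each of the \<open>n\<close> steps changes the
  compensated expectation by O(n^(-3/2)), so it tends to 1. By the law of large numbers the
  compensator is asymptotically a constant, which can then be divided out.\<close>

theorem martingale_clt_char: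
  fixes X s :: "nat \<Rightarrow> 'w \<Rightarrow> real"
  assumes X: "\<And>t. X t \<in> borel_measurable (F (Suc t))"
    and s: "\<And>t. s t \<in> borel_measurable (F t)" "\<And>t w. w \<in> space M \<Longrightarrow> 0 \<le> s t w"
    and X3: "\<And>t. integrable M (\<lambda>w. \<bar>X t w\<bar> ^ 3)" "\<And>t. expectation (\<lambda>w. \<bar>X t w\<bar> ^ 3) \<le> B3"
    and s2: "\<And>t. integrable M (\<lambda>w. (s t w)\<^sup>2)" "\<And>t. expectation (\<lambda>w. (s t w)\<^sup>2) \<le> B2"
    and X1i: "\<And>t. integrable M (X t)" and X2i: "\<And>t. integrable M (\<lambda>w. (X t w)\<^sup>2)"
    and cond: "\<And>t. AE w in M. real_cond_exp M (F t) (X t) w = 0"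
      "\<And>t. AE w in M. real_cond_exp M (F t) (\<lambda>w. (X t w)\<^sup>2) w = s t w"
    and lln: "small_in_prob M (\<lambda>n w. (\<Sum>t<n. s t w) / real n - v)" and v: "0 \<le> v"
  shows "(\<lambda>n. char (distr M borel (\<lambda>w. (\<Sum>t<n. X t w) / sqrt (real n))) u)
     \<longlonglongrightarrow> complex_of_real (exp (- (u\<^sup>2 * v / 2)))"
proof -
  \<comment> \<open>The level \<open>real n * (v + 1)\<close> keeps the compensator below the
    constant \<open>R\<close> for every \<open>n\<close>, yet lies above the accumulated variance
    with probability tending to 1.\<close>
  define Z where "Z n = exp_compensated s (real n * (v + 1)) X (u / sqrt (real n)) n" for n
  define R where "R = exp (u\<^sup>2 * (v + 1) / 2)"
  have XM [measurable]: "\<And>t. X t \<in> borel_measurable M" using X by (rule measurable_filtration)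
  have sM [measurable]: "\<And>t. s t \<in> borel_measurable M" using s(1) by (rule measurable_filtration)
  have [measurable]: "stopped_sum s b f t \<in> borel_measurable M" if [measurable]: "\<And>j. f j \<in> borel_measurable M" for b f t
    unfolding stopped_sum_def active_def by measurable
  have ZM [measurable]: "Z n \<in> borel_measurable M" for n
    unfolding Z_def exp_compensated_def by measurable
  have normZ: "norm (Z n w) \<le> R" if w: "w \<in> space M" for n w
  proof (cases "n = 0")
    case False
    have "(u / sqrt (real n))\<^sup>2 / 2 * stopped_sum s (real n * (v + 1)) s n w \<le> (u / sqrt (real n))\<^sup>2 / 2 * (real n * (v + 1))"
      using stopped_sum_bounds(2)[of s w "real n * (v + 1)" n] s(2)[OF w] v by (intro mult_left_mono) auto
    also have "\<dots> = u\<^sup>2 * (v + 1) / 2" using False by (simp add: power_divide)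
    finally show ?thesis by (simp add: Z_def exp_compensated_def norm_mult R_def)
  qed (use v in \<open>simp add: Z_def exp_compensated_def stopped_sum_def R_def\<close>)
  have Zbound: "norm (expectation (Z n) - 1) \<le> R * (\<bar>u\<bar> ^ 3 * B3 / 6 / sqrt (real n) + u ^ 4 * B2 / 8 / real n)" if n: "n > 0" for n
  proof -
    let ?E = "\<lambda>t. expectation (exp_compensated s (real n * (v + 1)) X (u / sqrt (real n)) t)"
    have "exp_compensated s (real n * (v + 1)) X (u / sqrt (real n)) 0 = (\<lambda>w. 1)"
      by (simp add: fun_eq_iff exp_compensated_def stopped_sum_def)
    then have E0: "?E 0 = 1" by (simp add: prob_space)
    have "norm (?E n - ?E 0) = norm (\<Sum>t<n. ?E (Suc t) - ?E t)"
      by (subst sum_lessThan_telescope) simp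
    also have "\<dots> \<le> (\<Sum>t<n. norm (?E (Suc t) - ?E t))" by (rule norm_sum)
    also have "\<dots> \<le> (\<Sum>t<n. exp ((u / sqrt (real n))\<^sup>2 * (real n * (v + 1)) / 2) *
        (\<bar>u / sqrt (real n)\<bar> ^ 3 * B3 / 6 + (u / sqrt (real n)) ^ 4 * B2 / 8))"
      using v by (intro sum_mono exp_compensated_step X s X3 s2 X1i X2i cond) auto
    also have "\<dots> = real n * (R * (\<bar>u / sqrt (real n)\<bar> ^ 3 * B3 / 6 + (u / sqrt (real n)) ^ 4 * B2 / 8))"
      using n by (simp add: power_divide R_def)
    also have "\<dots> = R * (\<bar>u\<bar> ^ 3 * B3 / 6 / sqrt (real n) + u ^ 4 * B2 / 8 / real n)"
    proof -
      define h where "h = sqrt (real n)"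
      have h: "h > 0" "real n = h * h" using n by (auto simp: h_def)
      show ?thesis unfolding h_def[symmetric] h(2) using h(1)
        by (simp add: power_divide field_simps power3_eq_cube power4_eq_xxxx)
    qed
    finally show ?thesis unfolding E0 Z_def .
  qed
  have EZ: "(\<lambda>n. expectation (Z n)) \<longlonglongrightarrow> 1"
  proof (rule LIM_zero_cancel, rule Lim_null_comparison)
    show "\<forall>\<^sub>F n in sequentially. norm (expectation (Z n) - 1) \<le> R * (\<bar>u\<bar> ^ 3 * B3 / 6 / sqrt (real n) + u ^ 4 * B2 / 8 / real n)"
      using eventually_gt_at_top[of 0] by eventually_elim (rule Zbound)
    show "(\<lambda>n. R * (\<bar>u\<bar> ^ 3 * B3 / 6 / sqrt (real n) + u ^ 4 * B2 / 8 / real n)) \<longlonglongrightarrow> 0"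
      by real_asymp
  qed
  define T where "T n w = (\<Sum>t<n. X t w) / sqrt (real n)" for n w
  have TM [measurable]: "T n \<in> borel_measurable M" for n unfolding T_def by measurable
  \<comment> \<open>Once no step is stopped, \<open>D\<close> is a unimodular factor times a
    function of the average conditional variance that vanishes at \<open>v\<close>.\<close>
  define D where "D n w = iexp (u * T n w) - of_real (exp (- (u\<^sup>2 * v / 2))) * Z n w" for n w
  have DM: "D n \<in> borel_measurable M" for n unfolding D_def by measurable
  have "(\<lambda>n. expectation (D n)) \<longlonglongrightarrow> 0"
  proof (rule small_in_prob_bounded_expectation[OF _ _ DM])
    show "norm (D n w) \<le> 1 + R" if w: "w \<in> space M" for n w
    proof -
      have "norm (D n w) \<le> norm (iexp (u * T n w)) + norm (of_real (exp (- (u\<^sup>2 * v / 2))) * Z n w)"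
        unfolding D_def by (rule norm_triangle_ineq4)
      also have "\<dots> \<le> 1 + 1 * R" 
        unfolding norm_mult using normZ[OF w] v by (intro add_mono mult_mono) auto
      finally show ?thesis by simp
    qed
    define g where "g x = 1 - exp (u\<^sup>2 / 2 * (x - v))" for x :: real
    have small: "small_in_prob M (\<lambda>n w. g ((\<Sum>t<n. s t w) / real n) - g v)"
      by (rule small_in_prob_continuous[OF lln]) (auto simp: g_def intro!: continuous_intros)
    have gv: "g v = 0" by (simp add: g_def)
    show "small_in_prob M (\<lambda>n w. norm (D n w))"
      unfolding small_in_prob_def
    proof (intro allI impI)
      fix e :: real assume e: "e > 0"
      let ?V = "\<lambda>n w. (\<Sum>t<n. s t w) / real n"
      have "mostly M e (\<lambda>n w. \<bar>g (?V n w) - g v\<bar> < e \<and> \<bar>?V n w - v\<bar> < 1)"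
        using e by (intro mostly_conj small_in_probD[OF small] small_in_probD[OF lln]) auto
      then show "mostly M e (\<lambda>n w. \<bar>norm (D n w)\<bar> < e)"
      proof (rule mostly_mono[OF _ order_refl])
        show "\<forall>\<^sub>F n in sequentially. \<forall>w\<in>space M. \<bar>g (?V n w) - g v\<bar> < e \<and> \<bar>?V n w - v\<bar> < 1 \<longrightarrow> \<bar>norm (D n w)\<bar> < e"
          using eventually_gt_at_top[of 0]
        proof (eventually_elim, intro ballI impI, elim conjE)
          fix n w assume n: "0 < n" and w: "w \<in> space M" and near: "\<bar>g (?V n w) - g v\<bar> < e" "\<bar>?V n w - v\<bar> < 1"
          have "?V n w \<le> v + 1" using near(2) by linarith
          then have le: "(\<Sum>t<n. s t w) \<le> real n * (v + 1)" using n by (simp add: field_simps)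
          \<comment> \<open>The conditional variances are nonnegative, so a total below the level
            keeps all earlier partial sums below it.\<close>
          have ac: "active s (real n * (v + 1)) j w = 1" if "j < n" for j
          proof -
            have "(\<Sum>i\<le>j. s i w) \<le> (\<Sum>t<n. s t w)"
              using that s(2)[of w] w by (intro sum_mono2) auto
            then show ?thesis using le by (simp add: active_def)
          qed
          then have st: "stopped_sum s (real n * (v + 1)) f n w = (\<Sum>t<n. f t w)" for f
            by (simp add: stopped_sum_def)
          have Zeq: "Z n w = iexp (u * T n w) * of_real (exp (u\<^sup>2 / 2 * ?V n w))"
            using n by (simp add: Z_def exp_compensated_def st T_def power_divide)
          have "D n w = iexp (u * T n w) * of_real (g (?V n w))"
            unfolding D_def Zeq g_def by (simp add: algebra_simps flip: of_real_mult exp_add)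
          then have "norm (D n w) = \<bar>g (?V n w)\<bar>" by (simp add: norm_mult)
          with near(1) gv show "\<bar>norm (D n w)\<bar> < e" by simp
        qed
      qed
    qed
  qed
  moreover have "expectation (D n) = char (distr M borel (T n)) u - of_real (exp (- (u\<^sup>2 * v / 2))) * expectation (Z n)" for n
  proof -
    have "integrable M (Z n)" using normZ by (intro integrable_const_bound[where B=R]) auto
    then show ?thesis unfolding D_def char_def by (simp add: integral_distr integrable_iexp)
  qed
  ultimately have "(\<lambda>n. char (distr M borel (T n)) u - of_real (exp (- (u\<^sup>2 * v / 2))) * expectation (Z n)) \<longlonglongrightarrow> 0"
    by simp
  from tendsto_add[OF this tendsto_mult_left[OF EZ, of "of_real (exp (- (u\<^sup>2 * v / 2)))"]]
  show ?thesis by (simp add: T_def[abs_def])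
qed

end

section \<open>Poisson probabilities\<close>

lemma poisson_prob_nonneg: "0 \<le> l \<Longrightarrow> 0 \<le> poisson_prob l k"
  by (simp add: poisson_prob_def)

lemma poisson_prob_exp_sums:
  "(\<lambda>k. poisson_prob l k * exp (s * real k)) sums exp (l * (exp s - 1))"
proof -
  have "(\<lambda>k. (l * exp s) ^ k /\<^sub>R fact k) sums exp (l * exp s)" by (rule exp_converges)
  from sums_mult[OF this, of "exp (-l)"]
  have "(\<lambda>k. exp (-l) * ((l * exp s) ^ k /\<^sub>R fact k)) sums (exp (-l) * exp (l * exp s))" .
  moreover have "exp (-l) * ((l * exp s) ^ k /\<^sub>R fact k) = poisson_prob l k * exp (s * real k)" for k
    by (simp add: poisson_prob_def power_mult_distrib exp_of_nat2_mult field_simps)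
  moreover have "exp (-l) * exp (l * exp s) = exp (l * (exp s - 1))"
    by (simp add: algebra_simps flip: exp_add)
  ultimately show ?thesis by simp
qed

lemma poisson_prob_sums: "poisson_prob l sums 1"
  using poisson_prob_exp_sums[of l 0] by simp

text \<open>The weights satisfy \<open>k p(k) = l p(k - 1)\<close>. Iterating this on falling
  products of \<open>k\<close> yields the factorial moments.\<close>

lemma poisson_shift_sums:
  assumes "(\<lambda>k. poisson_prob l k * h k) sums S" "\<And>k. g (Suc k) = h k"
  shows "(\<lambda>k. poisson_prob l k * (real k * g k)) sums (l * S)"
proof -
  have "poisson_prob l (Suc k) * (real (Suc k) * g (Suc k)) = l * (poisson_prob l k * h k)" for k
    by (simp add: poisson_prob_def assms(2) del: of_nat_Suc)
  with sums_mult[OF assms(1), of l]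
  have "(\<lambda>k. poisson_prob l (Suc k) * (real (Suc k) * g (Suc k))) sums (l * S)" by simp
  from sums_Suc[OF this] show ?thesis by simp
qed

lemma poisson_power_sums:
  "(\<lambda>k. poisson_prob l k * real k) sums l"
  "(\<lambda>k. poisson_prob l k * real k ^ 2) sums (l^2 + l)"
  "(\<lambda>k. poisson_prob l k * real k ^ 3) sums (l^3 + 3 * l^2 + l)"
  "(\<lambda>k. poisson_prob l k * real k ^ 4) sums (l^4 + 6 * l^3 + 7 * l^2 + l)"
proof -
  have s0: "(\<lambda>k. poisson_prob l k * 1) sums 1" using poisson_prob_sums by simp
  have s1: "(\<lambda>k. poisson_prob l k * real k) sums l"
    using poisson_shift_sums[OF s0, of "\<lambda>_. 1"] by simp
  have s2: "(\<lambda>k. poisson_prob l k * (real k * (real k - 1))) sums (l * l)"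
    by (rule poisson_shift_sums[OF s1]) simp
  have s3: "(\<lambda>k. poisson_prob l k * (real k * ((real k - 1) * (real k - 1 - 1)))) sums (l * (l * l))"
    by (rule poisson_shift_sums[OF s2]) simp
  have s4: "(\<lambda>k. poisson_prob l k * (real k * ((real k - 1) * ((real k - 1 - 1) * (real k - 1 - 1 - 1))))) sums (l * (l * (l * l)))"
    by (rule poisson_shift_sums[OF s3]) simp
  show "(\<lambda>k. poisson_prob l k * real k) sums l" by (rule s1)
  have t2: "(\<lambda>k. poisson_prob l k * real k ^ 2) sums (l * l + l)"
    using sums_add[OF s2 s1] by (simp add: algebra_simps power2_eq_square)
  then show "(\<lambda>k. poisson_prob l k * real k ^ 2) sums (l^2 + l)" by (simp add: power2_eq_square)
  \<comment> \<open>Powers are recovered from falling products: \<open>k^3\<close> is the third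
    falling product plus \<open>3 k^2 - 2 k\<close>, and below, \<open>k^4\<close> is the fourth
    plus \<open>6 k^3 - 11 k^2 + 6 k\<close>.\<close>
  have t3: "(\<lambda>k. poisson_prob l k * real k ^ 3) sums (l * (l * l) + 3 * (l * l + l) - 2 * l)"
    using sums_diff[OF sums_add[OF s3 sums_mult[OF t2, of 3]] sums_mult[OF s1, of 2]]
    by (simp add: algebra_simps power2_eq_square power3_eq_cube)
  then show "(\<lambda>k. poisson_prob l k * real k ^ 3) sums (l^3 + 3 * l^2 + l)"
    by (simp add: power2_eq_square power3_eq_cube algebra_simps)
  show "(\<lambda>k. poisson_prob l k * real k ^ 4) sums (l^4 + 6 * l^3 + 7 * l^2 + l)"
    using sums_add[OF sums_diff[OF sums_add[OF s4 sums_mult[OF t3, of 6]] sums_mult[OF t2, of 11]] sums_mult[OF s1, of 6]]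
    by (simp add: algebra_simps power2_eq_square power3_eq_cube power4_eq_xxxx)
qed

lemma poisson_centered_sums:
  "(\<lambda>k. poisson_prob l k * (real k - l)) sums 0"
  "(\<lambda>k. poisson_prob l k * ((real k - l)\<^sup>2 - real k)) sums 0"
  "(\<lambda>k. poisson_prob l k * ((real k - l)\<^sup>2 - real k)\<^sup>2) sums (2 * l\<^sup>2)"
proof -
  note s = poisson_prob_sums[of l] poisson_power_sums[of l]
  show "(\<lambda>k. poisson_prob l k * (real k - l)) sums 0"
    using sums_diff[OF s(2) sums_mult[OF s(1), of l]] by (simp add: algebra_simps)
  have "(\<lambda>k. poisson_prob l k * real k ^ 2 - (2 * l + 1) * (poisson_prob l k * real k) + l\<^sup>2 * poisson_prob l k) sums
      ((l^2 + l) - (2 * l + 1) * l + l\<^sup>2 * 1)"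
    by (intro sums_add sums_diff sums_mult s)
  then show "(\<lambda>k. poisson_prob l k * ((real k - l)\<^sup>2 - real k)) sums 0"
    by (simp add: algebra_simps power2_eq_square)
  \<comment> \<open>The coefficients are those of the square of
    \<open>k^2 - (2 l + 1) k + l^2\<close>.\<close>
  have "(\<lambda>k. poisson_prob l k * real k ^ 4 - (4 * l + 2) * (poisson_prob l k * real k ^ 3) + (6 * l\<^sup>2 + 4 * l + 1) * (poisson_prob l k * real k ^ 2)
      - (4 * l ^ 3 + 2 * l\<^sup>2) * (poisson_prob l k * real k) + l ^ 4 * poisson_prob l k) sums
      ((l^4 + 6 * l^3 + 7 * l^2 + l) - (4 * l + 2) * (l^3 + 3 * l^2 + l) + (6 * l\<^sup>2 + 4 * l + 1) * (l^2 + l)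
       - (4 * l ^ 3 + 2 * l\<^sup>2) * l + l ^ 4 * 1)"
    by (intro sums_add sums_diff sums_mult s)
  then show "(\<lambda>k. poisson_prob l k * ((real k - l)\<^sup>2 - real k)\<^sup>2) sums (2 * l\<^sup>2)"
    by (simp add: algebra_simps power2_eq_square power3_eq_cube power4_eq_xxxx)
qed

lemma poisson_prob_summable_bounded:
  assumes "0 \<le> l" "\<And>k. \<bar>h k\<bar> \<le> b"
  shows "summable (\<lambda>k. poisson_prob l k * h k)" "\<bar>\<Sum>k. poisson_prob l k * h k\<bar> \<le> b"
proof -
  have b: "norm (poisson_prob l k * h k) \<le> poisson_prob l k * b" for k
    using assms poisson_prob_nonneg[OF assms(1)] by (simp add: abs_mult mult_left_mono)
  have s: "(\<lambda>k. poisson_prob l k * b) sums b" using sums_mult2[OF poisson_prob_sums, of l b] by simp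
  show "summable (\<lambda>k. poisson_prob l k * h k)"
    by (rule summable_comparison_test'[OF sums_summable[OF s], of 0]) (rule b)
  have "norm (\<Sum>k. poisson_prob l k * h k) \<le> (\<Sum>k. poisson_prob l k * b)"
    by (rule norm_suminf_le[OF b]) (use s in \<open>simp add: sums_iff\<close>)
  then show "\<bar>\<Sum>k. poisson_prob l k * h k\<bar> \<le> b" using s by (simp add: sums_iff)
qed

text \<open>Differentiating the weights in \<open>l\<close> turns the weighted sum of
  \<open>h\<close> into the weighted sum of the differences \<open>h (Suc k) - h k\<close>, and the
  mean value inequality applies.\<close>

lemma poisson_prob_lipschitz:
  assumes l: "0 \<le> l" "0 \<le> l'" and h: "\<And>k. \<bar>h k\<bar> \<le> b" "\<And>k. \<bar>h (Suc k) - h k\<bar> \<le> L"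
  shows "\<bar>(\<Sum>k. poisson_prob l k * h k) - (\<Sum>k. poisson_prob l' k * h k)\<bar> \<le> L * \<bar>l - l'\<bar>"
proof -
  define c where "c k = h k / fact k" for k :: nat
  have sm: "summable (\<lambda>k. c k * x ^ k)" if "\<And>k. \<bar>h k\<bar> \<le> b" "c = (\<lambda>k. h k / fact k)" for x :: real and c h :: "nat \<Rightarrow> real" and b
  proof (rule summable_comparison_test'[of "\<lambda>k. b * (\<bar>x\<bar> ^ k /\<^sub>R fact k)" 0])
    show "summable (\<lambda>k. b * (\<bar>x\<bar> ^ k /\<^sub>R fact k))" by (intro summable_mult summable_exp_generic)
    show "norm (c k * x ^ k) \<le> b * (\<bar>x\<bar> ^ k /\<^sub>R fact k)" for k
      using mult_right_mono[OF that(1)[of k], of "\<bar>x\<bar> ^ k"] that(2)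
      by (simp add: abs_mult power_abs divide_simps)
  qed
  have smc: "summable (\<lambda>k. c k * x ^ k)" for x by (rule sm[of h b c]) (use h(1) in \<open>simp_all add: c_def fun_eq_iff\<close>)
  have smd: "summable (\<lambda>k. diffs c k * x ^ k)" for x
    by (rule sm[of "\<lambda>k. h (Suc k)" b "diffs c"]) (use h(1) in \<open>auto simp: c_def diffs_def fun_eq_iff simp del: of_nat_Suc\<close>)
  define P where "P x = exp (-x) * (\<Sum>k. c k * x ^ k)" for x
  define P' where "P' x = - exp (-x) * (\<Sum>k. c k * x ^ k) + exp (-x) * (\<Sum>k. diffs c k * x ^ k)" for x
  have P: "(\<Sum>k. poisson_prob x k * h k) = P x" for x
    unfolding P_def using suminf_mult[OF smc, of "exp (-x)" x] by (simp add: c_def poisson_prob_def ac_simps)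
  have d: "(P has_field_derivative P' x) (at x within {0..})" for x
    unfolding P_def P'_def
    by (rule DERIV_subset[of _ _ _ UNIV])
       (auto intro!: derivative_eq_intros termdiffs_strong_converges_everywhere smc)
  have "norm (P' x) \<le> L" if x: "x \<in> {0..}" for x
  proof -
    have "P' x = exp (-x) * ((\<Sum>k. diffs c k * x ^ k) - (\<Sum>k. c k * x ^ k))"
      by (simp add: P'_def algebra_simps)
    also have "\<dots> = (\<Sum>k. exp (-x) * (diffs c k * x ^ k - c k * x ^ k))"
      unfolding suminf_diff[OF smd smc] by (rule suminf_mult[symmetric]) (intro summable_diff smd smc)
    also have "\<dots> = (\<Sum>k. poisson_prob x k * (h (Suc k) - h k))"
      by (simp add: c_def diffs_def poisson_prob_def algebra_simps diff_divide_distrib del: of_nat_Suc)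
    finally show ?thesis using poisson_prob_summable_bounded(2)[of x "\<lambda>k. h (Suc k) - h k" L] x h(2) by simp
  qed
  from field_differentiable_bound[OF _ d this, of l l'] l show ?thesis
    by (simp add: P)
qed

section \<open>The stationary Poisson autoregression\<close>

locale poisson_autoregression = prob_space M for M :: "'w measure" +
  fixes f :: "real \<Rightarrow> nat \<Rightarrow> real" and \<kappa>1 \<kappa>2 :: real
    and N :: "int \<Rightarrow> 'w \<Rightarrow> nat" and lam :: "int \<Rightarrow> 'w \<Rightarrow> real"
  assumes f_nonneg: "\<And>l y. 0 \<le> l \<Longrightarrow> 0 \<le> f l y"
    and kappa: "0 \<le> \<kappa>1" "0 \<le> \<kappa>2" "\<kappa>1 + \<kappa>2 < 1"
    and contraction: "\<And>l l' y y'. 0 \<le> l \<Longrightarrow> 0 \<le> l' \<Longrightarrow>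
        \<bar>f l y - f l' y'\<bar> \<le> \<kappa>1 * \<bar>l - l'\<bar> + \<kappa>2 * \<bar>real y - real y'\<bar>"
    and N_measurable [measurable]: "\<And>t. N t \<in> measurable M (count_space UNIV)"
    and lam_measurable [measurable]: "\<And>t. lam t \<in> borel_measurable M"
    and lam_nonneg: "\<And>t w. w \<in> space M \<Longrightarrow> 0 \<le> lam t w"
    and stationary: "strictly_stationary M (\<lambda>t w. (lam t w, real (N t w)))"
    and poisson: "\<And>t k A. A \<in> past_sets M lam N t \<Longrightarrow>
        measure M ({w \<in> space M. N t w = k} \<inter> A) = (\<integral>w. indicator A w * poisson_prob (lam t w) k \<partial>M)"
    and recursion: "\<And>t w. w \<in> space M \<Longrightarrow> lam t w = f (lam (t - 1) w) (N (t - 1) w)"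
    and f00: "0 < f 0 0"
begin

section \<open>The filtration of the past and conditioning on it\<close>

definition past :: "int \<Rightarrow> 'w measure" where
  "past t = sigma (space M)
     (\<Union>s\<in>{..t - 1}. {lam s -` B \<inter> space M | B. B \<in> sets borel}
                   \<union> {N s -` B \<inter> space M | B. B \<subseteq> (UNIV :: nat set)})"

lemma past_generators_sub: "(\<Union>s\<in>{..t - 1}. {lam s -` B \<inter> space M | B. B \<in> sets borel}
     \<union> {N s -` B \<inter> space M | B. B \<subseteq> (UNIV :: nat set)}) \<subseteq> sets M"
  using lam_measurable N_measurable by (auto intro: measurable_sets)

lemma space_past [simp]: "space (past t) = space M"
  unfolding past_def by (rule space_measure_of) (use past_generators_sub sets.sets_into_space in blast)

lemma sets_past: "sets (past t) = past_sets M lam N t"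
  unfolding past_def past_sets_def
  by (rule sets_measure_of) (use past_generators_sub sets.sets_into_space in blast)

lemma subalgebra_past: "subalgebra M (past t)"
  unfolding subalgebra_def sets_past past_sets_def
  using sets.sigma_sets_subset[OF past_generators_sub] by simp

lemma sets_past_subset: "sets (past t) \<subseteq> sets M"
  using subalgebra_past by (simp add: subalgebra_def)

lemma past_mono: "s \<le> t \<Longrightarrow> sets (past s) \<subseteq> sets (past t)"
  unfolding sets_past past_sets_def by (rule sigma_sets_mono', rule UN_mono) auto

lemma measurable_past_mono: "g \<in> measurable (past s) K \<Longrightarrow> s \<le> t \<Longrightarrow> g \<in> measurable (past t) K"
  using past_mono[of s t] unfolding measurable_def by auto

lemma N_past: assumes "s < t" shows "N s \<in> measurable (past t) (count_space UNIV)"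
proof (rule measurableI)
  fix B :: "nat set" assume "B \<in> sets (count_space UNIV)"
  have "N s -` B \<inter> space M \<in> past_sets M lam N t"
    unfolding past_sets_def using assms by (intro sigma_sets.Basic UN_I[of s]) auto
  then show "N s -` B \<inter> space (past t) \<in> sets (past t)" by (simp add: sets_past)
qed simp

lemma lam_past_less: assumes "s < t" shows "lam s \<in> borel_measurable (past t)"
proof (rule measurableI)
  fix B :: "real set" assume B: "B \<in> sets borel"
  have "lam s -` B \<inter> space M \<in> past_sets M lam N t"
    unfolding past_sets_def using assms B by (intro sigma_sets.Basic UN_I[of s]) auto
  then show "lam s -` B \<inter> space (past t) \<in> sets (past t)" by (simp add: sets_past)
qed simp

lemma continuous_on_f: "continuous_on {0..} (\<lambda>l. f l k)"
proof (rule continuous_onI)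
  fix x e :: real assume x: "x \<in> {0..}" and e: "e > 0"
  show "\<exists>d>0. \<forall>x'\<in>{0..}. dist x' x < d \<longrightarrow> dist (f x' k) (f x k) \<le> e"
  proof (intro exI[of _ e] conjI e ballI impI)
    fix x' assume x': "x' \<in> {0..}" "dist x' x < e"
    have "\<bar>f x' k - f x k\<bar> \<le> \<kappa>1 * \<bar>x' - x\<bar>" using contraction[of x' x k k] x x' by simp
    also have "\<dots> \<le> 1 * \<bar>x' - x\<bar>" using kappa by (intro mult_right_mono) auto
    finally show "dist (f x' k) (f x k) \<le> e" using x' by (simp add: dist_real_def)
  qed
qed

text \<open>Continuity of \<open>f\<close> in the intensity is known for nonnegative arguments only.
  Clipping with \<open>max 0\<close> gives a function on the whole line and changes nothing at
  \<open>lam\<close>, which is nonnegative.\<close>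

lemma f_measurable [measurable]: "(\<lambda>l. f (max 0 l) k) \<in> borel_measurable borel"
  by (intro borel_measurable_continuous_onI continuous_on_compose2[OF continuous_on_f[of k]])
     (auto intro!: continuous_intros)

text \<open>The generators of \<open>past t\<close> stop at time \<open>t - 1\<close>, so the case
  \<open>s = t\<close> rests on the recursion: \<open>lam t\<close> is predictable. Counts have
  countably many values, hence measurability in the intensity for each fixed count suffices.\<close>

lemma lam_past: assumes "s \<le> t" shows "lam s \<in> borel_measurable (past t)"
proof -
  have [measurable]: "lam (s - 1) \<in> borel_measurable (past t)" using assms by (intro lam_past_less) auto
  have n [measurable]: "N (s - 1) \<in> measurable (past t) (count_space UNIV)" using assms by (intro N_past) auto
  have m: "(\<lambda>w. f (max 0 (lam (s - 1) w)) k) \<in> borel_measurable (past t)" for k by measurable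
  have "(\<lambda>w. f (max 0 (lam (s - 1) w)) (N (s - 1) w)) \<in> borel_measurable (past t)"
    by (rule measurable_compose_countable[OF m n])
  moreover have e: "lam s w = f (max 0 (lam (s - 1) w)) (N (s - 1) w)" if "w \<in> space (past t)" for w
    using recursion[of w s] lam_nonneg[of w "s - 1"] that by (simp add: max_def)
  ultimately show ?thesis by (subst measurable_cong[OF e]) auto
qed

lemma sigma_finite_past: "sigma_finite_subalgebra M (past t)"
  by (intro finite_measure_subalgebra_is_sigma_finite)
     (simp add: finite_measure_subalgebra_def finite_measure_axioms finite_measure_subalgebra_axioms_def subalgebra_past)

lemma poisson_prob_measurable [measurable]: "(\<lambda>l. poisson_prob l k) \<in> borel_measurable borel"
  unfolding poisson_prob_def by measurable

lemma indicator_N_measurable [measurable]: "(\<lambda>w. indicator {k} (N t w) :: real) \<in> borel_measurable M"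
  by (rule measurable_compose[OF N_measurable]) simp

lemma integrable_poisson_prob: "integrable M (\<lambda>w. poisson_prob (lam t w) k)"
proof (rule integrable_const_bound[where B=1])
  show "AE w in M. norm (poisson_prob (lam t w) k) \<le> 1"
  proof (rule AE_I2)
    fix w assume "w \<in> space M"
    then have l: "0 \<le> lam t w" by (rule lam_nonneg)
    have "poisson_prob (lam t w) k = (\<Sum>j\<in>{k}. poisson_prob (lam t w) j)" by simp
    also have "\<dots> \<le> (\<Sum>j. poisson_prob (lam t w) j)"
      using poisson_prob_sums[of "lam t w"] poisson_prob_nonneg[OF l]
      by (intro sum_le_suminf) (auto simp: sums_iff)
    also have "\<dots> = 1" using poisson_prob_sums[of "lam t w"] by (simp add: sums_iff)
    finally show "norm (poisson_prob (lam t w) k) \<le> 1" using poisson_prob_nonneg[OF l, of k] by simp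
  qed
qed measurable

text \<open>The hypothesis \<open>poisson\<close>, tested on every event of \<open>past t\<close>,
  is the defining property of this conditional expectation.\<close>

lemma cond_exp_indicator_N:
  "AE w in M. real_cond_exp M (past t) (\<lambda>w. indicator {k} (N t w)) w = poisson_prob (lam t w) k"
proof -
  interpret sigma_finite_subalgebra M "past t" by (rule sigma_finite_past)
  have [measurable]: "lam t \<in> borel_measurable (past t)" by (rule lam_past) simp
  show ?thesis
  proof (rule real_cond_exp_charact)
    fix A assume A: "A \<in> sets (past t)"
    then have AM: "A \<in> sets M" using sets_past_subset by blast
    have "(\<integral>w\<in>A. indicator {k} (N t w) \<partial>M) = (\<integral>w. indicator ({w \<in> space M. N t w = k} \<inter> A) w \<partial>M)"
      unfolding set_lebesgue_integral_def by (intro Bochner_Integration.integral_cong) (auto split: split_indicator)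
    also have "\<dots> = measure M ({w \<in> space M. N t w = k} \<inter> A)"
      using AM by simp
    also have "\<dots> = (\<integral>w. indicator A w * poisson_prob (lam t w) k \<partial>M)"
      using A by (intro poisson) (simp add: sets_past)
    finally show "(\<integral>w\<in>A. indicator {k} (N t w) \<partial>M) = (\<integral>w\<in>A. poisson_prob (lam t w) k \<partial>M)"
      by (simp add: set_lebesgue_integral_def)
  next
    show "integrable M (\<lambda>w. indicator {k} (N t w) :: real)"
      by (rule integrable_const_bound[where B=1]) (auto split: split_indicator)
  qed (auto intro: integrable_poisson_prob)
qed

lemma expectation_indicator_N:
  fixes G :: "'w \<Rightarrow> real"
  assumes G: "G \<in> borel_measurable (past t)" and i: "integrable M (\<lambda>w. G w * indicator {k} (N t w))"
  shows "integrable M (\<lambda>w. G w * poisson_prob (lam t w) k)"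
    "expectation (\<lambda>w. G w * poisson_prob (lam t w) k) = expectation (\<lambda>w. G w * indicator {k} (N t w))"
proof -
  interpret sigma_finite_subalgebra M "past t" by (rule sigma_finite_past)
  have [measurable]: "G \<in> borel_measurable M" by (rule measurable_from_subalg[OF subalgebra_past G])
  note c = real_cond_exp_intg[OF i G]
  have ae: "AE w in M. G w * real_cond_exp M (past t) (\<lambda>w. indicator {k} (N t w)) w = G w * poisson_prob (lam t w) k"
    using cond_exp_indicator_N[of t k] by eventually_elim simp
  show "integrable M (\<lambda>w. G w * poisson_prob (lam t w) k)"
    by (rule integrable_cong_AE_imp[OF c(1)]) (use ae in auto)
  have "expectation (\<lambda>w. G w * poisson_prob (lam t w) k) = expectation (\<lambda>w. G w * real_cond_exp M (past t) (\<lambda>w. indicator {k} (N t w)) w)"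
    by (rule integral_cong_AE) (use ae in auto)
  then show "expectation (\<lambda>w. G w * poisson_prob (lam t w) k) = expectation (\<lambda>w. G w * indicator {k} (N t w))"
    using c(2) by simp
qed

text \<open>By Tonelli the extended sum has a finite integral, hence is finite almost
  everywhere.\<close>

lemma AE_summable:
  fixes b :: "nat \<Rightarrow> 'w \<Rightarrow> real"
  assumes b: "\<And>k. integrable M (b k)" and s: "summable (\<lambda>k. expectation (\<lambda>w. \<bar>b k w\<bar>))"
  shows "AE w in M. summable (\<lambda>k. \<bar>b k w\<bar>)"
proof -
  have [measurable]: "b k \<in> borel_measurable M" for k using b by simp
  have "(\<integral>\<^sup>+w. (\<Sum>k. ennreal \<bar>b k w\<bar>) \<partial>M) = (\<Sum>k. \<integral>\<^sup>+w. ennreal \<bar>b k w\<bar> \<partial>M)"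
    by (rule nn_integral_suminf) measurable
  also have "\<dots> = (\<Sum>k. ennreal (expectation (\<lambda>w. \<bar>b k w\<bar>)))"
    using b by (intro suminf_cong nn_integral_eq_integral) auto
  also have "\<dots> = ennreal (\<Sum>k. expectation (\<lambda>w. \<bar>b k w\<bar>))"
    by (rule suminf_ennreal2[OF integral_nonneg_AE s]) simp
  also have "\<dots> \<noteq> \<infinity>" by simp
  finally have "AE w in M. (\<Sum>k. ennreal \<bar>b k w\<bar>) \<noteq> \<infinity>"
    by (intro nn_integral_PInf_AE) auto
  then show ?thesis
    by eventually_elim (rule summable_suminf_not_top, auto)
qed

text \<open>Split \<open>H (N t w) w\<close> over the events \<open>N t w = k\<close>. Each piece
  needs just the conditional probability of one count and a past-measurable factor, so no joint
  conditional law has to be constructed.\<close>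

lemma expectation_poisson_disintegration:
  fixes H :: "nat \<Rightarrow> 'w \<Rightarrow> real"
  assumes H: "\<And>k. H k \<in> borel_measurable (past t)" and i: "integrable M (\<lambda>w. H (N t w) w)"
  shows "integrable M (\<lambda>w. \<Sum>k. poisson_prob (lam t w) k * H k w)"
    "expectation (\<lambda>w. \<Sum>k. poisson_prob (lam t w) k * H k w) = expectation (\<lambda>w. H (N t w) w)"
proof -
  have HM [measurable]: "H k \<in> borel_measurable M" for k by (rule measurable_from_subalg[OF subalgebra_past H])
  define a where "a k w = H k w * indicator {k} (N t w)" for k w
  define b where "b k w = H k w * poisson_prob (lam t w) k" for k w
  have aM [measurable]: "a k \<in> borel_measurable M" for k unfolding a_def by measurable
  have ai: "integrable M (a k)" for k
    by (rule Bochner_Integration.integrable_bound[OF i]) (auto simp: a_def split: split_indicator)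
  have bi: "integrable M (b k)" and ab: "expectation (b k) = expectation (a k)" for k
    using expectation_indicator_N[OF H, of k k] ai[of k] by (auto simp: a_def[abs_def] b_def[abs_def])
  have aai: "integrable M (\<lambda>w. \<bar>H k w\<bar> * indicator {k} (N t w))" for k
    using integrable_abs[OF ai[of k]] by (simp add: a_def abs_mult)
  have absb: "expectation (\<lambda>w. \<bar>b k w\<bar>) = expectation (\<lambda>w. \<bar>a k w\<bar>)" for k
  proof -
    have "expectation (\<lambda>w. \<bar>b k w\<bar>) = expectation (\<lambda>w. \<bar>H k w\<bar> * poisson_prob (lam t w) k)"
      by (intro Bochner_Integration.integral_cong) (auto simp: b_def abs_mult lam_nonneg poisson_prob_nonneg)
    also have "\<dots> = expectation (\<lambda>w. \<bar>H k w\<bar> * indicator {k} (N t w))"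
      using H[of k] aai by (intro expectation_indicator_N) auto
    finally show ?thesis by (simp add: a_def abs_mult)
  qed
  have asums: "(\<lambda>k. a k w) sums H (N t w) w" "(\<lambda>k. \<bar>a k w\<bar>) sums \<bar>H (N t w) w\<bar>" for w
  proof -
    have "(\<lambda>k. a k w) = (\<lambda>k. if k = N t w then H k w else 0)"
      by (auto simp: a_def fun_eq_iff split: split_indicator)
    then show "(\<lambda>k. a k w) sums H (N t w) w" using sums_single[of "N t w" "\<lambda>k. H k w"] by simp
    have "(\<lambda>k. \<bar>a k w\<bar>) = (\<lambda>k. if k = N t w then \<bar>H k w\<bar> else 0)"
      by (auto simp: a_def fun_eq_iff split: split_indicator)
    then show "(\<lambda>k. \<bar>a k w\<bar>) sums \<bar>H (N t w) w\<bar>" using sums_single[of "N t w" "\<lambda>k. \<bar>H k w\<bar>"] by simp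
  qed
  \<comment> \<open>For each outcome only one \<open>a k\<close> can be nonzero, so partial sums of
    the absolute values stay below that of \<open>H (N t w) w\<close>; this licenses both
    interchanges of sum and expectation.\<close>
  have suma: "summable (\<lambda>k. expectation (\<lambda>w. \<bar>a k w\<bar>))"
  proof (rule summableI_nonneg_bounded)
    show "0 \<le> expectation (\<lambda>w. \<bar>a k w\<bar>)" for k by (rule integral_nonneg_AE) auto
    show "(\<Sum>k<n. expectation (\<lambda>w. \<bar>a k w\<bar>)) \<le> expectation (\<lambda>w. \<bar>H (N t w) w\<bar>)" for n
    proof -
      have "(\<Sum>k<n. expectation (\<lambda>w. \<bar>a k w\<bar>)) = expectation (\<lambda>w. \<Sum>k<n. \<bar>a k w\<bar>)"
        using ai by simp
      also have "\<dots> \<le> expectation (\<lambda>w. \<bar>H (N t w) w\<bar>)"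
      proof (rule integral_mono)
        show "(\<Sum>k<n. \<bar>a k w\<bar>) \<le> \<bar>H (N t w) w\<bar>" for w
          using sum_le_suminf[of "\<lambda>k. \<bar>a k w\<bar>" "{..<n}"] asums(2)[of w] by (simp add: sums_iff)
      qed (use ai i in auto)
      finally show ?thesis .
    qed
  qed
  then have sumb: "summable (\<lambda>k. expectation (\<lambda>w. \<bar>b k w\<bar>))" by (simp add: absb)
  note aeb = AE_summable[OF bi sumb]
  have eq: "(\<Sum>k. poisson_prob (lam t w) k * H k w) = (\<Sum>k. b k w)" for w
    by (simp add: b_def mult.commute)
  show "integrable M (\<lambda>w. \<Sum>k. poisson_prob (lam t w) k * H k w)"
    unfolding eq by (rule integrable_suminf) (use bi aeb sumb in auto)
  have "expectation (\<lambda>w. \<Sum>k. b k w) = (\<Sum>k. expectation (b k))"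
    by (rule integral_suminf) (use bi aeb sumb in auto)
  also have "\<dots> = (\<Sum>k. expectation (a k))" by (simp add: ab)
  also have "\<dots> = expectation (\<lambda>w. \<Sum>k. a k w)"
    by (rule integral_suminf[symmetric]) (use ai suma asums(2) in \<open>auto simp: sums_iff\<close>)
  also have "\<dots> = expectation (\<lambda>w. H (N t w) w)"
    using asums(1) by (simp add: sums_iff)
  finally show "expectation (\<lambda>w. \<Sum>k. poisson_prob (lam t w) k * H k w) = expectation (\<lambda>w. H (N t w) w)"
    by (simp add: eq)
qed

text \<open>The disintegration applied to \<open>H\<close> multiplied by the indicator of an
  arbitrary past event.\<close>

lemma cond_exp_poisson:
  fixes H :: "nat \<Rightarrow> 'w \<Rightarrow> real"
  assumes H: "\<And>k. H k \<in> borel_measurable (past t)" and i: "integrable M (\<lambda>w. H (N t w) w)"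
  shows "AE w in M. real_cond_exp M (past t) (\<lambda>w. H (N t w) w) w = (\<Sum>k. poisson_prob (lam t w) k * H k w)"
proof -
  interpret sigma_finite_subalgebra M "past t" by (rule sigma_finite_past)
  have lm [measurable]: "lam t \<in> borel_measurable (past t)" by (rule lam_past) simp
  note [measurable] = H
  show ?thesis
  proof (rule real_cond_exp_charact)
    fix A assume A [measurable]: "A \<in> sets (past t)"
    then have AM: "A \<in> sets M" using sets_past_subset by blast
    have "integrable M (\<lambda>w. indicator A w * H (N t w) w)"
      using integrable_mult_indicator[OF AM i] by simp
    then have "expectation (\<lambda>w. \<Sum>k. poisson_prob (lam t w) k * (indicator A w * H k w)) = expectation (\<lambda>w. indicator A w * H (N t w) w)"
      by (intro expectation_poisson_disintegration) measurable
    moreover have "(\<Sum>k. poisson_prob (lam t w) k * (indicator A w * H k w)) = indicator A w * (\<Sum>k. poisson_prob (lam t w) k * H k w)" for w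
      by (auto split: split_indicator)
    ultimately show "(\<integral>w\<in>A. H (N t w) w \<partial>M) = (\<integral>w\<in>A. (\<Sum>k. poisson_prob (lam t w) k * H k w) \<partial>M)"
      by (simp add: set_lebesgue_integral_def)
  qed (use expectation_poisson_disintegration[OF H i] i in auto)
qed

text \<open>Strict stationarity for the one-point index set, followed by evaluation of the
  coordinate.\<close>

lemma stationary_marginal:
  "distr M borel (\<lambda>w. (lam t w, real (N t w))) = distr M borel (\<lambda>w. (lam 0 w, real (N 0 w)))"
proof -
  let ?X = "\<lambda>t w. (lam t w, real (N t w))"
  have Xm [measurable]: "?X t \<in> borel_measurable M" for t by measurable
  have "distr M borel (?X t) = distr (distr M (PiM {0} (\<lambda>_. borel)) (\<lambda>w. \<lambda>i\<in>{0}. ?X (i + t) w)) borel (\<lambda>x. x 0)" for t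
    by (subst distr_distr) (auto simp: comp_def intro!: measurable_restrict)
  from this[of t] this[of 0] show ?thesis
    using stationary[unfolded strictly_stationary_def, rule_format, of "{0}" t] by simp
qed

lemma stationary_expectation:
  fixes g :: "real \<times> real \<Rightarrow> real"
  assumes g: "g \<in> borel_measurable (borel \<Otimes>\<^sub>M borel)"
  shows "expectation (\<lambda>w. g (lam t w, real (N t w))) = expectation (\<lambda>w. g (lam 0 w, real (N 0 w)))"
    "integrable M (\<lambda>w. g (lam t w, real (N t w))) \<longleftrightarrow> integrable M (\<lambda>w. g (lam 0 w, real (N 0 w)))"
proof -
  have [measurable]: "g \<in> borel_measurable borel" using g by (simp add: borel_prod)
  have e: "expectation (\<lambda>w. g (lam t w, real (N t w))) = integral\<^sup>L (distr M borel (\<lambda>w. (lam t w, real (N t w)))) g" for t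
    by (rule integral_distr[symmetric]) measurable
  have i: "integrable M (\<lambda>w. g (lam t w, real (N t w))) \<longleftrightarrow> integrable (distr M borel (\<lambda>w. (lam t w, real (N t w)))) g" for t
    by (rule integrable_distr_eq[symmetric]) measurable
  show "expectation (\<lambda>w. g (lam t w, real (N t w))) = expectation (\<lambda>w. g (lam 0 w, real (N 0 w)))"
    "integrable M (\<lambda>w. g (lam t w, real (N t w))) \<longleftrightarrow> integrable M (\<lambda>w. g (lam 0 w, real (N 0 w)))"
    unfolding e i by (simp_all add: stationary_marginal[of t])
qed

end

section \<open>Moments of the stationary process\<close>

lemma power_le_fact_exp:
  fixes x :: real
  assumes "0 \<le> x"
  shows "x ^ p \<le> fact p * exp x"
proof -
  have "(\<Sum>k\<in>{p}. x ^ k /\<^sub>R fact k) \<le> (\<Sum>k. x ^ k /\<^sub>R fact k)"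
    using assms by (intro sum_le_suminf summable_exp_generic) auto
  also have "\<dots> = exp x" using exp_converges[of x] by (simp add: sums_iff)
  finally show ?thesis by (simp add: field_simps)
qed

text \<open>Monotone convergence, used to pass from truncated moment bounds to integrability of the
  untruncated variable.\<close>

lemma (in prob_space) integrable_incseq_bounded:
  fixes h :: "nat \<Rightarrow> 'a \<Rightarrow> real"
  assumes h: "\<And>n. integrable M (h n)" "\<And>n w. w \<in> space M \<Longrightarrow> 0 \<le> h n w" "\<And>n w. w \<in> space M \<Longrightarrow> h n w \<le> h (Suc n) w"
    and lim: "\<And>w. w \<in> space M \<Longrightarrow> (\<lambda>n. h n w) \<longlonglongrightarrow> V w"
    and b: "\<And>n. expectation (h n) \<le> c"
  shows "integrable M V"
proof -
  have hM [measurable]: "h n \<in> borel_measurable M" for n using h(1) by simp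
  have V: "V \<in> borel_measurable M" by (rule borel_measurable_LIMSEQ_real[OF lim hM])
  have V0: "0 \<le> V w" if "w \<in> space M" for w
    by (rule LIMSEQ_le_const[OF lim[OF that]]) (use h(2) that in auto)
  have "(\<lambda>n. \<integral>\<^sup>+w. ennreal (h n w) \<partial>M) \<longlonglongrightarrow> (\<integral>\<^sup>+w. ennreal (V w) \<partial>M)"
  proof -
    \<comment> \<open>Monotonicity and convergence are assumed on \<open>space M\<close> only; the
      indicator makes them hold everywhere.\<close>
    have "(\<lambda>n. \<integral>\<^sup>+w. ennreal (h n w) * indicator (space M) w \<partial>M) \<longlonglongrightarrow> (\<integral>\<^sup>+w. ennreal (V w) * indicator (space M) w \<partial>M)"
    proof (rule nn_integral_LIMSEQ)
      show "incseq (\<lambda>n w. ennreal (h n w) * indicator (space M) w)"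
        using h(3) by (intro incseq_SucI) (auto simp: le_fun_def ennreal_leI split: split_indicator)
      show "(\<lambda>n. ennreal (h n w) * indicator (space M) w) \<longlonglongrightarrow> ennreal (V w) * indicator (space M) w" for w
        using lim[of w] by (cases "w \<in> space M") auto
    qed measurable
    then show ?thesis by (simp add: nn_integral_cong[where v="\<lambda>w. ennreal (g w) * indicator (space M) w" and u="\<lambda>w. ennreal (g w)" for g, symmetric])
  qed
  moreover have "(\<integral>\<^sup>+w. ennreal (h n w) \<partial>M) \<le> ennreal c" for n
    using h b[of n] by (subst nn_integral_eq_integral) (auto intro: ennreal_leI)
  ultimately have "(\<integral>\<^sup>+w. ennreal (V w) \<partial>M) \<le> ennreal c"
    by (intro LIMSEQ_le_const2) auto
  then have "(\<integral>\<^sup>+w. ennreal (V w) \<partial>M) < \<infinity>" by (auto simp: less_top[symmetric] top_unique)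
  then show ?thesis using V V0 by (intro integrableI_nonneg) auto
qed

context poisson_autoregression
begin

lemma f_growth:
  assumes "0 \<le> l"
  shows "f l y \<le> f 0 0 + \<kappa>1 * l + \<kappa>2 * real y"
  using contraction[of l 0 y 0] assms by simp

lemma measurable_f_lam: "s \<le> t \<Longrightarrow> (\<lambda>w. f (max 0 (lam s w)) k) \<in> borel_measurable (past t)"
  using measurable_compose[OF lam_past f_measurable] by auto

lemma recursion_Suc: "w \<in> space M \<Longrightarrow> lam (t + 1) w = f (max 0 (lam t w)) (N t w)"
  using recursion[of w "t + 1"] lam_nonneg[of w t] by (simp add: max_def)

text \<open>A Lyapunov condition for \<open>exp (s * l)\<close>: linear growth of \<open>f\<close>
  and the Poisson moment generating function give one step the exponent
  \<open>s * f 0 0 + s * \<kappa> * l\<close> with \<open>\<kappa> < 1\<close>. The minimum with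
  \<open>K\<close> is kept because integrability is not yet known.\<close>

lemma exponential_drift:
  obtains s :: real and \<phi> :: "real \<Rightarrow> real" and b :: real where "0 < s"
    "\<And>l K. 0 \<le> l \<Longrightarrow> 0 < K \<Longrightarrow> (\<Sum>k. poisson_prob l k * min (exp (s * f l k)) K) \<le> min (\<phi> l) K"
    "\<And>l. 0 \<le> l \<Longrightarrow> \<phi> l \<le> exp (s * l) / 2 + b" "0 \<le> b" "\<phi> \<in> borel_measurable borel" "\<And>l. 0 \<le> \<phi> l"
proof -
  \<comment> \<open>To second order \<open>exp (s * \<kappa>2) - 1\<close> exceeds
    \<open>s * \<kappa>2\<close> by at most \<open>s\<^sup>2\<close>; half the gap
    \<open>1 - \<kappa>1 - \<kappa>2\<close> absorbs this and keeps \<open>\<kappa>\<close> below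
    1.\<close>
  define s where "s = (1 - \<kappa>1 - \<kappa>2) / 2"
  define \<kappa> where "\<kappa> = \<kappa>1 + \<kappa>2 + s"
  have s: "0 < s" "s \<le> 1" using kappa by (auto simp: s_def)
  have k: "\<kappa> < 1" "0 \<le> \<kappa>" using kappa s by (auto simp: \<kappa>_def s_def field_simps)
  have es: "exp (s * \<kappa>2) - 1 \<le> s * (\<kappa>2 + s)"
  proof -
    have "s * \<kappa>2 \<le> s * 1" using s kappa by (intro mult_left_mono) auto
    then have le: "s * \<kappa>2 \<le> s" by simp
    have "exp (s * \<kappa>2) \<le> 1 + s * \<kappa>2 + (s * \<kappa>2)\<^sup>2"
      using s kappa order_trans[OF le s(2)] by (intro exp_bound) auto
    also have "(s * \<kappa>2)\<^sup>2 \<le> s\<^sup>2" using s kappa le by (intro power_mono) auto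
    finally show ?thesis by (simp add: algebra_simps power2_eq_square)
  qed
  define \<phi> where "\<phi> l = exp (s * f 0 0 + s * \<kappa> * l)" for l :: real
  \<comment> \<open>Beyond \<open>l1\<close> the exponent falls by at least 1 in a step, and
    \<open>exp (- 1)\<close> is at most one half; below \<open>l1\<close> the value is bounded by
    \<open>b\<close>.\<close>
  define l1 where "l1 = (f 0 0 + 1 / s) / (1 - \<kappa>)"
  define b where "b = \<phi> l1"
  have kernel: "(\<Sum>k. poisson_prob l k * min (exp (s * f l k)) K) \<le> min (\<phi> l) K" if l: "0 \<le> l" and K: "0 < K" for l K
  proof (rule min.boundedI)
    have sm: "summable (\<lambda>k. poisson_prob l k * min (exp (s * f l k)) K)"
      and "\<bar>\<Sum>k. poisson_prob l k * min (exp (s * f l k)) K\<bar> \<le> K"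
      using poisson_prob_summable_bounded[OF l, of "\<lambda>k. min (exp (s * f l k)) K" K] K by auto
    then show "(\<Sum>k. poisson_prob l k * min (exp (s * f l k)) K) \<le> K" by simp
    have S: "(\<lambda>k. exp (s * f 0 0 + s * \<kappa>1 * l) * (poisson_prob l k * exp (s * \<kappa>2 * real k))) sums
       (exp (s * f 0 0 + s * \<kappa>1 * l) * exp (l * (exp (s * \<kappa>2) - 1)))"
      by (intro sums_mult poisson_prob_exp_sums)
    have "(\<Sum>k. poisson_prob l k * min (exp (s * f l k)) K) \<le> (\<Sum>k. exp (s * f 0 0 + s * \<kappa>1 * l) * (poisson_prob l k * exp (s * \<kappa>2 * real k)))"
    proof (rule suminf_le[OF _ sm sums_summable[OF S]])
      fix k
      have "min (exp (s * f l k)) K \<le> exp (s * f l k)" by simp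
      also have "\<dots> \<le> exp (s * (f 0 0 + \<kappa>1 * l + \<kappa>2 * real k))"
        using f_growth[OF l] s by (simp add: mult_left_mono)
      also have "\<dots> = exp (s * f 0 0 + s * \<kappa>1 * l) * exp (s * \<kappa>2 * real k)"
        by (simp add: algebra_simps flip: exp_add)
      finally have "poisson_prob l k * min (exp (s * f l k)) K \<le> poisson_prob l k * (exp (s * f 0 0 + s * \<kappa>1 * l) * exp (s * \<kappa>2 * real k))"
        using poisson_prob_nonneg[OF l] by (intro mult_left_mono)
      then show "poisson_prob l k * min (exp (s * f l k)) K \<le> exp (s * f 0 0 + s * \<kappa>1 * l) * (poisson_prob l k * exp (s * \<kappa>2 * real k))"
        by (simp add: ac_simps)
    qed
    also have "\<dots> = exp (s * f 0 0 + s * \<kappa>1 * l + l * (exp (s * \<kappa>2) - 1))"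
      using S by (simp add: sums_iff exp_add)
    also have "\<dots> \<le> \<phi> l"
    proof -
      have "l * (exp (s * \<kappa>2) - 1) \<le> l * (s * (\<kappa>2 + s))" using es l by (intro mult_left_mono)
      then show ?thesis by (simp add: \<phi>_def \<kappa>_def algebra_simps)
    qed
    finally show "(\<Sum>k. poisson_prob l k * min (exp (s * f l k)) K) \<le> \<phi> l" .
  qed
  have drift: "\<phi> l \<le> exp (s * l) / 2 + b" if "0 \<le> l" for l
  proof (cases "l \<ge> l1")
    case True
    then have "f 0 0 + 1 / s \<le> l * (1 - \<kappa>)" using k by (simp add: l1_def field_simps)
    then have "s * (f 0 0 + 1 / s) \<le> s * (l * (1 - \<kappa>))" using s by (intro mult_left_mono) auto
    then have "s * f 0 0 + s * \<kappa> * l \<le> s * l - 1" using s by (simp add: algebra_simps)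
    then have "\<phi> l \<le> exp (s * l - 1)" by (simp add: \<phi>_def)
    also have "\<dots> = exp (s * l) / exp 1" by (simp add: exp_diff)
    also have "\<dots> \<le> exp (s * l) / 2" using exp_ge_add_one_self[of 1] by (intro divide_left_mono) auto
    finally have "\<phi> l \<le> exp (s * l) / 2" .
    moreover have "0 \<le> b" by (simp add: b_def \<phi>_def)
    ultimately show ?thesis by linarith
  next
    case False
    then have "\<phi> l \<le> b" using s k by (simp add: b_def \<phi>_def mult_left_mono)
    then show ?thesis by (simp add: add_increasing)
  qed
  have "\<phi> \<in> borel_measurable borel" unfolding \<phi>_def[abs_def] by measurable
  then show thesis
    by (intro that[of s \<phi> b]) (use s kernel drift in \<open>auto simp: \<phi>_def b_def\<close>)
qed

text \<open>By stationarity \<open>min V K\<close> has the same mean one step later. Comparing the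
  two through the drift cancels this finite mean and leaves a bound on the truncated moment of
  \<open>V\<close> that does not depend on \<open>K\<close>; without truncation the cancellation
  could be infinite minus infinite.\<close>

lemma exponential_moment:
  obtains s :: real where "0 < s" "\<And>t. integrable M (\<lambda>w. exp (s * lam t w))"
proof -
  obtain s \<phi> b where s: "0 < s"
    and kernel: "\<And>l K. 0 \<le> l \<Longrightarrow> 0 < K \<Longrightarrow> (\<Sum>k. poisson_prob l k * min (exp (s * f l k)) K) \<le> min (\<phi> l) K"
    and drift: "\<And>l. 0 \<le> l \<Longrightarrow> \<phi> l \<le> exp (s * l) / 2 + b" and b: "0 \<le> b"
    and [measurable]: "\<phi> \<in> borel_measurable borel" and phi0: "\<And>l. 0 \<le> \<phi> l"
    by (rule exponential_drift, rule that)
  define V where "V w = exp (s * lam 0 w)" for w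
  have VM [measurable]: "V \<in> borel_measurable M" unfolding V_def by measurable
  have trunc: "expectation (\<lambda>w. V w * of_bool (V w \<le> K)) \<le> 2 * b" if K: "0 < K" for K
  proof -
    have minV: "integrable M (\<lambda>w. min (V w) K)"
      using K by (intro integrable_const_bound[where B=K]) (auto simp: V_def)
    have minphi: "integrable M (\<lambda>w. min (\<phi> (lam 0 w)) K)"
      using K phi0 by (intro integrable_const_bound[where B=K]) auto
    have VK: "integrable M (\<lambda>w. V w * of_bool (V w \<le> K))"
      using K by (intro integrable_const_bound[where B=K]) (auto simp: V_def)
    define H where "H k w = min (exp (s * f (max 0 (lam 0 w)) k)) K" for k w
    have HM: "H k \<in> borel_measurable (past 0)" for k
    proof -
      have [measurable]: "(\<lambda>w. f (max 0 (lam 0 w)) k) \<in> borel_measurable (past 0)" by (rule measurable_f_lam) simp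
      show ?thesis unfolding H_def by measurable
    qed
    have He: "H (N 0 w) w = min (exp (s * lam 1 w)) K" if "w \<in> space M" for w
      using recursion_Suc[OF that, of 0] by (simp add: H_def)
    have int1: "integrable M (\<lambda>w. min (exp (s * lam 1 w)) K)"
      using K by (intro integrable_const_bound[where B=K]) auto
    have iH: "integrable M (\<lambda>w. H (N 0 w) w)"
      using int1 by (subst Bochner_Integration.integrable_cong[OF refl He]) auto
    have "expectation (\<lambda>w. min (V w) K) = expectation (\<lambda>w. min (exp (s * lam 1 w)) K)"
      unfolding V_def using stationary_expectation(1)[of "\<lambda>x. min (exp (s * fst x)) K" 1] by simp
    also have "\<dots> = expectation (\<lambda>w. H (N 0 w) w)"
      by (rule Bochner_Integration.integral_cong) (auto simp: He)
    also have "\<dots> = expectation (\<lambda>w. \<Sum>k. poisson_prob (lam 0 w) k * H k w)"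
      by (rule expectation_poisson_disintegration(2)[symmetric, OF HM iH])
    also have "\<dots> \<le> expectation (\<lambda>w. min (\<phi> (lam 0 w)) K)"
    proof (rule integral_mono[OF expectation_poisson_disintegration(1)[OF HM iH] minphi])
      show "(\<Sum>k. poisson_prob (lam 0 w) k * H k w) \<le> min (\<phi> (lam 0 w)) K" if "w \<in> space M" for w
        using kernel[OF lam_nonneg[OF that] K] lam_nonneg[OF that, of 0] by (simp add: H_def max_def)
    qed
    also have "\<dots> \<le> expectation (\<lambda>w. min (V w) K + b - V w * of_bool (V w \<le> K) / 2)"
    proof (rule integral_mono[OF minphi])
      show "integrable M (\<lambda>w. min (V w) K + b - V w * of_bool (V w \<le> K) / 2)"
        using minV VK by simp
      \<comment> \<open>If \<open>V \<le> K\<close>, the drift gains \<open>V / 2\<close>; if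
        \<open>V > K\<close>, both minima are at most \<open>K\<close> and nothing is claimed but
        \<open>b \<ge> 0\<close>.\<close>
      show "min (\<phi> (lam 0 w)) K \<le> min (V w) K + b - V w * of_bool (V w \<le> K) / 2" if "w \<in> space M" for w
        using drift[OF lam_nonneg[OF that, of 0]] b by (auto simp: V_def min_def)
    qed
    also have "\<dots> = expectation (\<lambda>w. min (V w) K) + b - expectation (\<lambda>w. V w * of_bool (V w \<le> K)) / 2"
      using minV VK by (simp add: prob_space)
    finally show ?thesis by simp
  qed
  have "integrable M V"
  proof (rule integrable_incseq_bounded[where h="\<lambda>n w. V w * of_bool (V w \<le> real (Suc n))" and c="2*b"])
    show "integrable M (\<lambda>w. V w * of_bool (V w \<le> real (Suc n)))" for n
      by (intro integrable_const_bound[where B="real (Suc n)"]) (auto simp: V_def)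
    show "expectation (\<lambda>w. V w * of_bool (V w \<le> real (Suc n))) \<le> 2 * b" for n by (rule trunc) simp
    show "(\<lambda>n. V w * of_bool (V w \<le> real (Suc n))) \<longlonglongrightarrow> V w" for w
    proof (rule tendsto_eventually)
      obtain m where "V w \<le> real m" using real_arch_simple by blast
      then show "\<forall>\<^sub>F n in sequentially. V w * of_bool (V w \<le> real (Suc n)) = V w"
        by (intro eventually_sequentiallyI[of m]) auto
    qed
  qed (auto simp: V_def)
  then have "integrable M (\<lambda>w. exp (s * lam t w))" for t
    unfolding V_def using stationary_expectation(2)[of "\<lambda>x. exp (s * fst x)" t] by simp
  with s show thesis by (rule that)
qed

text \<open>The factor in the Lipschitz condition in the parameter. It dominates the intensity, the
  count and the centred count, and being at least 1 it can be inserted as a factor into upper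
  bounds.\<close>

definition Y :: "int \<Rightarrow> 'w \<Rightarrow> real" where
  "Y t w = lam t w + real (N t w) + 1"

lemma Y_measurable [measurable]: "Y t \<in> borel_measurable M"
  unfolding Y_def by measurable

lemma Y_ge:
  assumes "w \<in> space M"
  shows "1 \<le> Y t w" "lam t w \<le> Y t w" "real (N t w) \<le> Y t w" "\<bar>real (N t w) - lam t w\<bar> \<le> Y t w" "0 \<le> Y t w"
  using lam_nonneg[OF assms, of t] by (auto simp: Y_def)

text \<open>Integrability passes from the conditional mean back to the variable: truncate at
  \<open>n\<close>, disintegrate, compare, and let \<open>n\<close> grow.\<close>

lemma integrable_poisson_bound:
  fixes H :: "nat \<Rightarrow> 'w \<Rightarrow> real"
  assumes H: "\<And>k. H k \<in> borel_measurable (past t)" "\<And>k w. 0 \<le> H k w" and HN: "(\<lambda>w. H (N t w) w) \<in> borel_measurable M"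
    and sm: "\<And>w. w \<in> space M \<Longrightarrow> (\<lambda>k. poisson_prob (lam t w) k * H k w) sums g w" and g: "integrable M g"
  shows "integrable M (\<lambda>w. H (N t w) w)"
proof (rule integrable_incseq_bounded[where h="\<lambda>n w. min (H (N t w) w) (real n)" and c="expectation g"])
  show i: "integrable M (\<lambda>w. min (H (N t w) w) (real n))" for n
    using H(2) HN by (intro integrable_const_bound[where B="real n"]) auto
  show "(\<lambda>n. min (H (N t w) w) (real n)) \<longlonglongrightarrow> H (N t w) w" for w
  proof (rule tendsto_eventually)
    obtain m where "H (N t w) w \<le> real m" using real_arch_simple by blast
    then show "\<forall>\<^sub>F n in sequentially. min (H (N t w) w) (real n) = H (N t w) w"
      by (intro eventually_sequentiallyI[of m]) auto
  qed
  show "expectation (\<lambda>w. min (H (N t w) w) (real n)) \<le> expectation g" for n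
  proof -
    note [measurable] = H(1)
    have m: "(\<lambda>w. min (H k w) (real n)) \<in> borel_measurable (past t)" for k by measurable
    note d = expectation_poisson_disintegration[where H="\<lambda>k w. min (H k w) (real n)", OF m i]
    have "expectation (\<lambda>w. min (H (N t w) w) (real n)) = expectation (\<lambda>w. \<Sum>k. poisson_prob (lam t w) k * min (H k w) (real n))"
      by (rule d(2)[symmetric])
    also have "\<dots> \<le> expectation g"
    proof (rule integral_mono[OF d(1) g])
      fix w assume w: "w \<in> space M"
      have "(\<Sum>k. poisson_prob (lam t w) k * min (H k w) (real n)) \<le> (\<Sum>k. poisson_prob (lam t w) k * H k w)"
      proof (rule suminf_le)
        show "summable (\<lambda>k. poisson_prob (lam t w) k * min (H k w) (real n))"
          using H(2) lam_nonneg[OF w] by (intro poisson_prob_summable_bounded(1)[where b="real n"]) auto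
      qed (use sm[OF w] poisson_prob_nonneg[OF lam_nonneg[OF w]] in \<open>auto simp: sums_iff intro: mult_left_mono\<close>)
      also have "\<dots> = g w" using sm[OF w] by (simp add: sums_iff)
      finally show "(\<Sum>k. poisson_prob (lam t w) k * min (H k w) (real n)) \<le> g w" .
    qed
    finally show ?thesis .
  qed
qed (use H(2) in \<open>auto simp: min_def\<close>)

lemma integrable_Y_power: "integrable M (\<lambda>w. Y t w ^ p)"
proof -
  obtain s where s: "0 < s" and i: "\<And>t. integrable M (\<lambda>w. exp (s * lam t w))" by (rule exponential_moment, rule that)
  \<comment> \<open>Given the intensity, \<open>exp (r * Y t)\<close> has mean
    \<open>exp (r * (lam t + 1) + lam t * (exp r - 1))\<close>. For \<open>r \<le> 1\<close> the
    coefficient of \<open>lam t\<close> is at most \<open>3 * r\<close>, so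
    \<open>3 * r \<le> s\<close> suffices.\<close>
  define r where "r = min 1 (s / 3)"
  have r: "0 < r" "r \<le> 1" "3 * r \<le> s" using s by (auto simp: r_def)
  have er: "r + (exp r - 1) \<le> s"
  proof -
    have "exp r \<le> 1 + r + r\<^sup>2" using r by (intro exp_bound) auto
    moreover have "r\<^sup>2 \<le> r" using r by (simp add: power2_eq_square mult_left_le)
    ultimately show ?thesis using r by linarith
  qed
  have [measurable]: "lam t \<in> borel_measurable (past t)" by (rule lam_past) simp
  have gi: "integrable M (\<lambda>w. exp (r * (lam t w + 1)) * exp (lam t w * (exp r - 1)))"
  proof (rule Bochner_Integration.integrable_bound[OF integrable_mult_right[OF i[of t], of "exp r"]])
    show "AE w in M. norm (exp (r * (lam t w + 1)) * exp (lam t w * (exp r - 1))) \<le> norm (exp r * exp (s * lam t w))"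
    proof (rule AE_I2)
      fix w assume w: "w \<in> space M"
      have "lam t w * (r + (exp r - 1)) \<le> lam t w * s" using er lam_nonneg[OF w] by (intro mult_left_mono)
      then show "norm (exp (r * (lam t w + 1)) * exp (lam t w * (exp r - 1))) \<le> norm (exp r * exp (s * lam t w))"
        by (simp add: algebra_simps flip: exp_add)
    qed
  qed measurable
  have "integrable M (\<lambda>w. exp (r * (lam t w + 1)) * exp (r * real (N t w)))"
  proof (rule integrable_poisson_bound[where H="\<lambda>k w. exp (r * (lam t w + 1)) * exp (r * real k)", OF _ _ _ _ gi])
    show "(\<lambda>k. poisson_prob (lam t w) k * (exp (r * (lam t w + 1)) * exp (r * real k))) sums (exp (r * (lam t w + 1)) * exp (lam t w * (exp r - 1)))" for w
      using sums_mult[OF poisson_prob_exp_sums[of "lam t w" r], of "exp (r * (lam t w + 1))"] by (simp add: ac_simps)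
    show "(\<lambda>w. exp (r * (lam t w + 1)) * exp (r * real k)) \<in> borel_measurable (past t)" for k by measurable
    show "(\<lambda>w. exp (r * (lam t w + 1)) * exp (r * real (N t w))) \<in> borel_measurable M" by measurable
  qed simp
  then have E: "integrable M (\<lambda>w. fact p / r ^ p * exp (r * Y t w))"
    by (simp add: Y_def algebra_simps flip: exp_add)
  show ?thesis
  proof (rule Bochner_Integration.integrable_bound[OF E])
    show "AE w in M. norm (Y t w ^ p) \<le> norm (fact p / r ^ p * exp (r * Y t w))"
    proof (rule AE_I2)
      fix w assume w: "w \<in> space M"
      have "(r * Y t w) ^ p \<le> fact p * exp (r * Y t w)"
        using r Y_ge[OF w, of t] by (intro power_le_fact_exp) auto
      then show "norm (Y t w ^ p) \<le> norm (fact p / r ^ p * exp (r * Y t w))"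
        using r Y_ge[OF w, of t] by (simp add: power_mult_distrib field_simps)
    qed
  qed measurable
qed

definition mu :: "nat \<Rightarrow> real" where
  "mu p = expectation (\<lambda>w. Y 0 w ^ p)"

lemma expectation_Y_power: "expectation (\<lambda>w. Y t w ^ p) = mu p"
  unfolding mu_def Y_def using stationary_expectation(1)[of "\<lambda>x. (fst x + snd x + 1) ^ p" t] by simp

lemma integrable_Y_bound:
  assumes "g \<in> borel_measurable M" "\<And>w. w \<in> space M \<Longrightarrow> \<bar>g w\<bar> \<le> c * Y t w ^ p"
  shows "integrable M g"
  by (rule Bochner_Integration.integrable_bound[OF integrable_mult_right[OF integrable_Y_power[of t p], of c]])
     (use assms in \<open>auto intro!: AE_I2 intro: order_trans[OF _ abs_ge_self]\<close>)

lemma mu_nonneg: "0 \<le> mu p"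
  unfolding mu_def by (intro integral_nonneg_AE AE_I2) (simp add: Y_ge)

end

section \<open>The law of large numbers\<close>

context poisson_autoregression
begin

definition bounded_lipschitz :: "real \<Rightarrow> real \<Rightarrow> (real \<Rightarrow> real) \<Rightarrow> bool" where
  "bounded_lipschitz b L g \<longleftrightarrow>
     (\<forall>x\<ge>0. \<bar>g x\<bar> \<le> b) \<and> (\<forall>x\<ge>0. \<forall>y\<ge>0. \<bar>g x - g y\<bar> \<le> L * \<bar>x - y\<bar>)"

lemma bounded_lipschitz_nonneg:
  assumes "bounded_lipschitz b L g"
  shows "0 \<le> b" "0 \<le> L"
proof -
  have "\<bar>g 0\<bar> \<le> b" "\<bar>g 0 - g 1\<bar> \<le> L"
    using assms[unfolded bounded_lipschitz_def, THEN conjunct1, rule_format, of 0]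
      assms[unfolded bounded_lipschitz_def, THEN conjunct2, rule_format, of 0 1] by simp_all
  then show "0 \<le> b" "0 \<le> L" using abs_ge_zero[of "g 0"] abs_ge_zero[of "g 0 - g 1"] by linarith+
qed

lemma bounded_lipschitz_measurable:
  assumes "bounded_lipschitz b L g"
  shows "(\<lambda>x. g (max 0 x)) \<in> borel_measurable borel"
proof (rule borel_measurable_continuous_onI)
  have L: "0 \<le> L" using bounded_lipschitz_nonneg[OF assms] by simp
  have c: "continuous_on {0..} g"
  proof (rule continuous_onI)
    fix x e :: real assume x: "x \<in> {0..}" and e: "e > 0"
    show "\<exists>d>0. \<forall>x'\<in>{0..}. dist x' x < d \<longrightarrow> dist (g x') (g x) \<le> e"
    proof (intro exI[of _ "e / (L + 1)"] conjI ballI impI)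
      show "0 < e / (L + 1)" using e L by simp
      fix x' assume x': "x' \<in> {0..}" "dist x' x < e / (L + 1)"
      have "\<bar>g x' - g x\<bar> \<le> L * \<bar>x' - x\<bar>" using assms x x' by (simp add: bounded_lipschitz_def)
      also have "\<dots> \<le> (L + 1) * (e / (L + 1))" using x' L by (intro mult_mono) (auto simp: dist_real_def)
      also have "\<dots> = e" using L by simp
      finally show "dist (g x') (g x) \<le> e" by (simp add: dist_real_def)
    qed
  qed
  show "continuous_on UNIV (\<lambda>x. g (max 0 x))"
    by (rule continuous_on_compose2[OF c]) (auto intro!: continuous_intros)
qed

definition transition :: "(real \<Rightarrow> real) \<Rightarrow> real \<Rightarrow> real" where
  "transition g l = (\<Sum>k. poisson_prob l k * g (f l k))"

text \<open>One step of the chain contracts Lipschitz constants by \<open>\<kappa>1 + \<kappa>2\<close>: moving the intensity costs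
  \<open>\<kappa>1\<close> through the first argument of \<open>f\<close> and \<open>\<kappa>2\<close> through the Poisson law of the second.\<close>

lemma bounded_lipschitz_transition:
  assumes g: "bounded_lipschitz b L g"
  shows "bounded_lipschitz b ((\<kappa>1 + \<kappa>2) * L) (transition g)"
  unfolding bounded_lipschitz_def
proof (intro conjI allI impI)
  have gb: "\<bar>g (f x k)\<bar> \<le> b" if "0 \<le> x" for x k
    using g f_nonneg[OF that] by (simp add: bounded_lipschitz_def)
  note L = bounded_lipschitz_nonneg[OF g]
  show "\<bar>transition g x\<bar> \<le> b" if "0 \<le> x" for x
    unfolding transition_def by (rule poisson_prob_summable_bounded(2)[OF that gb[OF that]])
  fix x y :: real assume xy: "0 \<le> x" "0 \<le> y"
  have gl: "\<bar>g (f x k) - g (f y k')\<bar> \<le> L * (\<kappa>1 * \<bar>x - y\<bar> + \<kappa>2 * \<bar>real k - real k'\<bar>)" if "0 \<le> x" "0 \<le> y" for x y k k'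
  proof -
    have "\<bar>g (f x k) - g (f y k')\<bar> \<le> L * \<bar>f x k - f y k'\<bar>"
      using g f_nonneg that by (simp add: bounded_lipschitz_def)
    also have "\<dots> \<le> L * (\<kappa>1 * \<bar>x - y\<bar> + \<kappa>2 * \<bar>real k - real k'\<bar>)"
      using contraction[OF that] L by (intro mult_left_mono) auto
    finally show ?thesis .
  qed
  have "transition g x - transition g y =
      ((\<Sum>k. poisson_prob x k * g (f x k)) - (\<Sum>k. poisson_prob x k * g (f y k)))
    + ((\<Sum>k. poisson_prob x k * g (f y k)) - (\<Sum>k. poisson_prob y k * g (f y k)))"
    by (simp add: transition_def)
  also have "(\<Sum>k. poisson_prob x k * g (f x k)) - (\<Sum>k. poisson_prob x k * g (f y k)) =
      (\<Sum>k. poisson_prob x k * (g (f x k) - g (f y k)))"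
    using poisson_prob_summable_bounded(1)[OF xy(1) gb[OF xy(1)]] poisson_prob_summable_bounded(1)[OF xy(1) gb[OF xy(2)]]
    by (simp add: suminf_diff right_diff_distrib)
  finally have "\<bar>transition g x - transition g y\<bar> \<le>
      \<bar>\<Sum>k. poisson_prob x k * (g (f x k) - g (f y k))\<bar>
      + \<bar>(\<Sum>k. poisson_prob x k * g (f y k)) - (\<Sum>k. poisson_prob y k * g (f y k))\<bar>"
    by (metis abs_triangle_ineq)
  also have "\<bar>\<Sum>k. poisson_prob x k * (g (f x k) - g (f y k))\<bar> \<le> L * (\<kappa>1 * \<bar>x - y\<bar>)"
    using gl[OF xy] by (intro poisson_prob_summable_bounded(2)[OF xy(1)]) (metis abs_zero add.right_neutral diff_self mult_zero_right)
  also have "\<bar>(\<Sum>k. poisson_prob x k * g (f y k)) - (\<Sum>k. poisson_prob y k * g (f y k))\<bar> \<le> (L * \<kappa>2) * \<bar>x - y\<bar>"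
  proof (rule poisson_prob_lipschitz[OF xy gb[OF xy(2)]])
    show "\<bar>g (f y (Suc k)) - g (f y k)\<bar> \<le> L * \<kappa>2" for k
      using gl[OF xy(2) xy(2), of "Suc k" k] by simp
  qed
  finally show "\<bar>transition g x - transition g y\<bar> \<le> (\<kappa>1 + \<kappa>2) * L * \<bar>x - y\<bar>"
    by (simp add: algebra_simps)
qed

lemma bounded_lipschitz_transition_power:
  "bounded_lipschitz b L g \<Longrightarrow> bounded_lipschitz b ((\<kappa>1 + \<kappa>2) ^ j * L) ((transition ^^ j) g)"
proof (induction j)
  case (Suc j)
  from bounded_lipschitz_transition[OF Suc.IH[OF Suc.prems]] show ?case by (simp add: mult.assoc)
qed simp

lemma bounded_lipschitz_lam_measurable:
  assumes "bounded_lipschitz b L g" "s \<le> t"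
  shows "(\<lambda>w. g (lam s w)) \<in> borel_measurable (past t)" "(\<lambda>w. g (lam s w)) \<in> borel_measurable M"
proof -
  have "(\<lambda>w. g (max 0 (lam s w))) \<in> borel_measurable (past t)"
    by (rule measurable_compose[OF lam_past[OF assms(2)] bounded_lipschitz_measurable[OF assms(1)]])
  then show 1: "(\<lambda>w. g (lam s w)) \<in> borel_measurable (past t)"
    by (subst measurable_cong[where g="\<lambda>w. g (max 0 (lam s w))"]) (auto simp: lam_nonneg)
  show "(\<lambda>w. g (lam s w)) \<in> borel_measurable M"
    by (rule measurable_from_subalg[OF subalgebra_past 1])
qed

lemma integrable_bounded_mult:
  fixes G H :: "'w \<Rightarrow> real"
  assumes "G \<in> borel_measurable M" "\<And>w. w \<in> space M \<Longrightarrow> \<bar>G w\<bar> \<le> c"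
    and "H \<in> borel_measurable M" "\<And>w. w \<in> space M \<Longrightarrow> \<bar>H w\<bar> \<le> b"
  shows "integrable M (\<lambda>w. G w * H w)"
proof (rule integrable_const_bound[where B="\<bar>c\<bar> * \<bar>b\<bar>"])
  show "AE w in M. norm (G w * H w) \<le> \<bar>c\<bar> * \<bar>b\<bar>"
    using assms(2,4) by (intro AE_I2) (auto simp: abs_mult intro!: mult_mono intro: order_trans[OF _ abs_ge_self])
qed (use assms in measurable)

text \<open>The Markov property one step at a time: conditioning on the past of the last step
  replaces \<open>g\<close> by \<open>transition g\<close>, so the induction has to vary
  \<open>g\<close> and its Lipschitz constant. The factor \<open>G\<close> stays known as the time
  advances.\<close>

lemma expectation_transition_power:
  fixes G :: "'w \<Rightarrow> real"
  assumes G: "G \<in> borel_measurable (past t)" "\<And>w. w \<in> space M \<Longrightarrow> \<bar>G w\<bar> \<le> c"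
  shows "bounded_lipschitz b L g \<Longrightarrow>
    expectation (\<lambda>w. G w * g (lam (t + int j) w)) = expectation (\<lambda>w. G w * (transition ^^ j) g (lam t w))"
proof (induction j arbitrary: g L)
  case (Suc j)
  let ?t = "t + int j"
  note g = Suc.prems
  have GM [measurable]: "G \<in> borel_measurable M" by (rule measurable_from_subalg[OF subalgebra_past G(1)])
  have [measurable]: "G \<in> borel_measurable (past ?t)" by (rule measurable_past_mono[OF G(1)]) simp
  define H where "H k w = G w * g (max 0 (f (max 0 (lam ?t w)) k))" for k w
  have HM: "H k \<in> borel_measurable (past ?t)" for k
  proof -
    have "(\<lambda>w. f (max 0 (lam ?t w)) k) \<in> borel_measurable (past ?t)" by (rule measurable_f_lam) simp
    from measurable_compose[OF this bounded_lipschitz_measurable[OF g]]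
    have [measurable]: "(\<lambda>w. g (max 0 (f (max 0 (lam ?t w)) k))) \<in> borel_measurable (past ?t)" .
    show ?thesis unfolding H_def by measurable
  qed
  have He: "H (N ?t w) w = G w * g (lam (?t + 1) w)" if "w \<in> space M" for w
    using recursion_Suc[OF that, of ?t] lam_nonneg[OF that, of "?t + 1"] by (simp add: H_def max_def)
  have "integrable M (\<lambda>w. G w * g (lam (?t + 1) w))"
    by (rule integrable_bounded_mult[where b=b, OF GM G(2) bounded_lipschitz_lam_measurable(2)[OF g order_refl]])
       (use g lam_nonneg in \<open>auto simp: bounded_lipschitz_def\<close>)
  then have iH: "integrable M (\<lambda>w. H (N ?t w) w)"
    by (subst Bochner_Integration.integrable_cong[OF refl He]) auto
  have "expectation (\<lambda>w. G w * g (lam (t + int (Suc j)) w)) = expectation (\<lambda>w. H (N ?t w) w)"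
    by (rule Bochner_Integration.integral_cong) (auto simp: He ac_simps)
  also have "\<dots> = expectation (\<lambda>w. \<Sum>k. poisson_prob (lam ?t w) k * H k w)"
    by (rule expectation_poisson_disintegration(2)[symmetric, OF HM iH])
  also have "\<dots> = expectation (\<lambda>w. G w * transition g (lam ?t w))"
  proof (rule Bochner_Integration.integral_cong[OF refl])
    fix w assume w: "w \<in> space M"
    have l: "0 \<le> lam ?t w" by (rule lam_nonneg[OF w])
    have "summable (\<lambda>k. poisson_prob (lam ?t w) k * g (f (lam ?t w) k))"
      using g f_nonneg[OF l] by (intro poisson_prob_summable_bounded(1)[OF l, of _ b]) (auto simp: bounded_lipschitz_def)
    from suminf_mult[OF this, of "G w"]
    show "(\<Sum>k. poisson_prob (lam ?t w) k * H k w) = G w * transition g (lam ?t w)"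
      using l f_nonneg[OF l] by (simp add: H_def transition_def max_def ac_simps)
  qed
  also have "\<dots> = expectation (\<lambda>w. G w * (transition ^^ j) (transition g) (lam t w))"
    by (rule Suc.IH[OF bounded_lipschitz_transition[OF g]])
  finally show ?case by (simp add: funpow_swap1)
qed simp

lemma expectation_lam_le: "integrable M (lam t)" "expectation (lam t) \<le> mu 1"
proof -
  show 1: "integrable M (lam t)" by (rule integrable_Y_bound[where c=1 and p=1 and t=t]) (auto simp: lam_nonneg Y_ge)
  have "expectation (lam t) \<le> expectation (\<lambda>w. Y t w ^ 1)"
    by (rule integral_mono[OF 1 integrable_Y_power]) (simp add: Y_ge)
  then show "expectation (lam t) \<le> mu 1" by (simp only: expectation_Y_power)
qed

text \<open>After \<open>j\<close> steps the conditional mean of \<open>g\<close> is a function of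
  the present with Lipschitz constant \<open>(\<kappa>1 + \<kappa>2) ^ j * L\<close>, hence almost
  constant, and a constant is uncorrelated with the centred variable.\<close>

lemma covariance_decay:
  assumes g: "bounded_lipschitz b L g" and m: "m = expectation (\<lambda>w. g (lam 0 w))"
  shows "\<bar>expectation (\<lambda>w. (g (lam t w) - m) * (g (lam (t + int j) w) - m))\<bar> \<le> 2 * b * L * mu 1 * (\<kappa>1 + \<kappa>2) ^ j"
proof -
  note nn = bounded_lipschitz_nonneg[OF g]
  have gM [measurable]: "(\<lambda>w. g (lam s w)) \<in> borel_measurable M" for s
    by (rule bounded_lipschitz_lam_measurable(2)[OF g order_refl])
  have gb: "\<bar>g (lam s w)\<bar> \<le> b" if "w \<in> space M" for s w
    using g lam_nonneg[OF that] by (simp add: bounded_lipschitz_def)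
  have gi: "integrable M (\<lambda>w. g (lam s w))" for s
    using gb by (intro integrable_const_bound[where B=b]) auto
  have mb: "\<bar>m\<bar> \<le> b"
  proof -
    have "\<bar>m\<bar> \<le> expectation (\<lambda>w. \<bar>g (lam 0 w)\<bar>)" unfolding m by (rule integral_abs_bound)
    also have "\<dots> \<le> expectation (\<lambda>w. b)" using gi gb by (intro integral_mono) auto
    finally show ?thesis by (simp add: prob_space)
  qed
  have mt: "expectation (\<lambda>w. g (lam s w)) = m" for s
  proof -
    have "expectation (\<lambda>w. g (lam s w)) = expectation (\<lambda>w. g (max 0 (lam s w)))" for s
      by (rule Bochner_Integration.integral_cong) (auto simp: lam_nonneg)
    moreover have "expectation (\<lambda>w. g (max 0 (lam s w))) = expectation (\<lambda>w. g (max 0 (lam 0 w)))"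
      using stationary_expectation(1)[of "\<lambda>x. g (max 0 (fst x))" s]
        measurable_compose[OF measurable_fst bounded_lipschitz_measurable[OF g], of borel] by simp
    ultimately show ?thesis by (simp add: m)
  qed
  define a where "a w = g (lam t w) - m" for w
  have aF: "a \<in> borel_measurable (past t)"
    unfolding a_def using bounded_lipschitz_lam_measurable(1)[OF g, of t t] by simp
  have aM [measurable]: "a \<in> borel_measurable M" unfolding a_def by measurable
  have ab: "\<bar>a w\<bar> \<le> 2 * b" if "w \<in> space M" for w
    using gb[OF that, of t] mb by (simp add: a_def)
  have ai: "integrable M a" using ab by (intro integrable_const_bound[where B="2*b"]) auto
  have a0: "expectation a = 0" unfolding a_def using gi mt[of t] by (simp add: prob_space)
  let ?P = "(transition ^^ j) g"
  note P = bounded_lipschitz_transition_power[OF g, of j]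
  have PM [measurable]: "(\<lambda>w. ?P (lam t w)) \<in> borel_measurable M"
    by (rule bounded_lipschitz_lam_measurable(2)[OF P order_refl])
  have Pb: "\<bar>?P (lam t w)\<bar> \<le> b" if "w \<in> space M" for w
    using P lam_nonneg[OF that] by (simp add: bounded_lipschitz_def)
  have agi: "integrable M (\<lambda>w. a w * g (lam (t + int j) w))" "integrable M (\<lambda>w. a w * ?P (lam t w))"
    by (rule integrable_bounded_mult[OF aM ab _ gb] integrable_bounded_mult[OF aM ab PM Pb]; simp)+
  have "expectation (\<lambda>w. (g (lam t w) - m) * (g (lam (t + int j) w) - m)) = expectation (\<lambda>w. a w * g (lam (t + int j) w) - m * a w)"
    by (simp add: a_def algebra_simps)
  \<comment> \<open>Subtracting the value of \<open>?P\<close> at 0 is free since \<open>a\<close>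
    has mean 0; it leaves an increment bounded by the Lipschitz constant times
    \<open>lam t\<close>.\<close>
  also have "\<dots> = expectation (\<lambda>w. a w * ?P (lam t w)) - ?P 0 * expectation a"
    using agi ai a0 expectation_transition_power[OF aF ab g, of j] by simp
  also have "\<dots> = expectation (\<lambda>w. a w * ?P (lam t w) - ?P 0 * a w)"
    using agi ai by simp
  finally have eq: "expectation (\<lambda>w. (g (lam t w) - m) * (g (lam (t + int j) w) - m)) = expectation (\<lambda>w. a w * ?P (lam t w) - ?P 0 * a w)" .
  have "\<bar>expectation (\<lambda>w. a w * ?P (lam t w) - ?P 0 * a w)\<bar> \<le> expectation (\<lambda>w. \<bar>a w * ?P (lam t w) - ?P 0 * a w\<bar>)"
    by (rule integral_abs_bound)
  also have "\<dots> \<le> expectation (\<lambda>w. 2 * b * ((\<kappa>1 + \<kappa>2) ^ j * L) * lam t w)"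
  proof (rule integral_mono)
    show "\<bar>a w * ?P (lam t w) - ?P 0 * a w\<bar> \<le> 2 * b * ((\<kappa>1 + \<kappa>2) ^ j * L) * lam t w" if w: "w \<in> space M" for w
    proof -
      have "\<bar>a w * ?P (lam t w) - ?P 0 * a w\<bar> = \<bar>a w\<bar> * \<bar>?P (lam t w) - ?P 0\<bar>"
        by (simp add: algebra_simps flip: abs_mult)
      also have "\<dots> \<le> (2 * b) * (((\<kappa>1 + \<kappa>2) ^ j * L) * \<bar>lam t w - 0\<bar>)"
        using ab[OF w] nn P[unfolded bounded_lipschitz_def, THEN conjunct2, rule_format, OF lam_nonneg[OF w] order_refl]
        by (intro mult_mono) auto
      finally show ?thesis using lam_nonneg[OF w, of t] by (simp add: ac_simps)
    qed
  qed (use agi ai expectation_lam_le in auto)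
  also have "\<dots> = 2 * b * ((\<kappa>1 + \<kappa>2) ^ j * L) * expectation (lam t)" by simp
  also have "\<dots> \<le> 2 * b * ((\<kappa>1 + \<kappa>2) ^ j * L) * mu 1"
    using nn kappa by (intro mult_left_mono expectation_lam_le) auto
  finally show ?thesis unfolding eq by (simp add: ac_simps)
qed

text \<open>Geometrically decaying covariances make the variance of the sum grow at most
  linearly.\<close>

lemma lln_bounded_lipschitz:
  assumes g: "bounded_lipschitz b L g"
  shows "small_in_prob M (\<lambda>n w. (\<Sum>t<n. g (lam (int (Suc t)) w)) / real n - expectation (\<lambda>w. g (lam 0 w)))"
proof -
  define m where "m = expectation (\<lambda>w. g (lam 0 w))"
  define a where "a t w = g (lam (int (Suc t)) w) - m" for t w
  define \<kappa> where "\<kappa> = \<kappa>1 + \<kappa>2"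
  have k: "0 \<le> \<kappa>" "\<kappa> < 1" using kappa by (auto simp: \<kappa>_def)
  note nn = bounded_lipschitz_nonneg[OF g]
  define c where "c = 2 * b * L * mu 1"
  have c: "0 \<le> c" using nn mu_nonneg by (simp add: c_def)
  have aM [measurable]: "a t \<in> borel_measurable M" for t
    unfolding a_def using bounded_lipschitz_lam_measurable(2)[OF g order_refl, of "int (Suc t)"] by simp
  define B where "B = b + \<bar>m\<bar>"
  have ab: "\<bar>a t w\<bar> \<le> B" if "w \<in> space M" for w t
  proof -
    have "\<bar>g (lam (int (Suc t)) w)\<bar> \<le> b" using g lam_nonneg[OF that] by (simp add: bounded_lipschitz_def)
    then show ?thesis by (simp add: a_def B_def)
  qed
  have ai: "integrable M (\<lambda>w. a s w * a t w)" for s t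
    by (rule integrable_bounded_mult[OF aM ab aM ab])
  have cov: "\<bar>expectation (\<lambda>w. a s w * a t w)\<bar> \<le> c * \<kappa> ^ (t - s)" if "s \<le> t" for s t
    using covariance_decay[OF g m_def, of "int (Suc s)" "t - s"] that
    by (simp add: a_def c_def \<kappa>_def of_nat_diff)
  have geo: "(\<Sum>s<n. \<kappa> ^ (n - s)) \<le> 1 / (1 - \<kappa>)" for n
  proof -
    have "(\<Sum>s<n. \<kappa> ^ (n - s)) = (\<Sum>s<n. \<kappa> ^ Suc s)"
      by (rule sum.reindex_bij_witness[of _ "\<lambda>i. n - Suc i" "\<lambda>i. n - Suc i"]) (auto simp: Suc_diff_Suc)
    also have "\<dots> \<le> (\<Sum>s<n. \<kappa> ^ s)" using k by (intro sum_mono power_decreasing) auto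
    also have "\<dots> \<le> (\<Sum>s. \<kappa> ^ s)" using k by (intro sum_le_suminf summable_geometric) auto
    also have "\<dots> = 1 / (1 - \<kappa>)" using k by (intro suminf_geometric) auto
    finally show ?thesis .
  qed
  \<comment> \<open>The increase per index: twice the summed covariances with all earlier ones, plus
    the square of the new term.\<close>
  define D where "D = 2 * (c / (1 - \<kappa>)) + B\<^sup>2"
  have var: "integrable M (\<lambda>w. (\<Sum>t<n. a t w)\<^sup>2) \<and> expectation (\<lambda>w. (\<Sum>t<n. a t w)\<^sup>2) \<le> real n * D" for n
  proof (induction n)
    case (Suc n)
    let ?S = "\<lambda>w. \<Sum>t<n. a t w"
    have eq: "(\<Sum>t<Suc n. a t w)\<^sup>2 = (?S w)\<^sup>2 + 2 * (\<Sum>t<n. a t w * a n w) + a n w * a n w" for w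
      unfolding sum_distrib_right[symmetric] by (simp add: power2_eq_square algebra_simps)
    have i: "integrable M (\<lambda>w. \<Sum>t<n. a t w * a n w)" using ai by (intro Bochner_Integration.integrable_sum)
    have int: "integrable M (\<lambda>w. (\<Sum>t<Suc n. a t w)\<^sup>2)" unfolding eq using Suc i ai by auto
    have "expectation (\<lambda>w. (\<Sum>t<Suc n. a t w)\<^sup>2) =
        expectation (\<lambda>w. (?S w)\<^sup>2) + 2 * (\<Sum>t<n. expectation (\<lambda>w. a t w * a n w)) + expectation (\<lambda>w. a n w * a n w)"
      unfolding eq using Suc i ai by simp
    also have "(\<Sum>t<n. expectation (\<lambda>w. a t w * a n w)) \<le> (\<Sum>t<n. c * \<kappa> ^ (n - t))"
      using cov by (intro sum_mono) (auto intro: order_trans[OF abs_ge_self])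
    also have "\<dots> \<le> c * (1 / (1 - \<kappa>))"
      unfolding sum_distrib_left[symmetric] using geo c by (intro mult_left_mono)
    also have "expectation (\<lambda>w. a n w * a n w) \<le> expectation (\<lambda>w. B\<^sup>2)"
    proof (rule integral_mono)
      fix w assume "w \<in> space M"
      from power_mono[OF ab[OF this, of n] abs_ge_zero, of 2]
      show "a n w * a n w \<le> B\<^sup>2" by (simp add: power2_eq_square)
    qed (use ai in auto)
    finally have "expectation (\<lambda>w. (\<Sum>t<Suc n. a t w)\<^sup>2) \<le> expectation (\<lambda>w. (?S w)\<^sup>2) + D"
      by (simp add: D_def prob_space)
    then show ?case using int Suc by (simp add: algebra_simps)
  qed simp
  let ?A = "\<lambda>n w. (\<Sum>t<n. a t w) / real n"
  have "small_in_prob M ?A"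
  proof (rule small_in_prob_L1)
    \<comment> \<open>From \<open>\<bar>S * h\<bar> \<le> S\<^sup>2 + h\<^sup>2\<close> with
      \<open>h = sqrt n\<close>; this turns the variance bound into a bound in mean.\<close>
    let ?Q = "\<lambda>n w. (\<Sum>t<n. a t w)\<^sup>2 / (real n * sqrt (real n)) + 1 / sqrt (real n)"
    show "integrable M (?Q n)" for n using var[of n] by auto
    show "\<bar>?A n w\<bar> \<le> ?Q n w" for n w
    proof (cases "n = 0")
      case False
      define h where "h = sqrt (real n)"
      define S where "S = (\<Sum>t<n. a t w)"
      have h: "h > 0" "real n = h * h" using False by (auto simp: h_def)
      have "\<bar>S * h\<bar> \<le> S\<^sup>2 + h\<^sup>2" by (rule abs_mult_le_sum_squares)
      then have "\<bar>S\<bar> * h \<le> S\<^sup>2 + h\<^sup>2" using h by (simp add: abs_mult)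
      then have "\<bar>S\<bar> * h / (h * h * h) \<le> (S\<^sup>2 + h\<^sup>2) / (h * h * h)"
        using h by (intro divide_right_mono) auto
      then show ?thesis unfolding h_def[symmetric] S_def[symmetric] h(2) using h(1)
        by (simp add: add_divide_distrib power2_eq_square)
    qed simp
    have E: "expectation (?Q n) = expectation (\<lambda>w. (\<Sum>t<n. a t w)\<^sup>2) / (real n * sqrt (real n)) + 1 / sqrt (real n)" for n
      using var[of n] by (simp add: prob_space)
    show "(\<lambda>n. expectation (?Q n)) \<longlonglongrightarrow> 0"
    proof (rule Lim_null_comparison)
      show "\<forall>\<^sub>F n in sequentially. norm (expectation (?Q n)) \<le> D / sqrt (real n) + 1 / sqrt (real n)"
        using eventually_gt_at_top[of 0]
      proof eventually_elim
        case (elim n)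
        have "0 \<le> expectation (?Q n)" by (intro integral_nonneg_AE AE_I2) simp
        moreover have "expectation (?Q n) \<le> real n * D / (real n * sqrt (real n)) + 1 / sqrt (real n)"
          unfolding E using var[of n] by (intro add_right_mono divide_right_mono) auto
        ultimately show ?case using elim by simp
      qed
      show "(\<lambda>n. D / sqrt (real n) + 1 / sqrt (real n)) \<longlonglongrightarrow> 0" by real_asymp
    qed
  qed
  then show ?thesis
  proof (rule small_in_prob_cong)
    show "\<forall>\<^sub>F n in sequentially. \<forall>w\<in>space M. (\<Sum>t<n. g (lam (int (Suc t)) w)) / real n - expectation (\<lambda>w. g (lam 0 w)) = ?A n w"
      using eventually_gt_at_top[of 0]
      by eventually_elim (auto simp: a_def m_def[symmetric] sum_subtractf diff_divide_distrib)
  qed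
qed

text \<open>The square is neither bounded nor Lipschitz, so it is truncated at \<open>K\<close>; the
  excess is at most \<open>lam ^ 3 / K\<close> and thus small in mean, uniformly in time.\<close>

lemma lln_lam_square:
  "small_in_prob M (\<lambda>n w. (\<Sum>t<n. (lam (int (Suc t)) w)\<^sup>2) / real n - expectation (\<lambda>w. (lam 0 w)\<^sup>2))"
proof (rule small_in_probI)
  fix e :: real assume e: "e > 0"
  define K where "K = max 1 (3 * mu 3 / e)"
  have K: "1 \<le> K" "0 < K" by (auto simp: K_def)
  have Kmu: "mu 3 / K \<le> e / 3"
  proof -
    have "3 * mu 3 / e \<le> K" by (simp add: K_def)
    then show ?thesis using e K by (simp add: field_simps)
  qed
  define g where "g l = (min l K)\<^sup>2" for l
  have g: "bounded_lipschitz (K\<^sup>2) (2 * K) g"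
    unfolding bounded_lipschitz_def
  proof (intro conjI allI impI)
    fix x y :: real assume xy: "0 \<le> x" "0 \<le> y"
    have "\<bar>g x - g y\<bar> = \<bar>min x K + min y K\<bar> * \<bar>min x K - min y K\<bar>"
      by (simp add: g_def square_diff_square_factored power2_eq_square flip: abs_mult)
    also have "\<dots> \<le> (2 * K) * \<bar>x - y\<bar>"
      using xy K by (intro mult_mono) (auto simp: min_def)
    finally show "\<bar>g x - g y\<bar> \<le> 2 * K * \<bar>x - y\<bar>" .
  qed (use K in \<open>auto simp: g_def intro!: power_mono\<close>)
  define r where "r t w = (lam t w)\<^sup>2 - g (lam t w)" for t w
  have r0: "0 \<le> r t w" if "w \<in> space M" for t w
    using lam_nonneg[OF that, of t] K unfolding r_def g_def by (simp add: power_mono)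
  have rY: "r t w \<le> (1 / K) * Y t w ^ 3" if "w \<in> space M" for t w
  proof -
    have "r t w \<le> lam t w ^ 3 / K"
    proof (cases "lam t w \<le> K")
      case False
      then have "(lam t w)\<^sup>2 * K \<le> (lam t w)\<^sup>2 * lam t w" by (intro mult_left_mono) auto
      then have "(lam t w)\<^sup>2 \<le> lam t w ^ 3 / K" using K by (simp add: field_simps power2_eq_square power3_eq_cube)
      then show ?thesis by (simp add: r_def g_def order_trans[rotated])
    qed (use lam_nonneg[OF that, of t] K in \<open>simp add: r_def g_def\<close>)
    also have "\<dots> \<le> (1 / K) * Y t w ^ 3"
      using K Y_ge(2)[OF that, of t] lam_nonneg[OF that, of t] by (simp add: divide_right_mono power_mono)
    finally show ?thesis .
  qed
  have gM [measurable]: "(\<lambda>w. g (lam t w)) \<in> borel_measurable M" for t unfolding g_def by measurable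
  have rM [measurable]: "r t \<in> borel_measurable M" for t unfolding r_def by measurable
  have ri: "integrable M (r t)" for t
    by (rule integrable_Y_bound[where c="1/K" and p=3 and t=t]) (use r0 rY in auto)
  have gi: "integrable M (\<lambda>w. g (lam t w))" for t
    using g lam_nonneg by (intro integrable_const_bound[where B="K\<^sup>2"] AE_I2) (auto simp: bounded_lipschitz_def)
  have Er: "expectation (r t) \<le> e / 3" "0 \<le> expectation (r t)" for t
  proof -
    have "expectation (r t) \<le> expectation (\<lambda>w. (1 / K) * Y t w ^ 3)"
      using ri rY integrable_Y_power[of t 3] by (intro integral_mono) auto
    also have "\<dots> = mu 3 / K" by (simp add: expectation_Y_power)
    finally show "expectation (r t) \<le> e / 3" using Kmu by (rule order_trans)
    show "0 \<le> expectation (r t)" using r0 by (intro integral_nonneg_AE AE_I2)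
  qed
  have Esq: "expectation (\<lambda>w. (lam 0 w)\<^sup>2) = expectation (\<lambda>w. g (lam 0 w)) + expectation (r 0)"
    using gi[of 0] ri[of 0] by (subst Bochner_Integration.integral_add[symmetric]) (auto simp: r_def)
  \<comment> \<open>Three shares of \<open>e / 3\<close>: the truncated law of large numbers, the
    averaged excess, and the error in the limit.\<close>
  define Q where "Q n w = e / 3 + (\<Sum>t<n. r (int (Suc t)) w) / real n + expectation (r 0)" for n w
  have "mostly M e (\<lambda>n w. \<bar>(\<Sum>t<n. (lam (int (Suc t)) w)\<^sup>2) / real n - expectation (\<lambda>w. (lam 0 w)\<^sup>2)\<bar> \<le> Q n w)"
  proof (rule mostly_imp[OF small_in_probD[OF lln_bounded_lipschitz[OF g] e, of "e / 3"]])
    show "0 < e / 3" using e by simp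
    fix n w assume w: "w \<in> space M"
      and near: "\<bar>(\<Sum>t<n. g (lam (int (Suc t)) w)) / real n - expectation (\<lambda>w. g (lam 0 w))\<bar> < e / 3"
    have "(\<Sum>t<n. (lam (int (Suc t)) w)\<^sup>2) = (\<Sum>t<n. g (lam (int (Suc t)) w)) + (\<Sum>t<n. r (int (Suc t)) w)"
      by (simp add: r_def sum_subtractf)
    then have "(\<Sum>t<n. (lam (int (Suc t)) w)\<^sup>2) / real n - expectation (\<lambda>w. (lam 0 w)\<^sup>2) =
       ((\<Sum>t<n. g (lam (int (Suc t)) w)) / real n - expectation (\<lambda>w. g (lam 0 w))) + (\<Sum>t<n. r (int (Suc t)) w) / real n - expectation (r 0)"
      by (simp add: Esq add_divide_distrib)
    moreover have "0 \<le> (\<Sum>t<n. r (int (Suc t)) w) / real n"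
      using r0 w by (intro divide_nonneg_nonneg sum_nonneg) auto
    ultimately show "\<bar>(\<Sum>t<n. (lam (int (Suc t)) w)\<^sup>2) / real n - expectation (\<lambda>w. (lam 0 w)\<^sup>2)\<bar> \<le> Q n w"
      using near Er(2)[of 0] unfolding Q_def by linarith
  qed
  moreover have "\<forall>\<^sub>F n in sequentially. integrable M (Q n) \<and> (\<forall>w\<in>space M. 0 \<le> Q n w) \<and> expectation (Q n) \<le> e"
    using eventually_gt_at_top[of 0]
  proof (eventually_elim, intro conjI ballI)
    fix n :: nat assume n: "0 < n"
    show "integrable M (Q n)" unfolding Q_def using ri by auto
    show "0 \<le> Q n w" if "w \<in> space M" for w
      unfolding Q_def using r0[OF that] Er(2) e by (intro add_nonneg_nonneg divide_nonneg_nonneg sum_nonneg) auto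
    have "expectation (Q n) = e / 3 + (\<Sum>t<n. expectation (r (int (Suc t)))) / real n + expectation (r 0)"
      unfolding Q_def using ri by (simp add: prob_space)
    also have "\<dots> \<le> e / 3 + (\<Sum>t<n. e / 3) / real n + e / 3"
      using Er by (intro add_mono divide_right_mono sum_mono) auto
    also have "\<dots> = e" using n by simp
    finally show "expectation (Q n) \<le> e" .
  qed
  ultimately show "\<exists>Q. mostly M e (\<lambda>n w. \<bar>(\<Sum>t<n. (lam (int (Suc t)) w)\<^sup>2) / real n - expectation (\<lambda>w. (lam 0 w)\<^sup>2)\<bar> \<le> Q n w) \<and>
     (\<forall>\<^sub>F n in sequentially. integrable M (Q n) \<and> (\<forall>w\<in>space M. 0 \<le> Q n w) \<and> expectation (Q n) \<le> e)" by blast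
qed

end

section \<open>The statistic with known intensities\<close>

context poisson_autoregression
begin

text \<open>Index \<open>t\<close> stands for time \<open>t + 1\<close>: sums over
  \<open>t < n\<close> cover the times 1 to \<open>n\<close>, and a term at time
  \<open>Suc t\<close> is measurable one index later.\<close>

sublocale shifted: filtered_prob_space M "\<lambda>t. past (int (Suc t))"
proof
  show "subalgebra M (past (int (Suc t)))" for t by (rule subalgebra_past)
  show "sets (past (int (Suc t))) \<subseteq> sets (past (int (Suc (Suc t))))" for t by (rule past_mono) simp
qed

definition eps :: "int \<Rightarrow> 'w \<Rightarrow> real" where
  "eps t w = real (N t w) - lam t w"

definition X :: "int \<Rightarrow> 'w \<Rightarrow> real" where
  "X t w = (real (N t w) - lam t w)\<^sup>2 - real (N t w)"

lemma eps_measurable [measurable]: "eps t \<in> borel_measurable M"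
  unfolding eps_def by measurable

lemma X_measurable [measurable]: "X t \<in> borel_measurable M"
  unfolding X_def by measurable

lemma eps_past: "s < t \<Longrightarrow> eps s \<in> borel_measurable (past t)"
  using N_past[of s t] lam_past_less[of s t] unfolding eps_def by measurable

lemma X_past: "s < t \<Longrightarrow> X s \<in> borel_measurable (past t)"
  using N_past[of s t] lam_past_less[of s t] unfolding X_def by measurable

lemma abs_eps_le: "w \<in> space M \<Longrightarrow> \<bar>eps t w\<bar> \<le> Y t w"
  by (simp add: eps_def Y_ge)

lemma abs_X_le: assumes "w \<in> space M" shows "\<bar>X t w\<bar> \<le> (Y t w)\<^sup>2"
proof -
  have l: "0 \<le> lam t w" by (rule lam_nonneg[OF assms])
  have "(real (N t w) - lam t w)\<^sup>2 \<le> (real (N t w) + lam t w)\<^sup>2"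
    using l by (intro abs_le_square_iff[THEN iffD1]) auto
  moreover have "(Y t w)\<^sup>2 = (real (N t w) + lam t w)\<^sup>2 + 2 * (real (N t w) + lam t w) + 1"
    by (simp add: Y_def power2_eq_square algebra_simps)
  moreover have "\<bar>A - x\<bar> \<le> Z" if "A \<le> B" "Z = B + 2 * (x + y) + 1" "0 \<le> x" "0 \<le> y" "0 \<le> A" for A B Z x y :: real
    using that by (simp add: abs_le_iff)
  ultimately show ?thesis
    unfolding X_def using l of_nat_0_le_iff zero_le_power2 by blast
qed

lemma integrable_eps_X: "integrable M (eps t)" "integrable M (X t)" "integrable M (\<lambda>w. (X t w)\<^sup>2)"
  "integrable M (\<lambda>w. \<bar>X t w\<bar> ^ 3)" "expectation (\<lambda>w. (X t w)\<^sup>2) \<le> mu 4" "expectation (\<lambda>w. \<bar>X t w\<bar> ^ 3) \<le> mu 6"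
proof -
  show "integrable M (eps t)" by (rule integrable_Y_bound[where c=1 and p=1 and t=t]) (auto simp: abs_eps_le)
  show "integrable M (X t)" by (rule integrable_Y_bound[where c=1 and p=2 and t=t]) (auto simp: abs_X_le)
  have b2: "(X t w)\<^sup>2 \<le> Y t w ^ 4" if "w \<in> space M" for w
    using power_mono[OF abs_X_le[OF that, of t], of 2] by (simp flip: power_mult)
  show 2: "integrable M (\<lambda>w. (X t w)\<^sup>2)"
    by (rule integrable_Y_bound[where c=1 and p=4 and t=t]) (auto simp: b2)
  have b3: "\<bar>X t w\<bar> ^ 3 \<le> Y t w ^ 6" if "w \<in> space M" for w
    using power_mono[OF abs_X_le[OF that, of t], of 3] by (simp flip: power_mult)
  show 3: "integrable M (\<lambda>w. \<bar>X t w\<bar> ^ 3)"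
    by (rule integrable_Y_bound[where c=1 and p=6 and t=t]) (auto simp: b3)
  show "expectation (\<lambda>w. (X t w)\<^sup>2) \<le> mu 4"
    unfolding expectation_Y_power[of t, symmetric] using 2 integrable_Y_power b2 by (intro integral_mono) auto
  show "expectation (\<lambda>w. \<bar>X t w\<bar> ^ 3) \<le> mu 6"
    unfolding expectation_Y_power[of t, symmetric] using 3 integrable_Y_power b3 by (intro integral_mono) auto
qed

lemma cond_exp_eps: "AE w in M. real_cond_exp M (past t) (eps t) w = 0"
proof -
  have [measurable]: "lam t \<in> borel_measurable (past t)" by (rule lam_past) simp
  have "AE w in M. real_cond_exp M (past t) (\<lambda>w. real (N t w) - lam t w) w = (\<Sum>k. poisson_prob (lam t w) k * (real k - lam t w))"
    using integrable_eps_X(1)[of t] by (intro cond_exp_poisson) (auto simp: eps_def[abs_def])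
  then show ?thesis using poisson_centered_sums(1) by (simp add: eps_def[abs_def] sums_iff)
qed

lemma cond_exp_X: "AE w in M. real_cond_exp M (past t) (X t) w = 0"
proof -
  have [measurable]: "lam t \<in> borel_measurable (past t)" by (rule lam_past) simp
  have "AE w in M. real_cond_exp M (past t) (\<lambda>w. (real (N t w) - lam t w)\<^sup>2 - real (N t w)) w =
      (\<Sum>k. poisson_prob (lam t w) k * ((real k - lam t w)\<^sup>2 - real k))"
    using integrable_eps_X(2)[of t] by (intro cond_exp_poisson) (auto simp: X_def[abs_def])
  then show ?thesis using poisson_centered_sums(2) by (simp add: X_def[abs_def] sums_iff)
qed

lemma cond_exp_X_square: "AE w in M. real_cond_exp M (past t) (\<lambda>w. (X t w)\<^sup>2) w = 2 * (lam t w)\<^sup>2"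
proof -
  have [measurable]: "lam t \<in> borel_measurable (past t)" by (rule lam_past) simp
  have "AE w in M. real_cond_exp M (past t) (\<lambda>w. ((real (N t w) - lam t w)\<^sup>2 - real (N t w))\<^sup>2) w =
      (\<Sum>k. poisson_prob (lam t w) k * ((real k - lam t w)\<^sup>2 - real k)\<^sup>2)"
    using integrable_eps_X(3)[of t] by (intro cond_exp_poisson) (auto simp: X_def[abs_def])
  then show ?thesis using poisson_centered_sums(3) by (simp add: X_def[abs_def] sums_iff)
qed

definition v :: real where "v = 2 * expectation (\<lambda>w. (lam 0 w)\<^sup>2)"

lemma lam_square_le: "w \<in> space M \<Longrightarrow> (lam t w)\<^sup>2 \<le> Y t w ^ 2"
  using lam_nonneg[of w t] Y_ge(2)[of w t] by (intro power_mono)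

lemma integrable_lam_power: "integrable M (\<lambda>w. lam t w ^ p)"
  by (rule integrable_Y_bound[where c=1 and p=p and t=t]) (auto simp: lam_nonneg Y_ge power_mono)

text \<open>If \<open>v\<close> were 0, the intensity at time 0 would vanish almost surely, hence so
  would the count, whose mean is that of the intensity. The recursion would then make the intensity
  at time 1 equal to the positive constant \<open>f 0 0\<close>, against stationarity.\<close>

lemma v_pos: "0 < v"
proof (rule ccontr)
  assume "\<not> 0 < v"
  moreover have "0 \<le> expectation (\<lambda>w. (lam 0 w)\<^sup>2)" by (intro integral_nonneg_AE) auto
  ultimately have z: "expectation (\<lambda>w. (lam 0 w)\<^sup>2) = 0" by (simp add: v_def)
  then have l0: "AE w in M. lam 0 w = 0"
    using integrable_lam_power[of 0 2] by (subst (asm) integral_nonneg_eq_0_iff_AE) auto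
  have "expectation (eps 0) = 0"
  proof -
    interpret sigma_finite_subalgebra M "past 0" by (rule sigma_finite_past)
    have "expectation (eps 0) = expectation (real_cond_exp M (past 0) (eps 0))"
      by (rule real_cond_exp_int(2)[symmetric]) (rule integrable_eps_X)
    also have "\<dots> = expectation (\<lambda>w. 0)" using cond_exp_eps[of 0] by (intro integral_cong_AE) auto
    finally show ?thesis by simp
  qed
  moreover have "expectation (eps 0) = expectation (\<lambda>w. real (N 0 w))"
    using l0 by (intro integral_cong_AE) (auto simp: eps_def)
  moreover have "integrable M (\<lambda>w. real (N 0 w))"
    by (rule integrable_Y_bound[where c=1 and p=1 and t=0]) (auto simp: Y_ge)
  ultimately have n0: "AE w in M. real (N 0 w) = 0"
    using integral_nonneg_eq_0_iff_AE[of M "\<lambda>w. real (N 0 w)"] by simp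
  have "AE w in M. lam 1 w = f 0 0"
    using l0 n0 AE_space by eventually_elim (use recursion[of _ 1] in auto)
  then have "expectation (\<lambda>w. (lam 1 w)\<^sup>2) = expectation (\<lambda>w. (f 0 0)\<^sup>2)"
    by (intro integral_cong_AE) auto
  then have "expectation (\<lambda>w. (lam 1 w)\<^sup>2) = (f 0 0)\<^sup>2" by (simp add: prob_space)
  moreover have "expectation (\<lambda>w. (lam 1 w)\<^sup>2) = expectation (\<lambda>w. (lam 0 w)\<^sup>2)"
    using stationary_expectation(1)[of "\<lambda>x. (fst x)\<^sup>2" 1] by simp
  ultimately show False using z f00 by simp
qed

definition T :: "nat \<Rightarrow> 'w \<Rightarrow> real" where
  "T n w = (\<Sum>t<n. X (int (Suc t)) w) / sqrt (real n)"

lemma T_measurable [measurable]: "T n \<in> borel_measurable M"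
  unfolding T_def by measurable

text \<open>The conditional variance of \<open>X t\<close> is \<open>2 * (lam t)\<^sup>2\<close>,
  whose averages converge to \<open>v\<close>; the moment constants come from domination by powers
  of \<open>Y\<close> and are uniform in time.\<close>

lemma T_char: "(\<lambda>n. char (distr M borel (T n)) u) \<longlonglongrightarrow> complex_of_real (exp (- (u\<^sup>2 * v / 2)))"
  unfolding T_def[abs_def]
proof (rule shifted.martingale_clt_char[where s="\<lambda>t w. 2 * (lam (int (Suc t)) w)\<^sup>2" and ?B3.0="mu 6" and ?B2.0="4 * mu 4"])
  fix t
  have [measurable]: "lam (int (Suc t)) \<in> borel_measurable (past (int (Suc t)))" by (rule lam_past) simp
  show "(\<lambda>w. 2 * (lam (int (Suc t)) w)\<^sup>2) \<in> borel_measurable (past (int (Suc t)))" by measurable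
  have e: "(2 * (lam (int (Suc t)) w)\<^sup>2)\<^sup>2 = 4 * lam (int (Suc t)) w ^ 4" for w
    by (simp add: power_mult_distrib flip: power_mult)
  show i: "integrable M (\<lambda>w. (2 * (lam (int (Suc t)) w)\<^sup>2)\<^sup>2)"
    unfolding e using integrable_lam_power by simp
  have "expectation (\<lambda>w. lam (int (Suc t)) w ^ 4) \<le> expectation (\<lambda>w. Y (int (Suc t)) w ^ 4)"
    by (rule integral_mono[OF integrable_lam_power integrable_Y_power]) (auto simp: lam_nonneg Y_ge intro!: power_mono)
  then show "expectation (\<lambda>w. (2 * (lam (int (Suc t)) w)\<^sup>2)\<^sup>2) \<le> 4 * mu 4"
    unfolding e using integrable_lam_power by (simp add: expectation_Y_power)
next
  have "small_in_prob M (\<lambda>n w. 2 * ((\<Sum>t<n. (lam (int (Suc t)) w)\<^sup>2) / real n - expectation (\<lambda>w. (lam 0 w)\<^sup>2)))"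
    by (rule small_in_prob_cmult[OF lln_lam_square])
  then show "small_in_prob M (\<lambda>n w. (\<Sum>t<n. 2 * (lam (int (Suc t)) w)\<^sup>2) / real n - v)"
    by (simp add: v_def algebra_simps sum_distrib_left)
qed (use v_pos in \<open>auto intro: X_past integrable_eps_X cond_exp_X cond_exp_X_square\<close>)

lemma T_tight: "tight_in_prob M T"
proof (rule tight_in_prob_L1[where Q="\<lambda>n w. 1 + (T n w)\<^sup>2" and c="1 + mu 4"])
  have S: "integrable M (\<lambda>w. (\<Sum>t<n. X (int (Suc t)) w)\<^sup>2) \<and>
      expectation (\<lambda>w. (\<Sum>t<n. X (int (Suc t)) w)\<^sup>2) = (\<Sum>t<n. expectation (\<lambda>w. (X (int (Suc t)) w)\<^sup>2))" for n
    by (rule shifted.martingale_difference_sum_square) (auto intro: X_past cond_exp_X integrable_eps_X)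
  have T2: "(T n w)\<^sup>2 = (\<Sum>t<n. X (int (Suc t)) w)\<^sup>2 / real n" for n w
    by (simp add: T_def power_divide)
  show "integrable M (\<lambda>w. 1 + (T n w)\<^sup>2)" for n
    unfolding T2 using S[of n] by (intro Bochner_Integration.integrable_add integrable_divide) auto
  show "\<bar>T n w\<bar> \<le> 1 + (T n w)\<^sup>2" for n w
    using abs_mult_le_sum_squares[of 1 "T n w"] by simp
  show "expectation (\<lambda>w. 1 + (T n w)\<^sup>2) \<le> 1 + mu 4" for n
  proof -
    have "expectation (\<lambda>w. 1 + (T n w)\<^sup>2) = 1 + (\<Sum>t<n. expectation (\<lambda>w. (X (int (Suc t)) w)\<^sup>2)) / real n"
      unfolding T2 using S[of n] by (simp add: prob_space)
    also have "\<dots> \<le> 1 + (\<Sum>t<n. mu 4) / real n"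
      by (intro add_left_mono divide_right_mono sum_mono integrable_eps_X) auto
    also have "\<dots> \<le> 1 + mu 4" using mu_nonneg[of 4] by simp
    finally show ?thesis .
  qed
qed

end

section \<open>Perturbation of the intensity recursion\<close>

lemma power_convex_combination:
  fixes a x y :: real
  assumes "0 \<le> a" "a \<le> 1" "0 \<le> x" "0 \<le> y"
  shows "(a * x + (1 - a) * y) ^ p \<le> a * x ^ p + (1 - a) * y ^ p"
proof -
  have c: "convex_on {0::real..} (\<lambda>x. x ^ p)"
    by (cases "even p") (auto intro: convex_power_odd convex_on_subset[OF convex_power_even])
  from convex_onD[OF c, of "1 - a" x y] assms show ?thesis by simp
qed

lemma geometric_sum_le:
  fixes a :: real
  assumes "0 \<le> a" "a < 1"
  shows "(\<Sum>t<n. a ^ t) \<le> 1 / (1 - a)"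
  using sum_le_suminf[of "\<lambda>t. a ^ t" "{..<n}"] suminf_geometric[of a] assms by (simp add: summable_geometric)

lemma fold_contraction:
  fixes f :: "real \<Rightarrow> nat \<Rightarrow> real"
  assumes "\<And>l y. 0 \<le> l \<Longrightarrow> 0 \<le> f l y" "0 \<le> a"
    and "\<And>l l' y. 0 \<le> l \<Longrightarrow> 0 \<le> l' \<Longrightarrow> \<bar>f l y - f l' y\<bar> \<le> a * \<bar>l - l'\<bar>"
  shows "0 \<le> l \<Longrightarrow> 0 \<le> l' \<Longrightarrow>
    \<bar>fold (\<lambda>y l. f l y) ns l - fold (\<lambda>y l. f l y) ns l'\<bar> \<le> a ^ length ns * \<bar>l - l'\<bar>"
proof (induction ns arbitrary: l l')
  case (Cons y ns)
  have "\<bar>fold (\<lambda>y l. f l y) (y # ns) l - fold (\<lambda>y l. f l y) (y # ns) l'\<bar> \<le> a ^ length ns * \<bar>f l y - f l' y\<bar>"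
    using Cons.IH[of "f l y" "f l' y"] assms(1) Cons.prems by simp
  also have "\<dots> \<le> a ^ length ns * (a * \<bar>l - l'\<bar>)"
    using assms(2,3) Cons.prems by (intro mult_left_mono) auto
  finally show ?case by (simp add: ac_simps)
qed simp

text \<open>The bound is the fixed point of \<open>x \<mapsto> a * x + c * (2 * L + 1)\<close>, so
  one step preserves it, provided the unperturbed recursion stays in \<open>[0, L]\<close>, where
  the perturbation is at most \<open>c * (2 * L + 1)\<close>.\<close>

lemma fold_perturbation:
  fixes f f0 :: "real \<Rightarrow> nat \<Rightarrow> real"
  assumes f: "\<And>l y. 0 \<le> l \<Longrightarrow> 0 \<le> f l y" and a: "0 \<le> a" "a < 1" and c: "0 \<le> c"
    and contr: "\<And>l l' y. 0 \<le> l \<Longrightarrow> 0 \<le> l' \<Longrightarrow> \<bar>f l y - f l' y\<bar> \<le> a * \<bar>l - l'\<bar>"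
    and close: "\<And>l y. 0 \<le> l \<Longrightarrow> \<bar>f l y - f0 l y\<bar> \<le> c * (l + real y + 1)"
    and f0: "\<And>l y. 0 \<le> l \<Longrightarrow> l \<le> L \<Longrightarrow> real y \<le> L \<Longrightarrow> 0 \<le> f0 l y \<and> f0 l y \<le> L"
  shows "0 \<le> l \<Longrightarrow> 0 \<le> l0 \<Longrightarrow> l0 \<le> L \<Longrightarrow> \<forall>y\<in>set ns. real y \<le> L \<Longrightarrow> \<bar>l - l0\<bar> \<le> c * (2 * L + 1) / (1 - a) \<Longrightarrow>
    \<bar>fold (\<lambda>y l. f l y) ns l - fold (\<lambda>y l. f0 l y) ns l0\<bar> \<le> c * (2 * L + 1) / (1 - a)"
proof (induction ns arbitrary: l l0)
  case (Cons y ns)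
  have y: "real y \<le> L" using Cons.prems by simp
  have "\<bar>f l y - f0 l0 y\<bar> \<le> \<bar>f l y - f l0 y\<bar> + \<bar>f l0 y - f0 l0 y\<bar>" by linarith
  also have "\<bar>f l y - f l0 y\<bar> \<le> a * (c * (2 * L + 1) / (1 - a))"
    using Cons.prems a by (intro order_trans[OF contr[of l l0 y] mult_left_mono]) auto
  also have "\<bar>f l0 y - f0 l0 y\<bar> \<le> c * (2 * L + 1)"
    using Cons.prems c y by (intro order_trans[OF close[of l0 y] mult_left_mono]) auto
  also have "a * (c * (2 * L + 1) / (1 - a)) + c * (2 * L + 1) = c * (2 * L + 1) / (1 - a)"
    using a by (simp add: field_simps)
  finally have "\<bar>f l y - f0 l0 y\<bar> \<le> c * (2 * L + 1) / (1 - a)" by simp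
  then have "\<bar>fold (\<lambda>y l. f l y) ns (f l y) - fold (\<lambda>y l. f0 l y) ns (f0 l0 y)\<bar> \<le> c * (2 * L + 1) / (1 - a)"
    using Cons.prems f f0[of l0 y] y by (intro Cons.IH) auto
  then show ?case by simp
qed simp

lemma lhat_Suc: "1 \<le> t \<Longrightarrow> lhat f th l1 Ns (Suc t) = f th (lhat f th l1 Ns t) (Ns (int t))"
  by (cases t) auto

lemma lhat_fold:
  "1 \<le> t \<Longrightarrow> lhat f th l1 Ns (t + m) = fold (\<lambda>y l. f th l y) (map (\<lambda>j. Ns (int (t + j))) [0..<m]) (lhat f th l1 Ns t)"
proof (induction m)
  case (Suc m)
  then show ?case using lhat_Suc[of "t + m" f th l1 Ns] by simp
qed simp

lemma lhat_nonneg: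
  assumes "\<And>l y. 0 \<le> l \<Longrightarrow> 0 \<le> f th l y" "0 \<le> l1"
  shows "0 \<le> lhat f th l1 Ns t"
proof (induction t)
  case (Suc t)
  then show ?case using assms lhat_Suc[of t f th l1 Ns] by (cases t) auto
qed simp

context poisson_autoregression
begin

text \<open>Unrolled, the sum of \<open>\<kappa>1 ^ (t - 1 - s) * Y s\<close> over
  \<open>s < t\<close>: the effect of an error proportional to \<open>Y\<close> in every step,
  forgotten at rate \<open>\<kappa>1\<close>. It involves no estimator.\<close>

primrec W :: "nat \<Rightarrow> 'w \<Rightarrow> real" where
  "W 0 w = 0"
| "W (Suc t) w = \<kappa>1 * W t w + Y (int t) w"

lemma kappa1: "0 \<le> \<kappa>1" "\<kappa>1 < 1"
  using kappa by auto

lemma W_measurable [measurable]: "W t \<in> borel_measurable M"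
  by (induction t) auto

lemma W_nonneg: "w \<in> space M \<Longrightarrow> 0 \<le> W t w"
  by (induction t) (auto simp: kappa1 Y_ge)

text \<open>\<open>W (Suc t)\<close> is a convex combination of \<open>W t\<close> and
  \<open>Y t / (1 - \<kappa>1)\<close>, so convexity of powers reproduces the bound, which is the
  moment bound of the second of these.\<close>

lemma W_power:
  assumes p: "0 < p"
  shows "integrable M (\<lambda>w. W t w ^ p) \<and> expectation (\<lambda>w. W t w ^ p) \<le> mu p / (1 - \<kappa>1) ^ p"
proof (induction t)
  case 0
  then show ?case using p kappa1 mu_nonneg by (simp add: zero_power)
next
  case (Suc t)
  have b: "W (Suc t) w ^ p \<le> \<kappa>1 * W t w ^ p + (1 - \<kappa>1) * (Y (int t) w ^ p / (1 - \<kappa>1) ^ p)" if w: "w \<in> space M" for w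
    using power_convex_combination[of \<kappa>1 "W t w" "Y (int t) w / (1 - \<kappa>1)" p] kappa1 W_nonneg[OF w, of t] Y_ge(5)[OF w]
    by (simp add: power_divide)
  let ?B = "\<lambda>w. \<kappa>1 * W t w ^ p + (1 - \<kappa>1) * (Y (int t) w ^ p / (1 - \<kappa>1) ^ p)"
  have iB: "integrable M ?B"
    using Suc.IH integrable_Y_power[of "int t" p] by (intro Bochner_Integration.integrable_add integrable_mult_right integrable_divide) auto
  have i: "integrable M (\<lambda>w. W (Suc t) w ^ p)"
  proof (rule Bochner_Integration.integrable_bound[OF iB])
    show "AE w in M. norm (W (Suc t) w ^ p) \<le> norm (?B w)"
      using b W_nonneg[of _ "Suc t"] by (intro AE_I2) (auto simp del: W.simps intro: order_trans[OF _ abs_ge_self])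
  qed measurable
  have "expectation (\<lambda>w. W (Suc t) w ^ p) \<le> expectation ?B"
    by (rule integral_mono[OF i iB b])
  also have "\<dots> = \<kappa>1 * expectation (\<lambda>w. W t w ^ p) + (1 - \<kappa>1) * (mu p / (1 - \<kappa>1) ^ p)"
    using Suc.IH integrable_Y_power[of "int t" p] by (simp add: expectation_Y_power)
  also have "\<dots> \<le> \<kappa>1 * (mu p / (1 - \<kappa>1) ^ p) + (1 - \<kappa>1) * (mu p / (1 - \<kappa>1) ^ p)"
    using Suc.IH kappa1 by (intro add_right_mono mult_left_mono) auto
  also have "\<dots> = mu p / (1 - \<kappa>1) ^ p" unfolding distrib_right[symmetric] by simp
  finally show ?case using i by blast
qed

definition nu :: real where
  "nu = 2 * mu 3 + mu 3 / (1 - \<kappa>1) ^ 3"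

lemma nu_nonneg: "0 \<le> nu"
  unfolding nu_def using mu_nonneg kappa1 by simp

text \<open>The factors belong to different, dependent times; bounding the product by the sum of
  cubes reduces everything to third moments, two of \<open>Y\<close> and one of \<open>W\<close>,
  which is \<open>nu\<close>.\<close>

lemma triple_product:
  "integrable M (\<lambda>w. \<bar>eps s w\<bar> * W t w * Y r w)" "expectation (\<lambda>w. \<bar>eps s w\<bar> * W t w * Y r w) \<le> nu"
proof -
  let ?B = "\<lambda>w. Y s w ^ 3 + W t w ^ 3 + Y r w ^ 3"
  have cube: "x * y * z \<le> x ^ 3 + y ^ 3 + z ^ 3" if "0 \<le> x" "0 \<le> y" "0 \<le> z" for x y z :: real
  proof -
    define m where "m = max x (max y z)"
    have "x * y * z \<le> m * m * m" using that by (intro mult_mono) (auto simp: m_def)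
    also have "\<dots> = m ^ 3" by (simp add: power3_eq_cube)
    also have "\<dots> \<le> x ^ 3 + y ^ 3 + z ^ 3" using that by (auto simp: m_def max_def)
    finally show ?thesis .
  qed
  have b: "\<bar>eps s w\<bar> * W t w * Y r w \<le> ?B w" if w: "w \<in> space M" for w
  proof -
    have "\<bar>eps s w\<bar> * W t w * Y r w \<le> Y s w * W t w * Y r w"
      using abs_eps_le[OF w] W_nonneg[OF w] Y_ge(5)[OF w] by (intro mult_right_mono) auto
    also have "\<dots> \<le> ?B w" using W_nonneg[OF w] Y_ge(5)[OF w] by (intro cube) auto
    finally show ?thesis .
  qed
  have W3: "integrable M (\<lambda>w. W t w ^ 3)" "expectation (\<lambda>w. W t w ^ 3) \<le> mu 3 / (1 - \<kappa>1) ^ 3"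
    using W_power[of 3 t] by auto
  have iB: "integrable M ?B"
    using W3 integrable_Y_power by (intro Bochner_Integration.integrable_add) auto
  have n: "0 \<le> \<bar>eps s w\<bar> * W t w * Y r w" if w: "w \<in> space M" for w
    using W_nonneg[OF w] Y_ge(5)[OF w] by simp
  show i: "integrable M (\<lambda>w. \<bar>eps s w\<bar> * W t w * Y r w)"
  proof (rule Bochner_Integration.integrable_bound[OF iB])
    show "AE w in M. norm (\<bar>eps s w\<bar> * W t w * Y r w) \<le> norm (?B w)"
      using order_trans[OF b abs_ge_self] n by (intro AE_I2) (simp add: abs_of_nonneg)
  qed measurable
  have "expectation (\<lambda>w. \<bar>eps s w\<bar> * W t w * Y r w) \<le> expectation ?B"
    by (rule integral_mono[OF i iB b])
  also have "\<dots> \<le> nu"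
    unfolding nu_def using W3 integrable_Y_power by (simp add: expectation_Y_power)
  finally show "expectation (\<lambda>w. \<bar>eps s w\<bar> * W t w * Y r w) \<le> nu" .
qed

text \<open>Insert the factor \<open>Y 0\<close>, which is at least 1.\<close>

lemma double_product:
  "integrable M (\<lambda>w. \<bar>eps s w\<bar> * W t w)" "expectation (\<lambda>w. \<bar>eps s w\<bar> * W t w) \<le> nu"
proof -
  have b: "\<bar>eps s w\<bar> * W t w \<le> \<bar>eps s w\<bar> * W t w * Y 0 w" if w: "w \<in> space M" for w
    using mult_left_mono[OF Y_ge(1)[OF w, of 0], of "\<bar>eps s w\<bar> * W t w"] W_nonneg[OF w] by simp
  have n: "0 \<le> \<bar>eps s w\<bar> * W t w" if w: "w \<in> space M" for w using W_nonneg[OF w] by simp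
  show i: "integrable M (\<lambda>w. \<bar>eps s w\<bar> * W t w)"
  proof (rule Bochner_Integration.integrable_bound[OF triple_product(1)[of s t 0]])
    show "AE w in M. norm (\<bar>eps s w\<bar> * W t w) \<le> norm (\<bar>eps s w\<bar> * W t w * Y 0 w)"
      using order_trans[OF b abs_ge_self] n by (intro AE_I2) (simp add: abs_of_nonneg)
  qed measurable
  have "expectation (\<lambda>w. \<bar>eps s w\<bar> * W t w) \<le> expectation (\<lambda>w. \<bar>eps s w\<bar> * W t w * Y 0 w)"
    by (rule integral_mono[OF i triple_product(1) b])
  also have "\<dots> \<le> nu" by (rule triple_product(2))
  finally show "expectation (\<lambda>w. \<bar>eps s w\<bar> * W t w) \<le> nu" .
qed

lemma eps_moments:
  "integrable M (\<lambda>w. \<bar>eps s w\<bar>)" "expectation (\<lambda>w. \<bar>eps s w\<bar>) \<le> mu 1"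
  "integrable M (\<lambda>w. (eps s w)\<^sup>2)" "expectation (\<lambda>w. (eps s w)\<^sup>2) \<le> mu 2"
proof -
  show 1: "integrable M (\<lambda>w. \<bar>eps s w\<bar>)" using integrable_eps_X(1) by simp
  have "expectation (\<lambda>w. \<bar>eps s w\<bar>) \<le> expectation (\<lambda>w. Y s w ^ 1)"
    by (rule integral_mono[OF 1 integrable_Y_power]) (simp add: abs_eps_le)
  then show "expectation (\<lambda>w. \<bar>eps s w\<bar>) \<le> mu 1" by (simp only: expectation_Y_power)
  have b: "(eps s w)\<^sup>2 \<le> Y s w ^ 2" if "w \<in> space M" for w
    using power_mono[OF abs_eps_le[OF that, of s], of 2] by simp
  show 2: "integrable M (\<lambda>w. (eps s w)\<^sup>2)"
    by (rule integrable_Y_bound[where c=1 and p=2 and t=s]) (auto simp: b)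
  have "expectation (\<lambda>w. (eps s w)\<^sup>2) \<le> expectation (\<lambda>w. Y s w ^ 2)"
    by (rule integral_mono[OF 2 integrable_Y_power b])
  then show "expectation (\<lambda>w. (eps s w)\<^sup>2) \<le> mu 2" by (simp only: expectation_Y_power)
qed

section \<open>Cells of the recent past and their martingales\<close>

definition recent :: "nat \<Rightarrow> nat \<Rightarrow> 'w \<Rightarrow> nat list" where
  "recent m t w = map (\<lambda>j. N (int (t + j)) w) [0..<m]"

lemma lam_fold: "w \<in> space M \<Longrightarrow> lam (int (t + m)) w = fold (\<lambda>y l. f l y) (recent m t w) (lam (int t) w)"
proof (induction m)
  case (Suc m)
  have "lam (int (t + Suc m)) w = f (lam (int (t + m)) w) (N (int (t + m)) w)"
    using recursion[OF Suc.prems, of "int (t + Suc m)"] by simp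
  then show ?case using Suc by (simp add: recent_def)
qed (simp add: recent_def)

text \<open>At time \<open>t + 1\<close> the last \<open>m\<close> counts and the intensity \<open>m\<close> steps back, rounded down to a grid of
  mesh \<open>\<gamma>\<close>. Up to \<open>\<gamma>\<close> and a geometrically small error the plug-in intensity is a function of this cell.\<close>

definition cell :: "nat \<Rightarrow> real \<Rightarrow> nat \<Rightarrow> 'w \<Rightarrow> nat \<times> nat list" where
  "cell m \<gamma> t w = (nat \<lfloor>lam (int (Suc t - m)) w / \<gamma>\<rfloor>, recent m (Suc t - m) w)"

definition cells :: "nat \<Rightarrow> real \<Rightarrow> nat \<Rightarrow> (nat \<times> nat list) set" where
  "cells m \<gamma> L = {..nat \<lfloor>real L / \<gamma>\<rfloor>} \<times> {ns. set ns \<subseteq> {..L} \<and> length ns = m}"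

lemma finite_cells: "finite (cells m \<gamma> L)"
  unfolding cells_def by (intro finite_cartesian_product finite_lists_length_eq) auto

lemma card_cells:
  assumes "0 < \<gamma>"
  shows "real (card (cells m \<gamma> L)) \<le> (real L / \<gamma> + 1) * (real L + 1) ^ m"
proof -
  have "real (card (cells m \<gamma> L)) = (real (nat \<lfloor>real L / \<gamma>\<rfloor>) + 1) * (real L + 1) ^ m"
    unfolding cells_def by (simp add: card_cartesian_product card_lists_length_eq algebra_simps)
  also have "real (nat \<lfloor>real L / \<gamma>\<rfloor>) \<le> real L / \<gamma>"
    using assms by (simp add: of_nat_nat)
  finally show ?thesis by (simp add: mult_right_mono)
qed

text \<open>The window runs from time \<open>Suc t - m\<close> to time \<open>t\<close>, so the cell
  is known before the count at time \<open>Suc t\<close>; this is what keeps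
  \<open>eps (Suc t)\<close> centred on each cell.\<close>

lemma cell_past:
  assumes "m \<le> t"
  shows "{w \<in> space M. cell m \<gamma> t w = c} \<in> sets (past (int (Suc t)))"
proof (cases "length (snd c) = m")
  case len: True
  have [measurable]: "lam (int (Suc t - m)) \<in> borel_measurable (past (int (Suc t)))" by (rule lam_past) simp
  have nm: "N (int (Suc t - m + j)) \<in> measurable (past (int (Suc t))) (count_space UNIV)" if "j < m" for j
    using that assms by (intro N_past) auto
  have 1: "{w \<in> space (past (int (Suc t))). nat \<lfloor>lam (int (Suc t - m)) w / \<gamma>\<rfloor> = fst c} \<in> sets (past (int (Suc t)))"
    by measurable
  have 2: "{w \<in> space (past (int (Suc t))). \<forall>j\<in>{..<m}. N (int (Suc t - m + j)) w = snd c ! j} \<in> sets (past (int (Suc t)))"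
  proof (rule sets.sets_Collect_finite_All)
    show "{w \<in> space (past (int (Suc t))). N (int (Suc t - m + j)) w = snd c ! j} \<in> sets (past (int (Suc t)))" if "j \<in> {..<m}" for j
    proof -
      have "N (int (Suc t - m + j)) -` {snd c ! j} \<inter> space (past (int (Suc t))) \<in> sets (past (int (Suc t)))"
        using that by (intro measurable_sets[OF nm]) auto
      also have "N (int (Suc t - m + j)) -` {snd c ! j} \<inter> space (past (int (Suc t)))
          = {w \<in> space (past (int (Suc t))). N (int (Suc t - m + j)) w = snd c ! j}" by blast
      finally show ?thesis .
    qed
  qed auto
  have "{w \<in> space M. cell m \<gamma> t w = c} =
    {w \<in> space (past (int (Suc t))). nat \<lfloor>lam (int (Suc t - m)) w / \<gamma>\<rfloor> = fst c}
    \<inter> {w \<in> space (past (int (Suc t))). \<forall>j\<in>{..<m}. N (int (Suc t - m + j)) w = snd c ! j}"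
    using len by (auto simp: cell_def recent_def prod_eq_iff list_eq_iff_nth_eq)
  with 1 2 show ?thesis by simp
next
  case False
  then have empty: "{w \<in> space M. cell m \<gamma> t w = c} = {}" by (auto simp: cell_def recent_def)
  show ?thesis unfolding empty by (rule sets.empty_sets)
qed

text \<open>The martingale of one cell. The condition \<open>m \<le> t\<close> makes the window
  start at time 1 or later; otherwise the natural subtraction would start it at time 0, where the
  plug-in intensity is undefined.\<close>

definition cell_sum :: "nat \<Rightarrow> real \<Rightarrow> nat \<Rightarrow> nat \<times> nat list \<Rightarrow> 'w \<Rightarrow> real" where
  "cell_sum m \<gamma> n c w = (\<Sum>t<n. eps (int (Suc t)) w * of_bool (m \<le> t \<and> cell m \<gamma> t w = c))"

text \<open>Cauchy-Schwarz with a free weight \<open>a\<close>. Squares are orthogonal in time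
  within a cell, and each time falls in at most one cell, so the mean of all squares together is at
  most \<open>real n * mu 2\<close>; the number of cells enters only through the term divided by
  \<open>a\<close>.\<close>

lemma cell_sum_L1:
  assumes a: "0 < a"
  shows "integrable M (\<lambda>w. \<Sum>c\<in>cells m \<gamma> L. \<bar>cell_sum m \<gamma> n c w\<bar>)"
    "expectation (\<lambda>w. \<Sum>c\<in>cells m \<gamma> L. \<bar>cell_sum m \<gamma> n c w\<bar>) \<le> a * (real n * mu 2) + real (card (cells m \<gamma> L)) / a"
proof -
  let ?C = "cells m \<gamma> L"
  define D where "D c t w = eps (int (Suc t)) w * of_bool (m \<le> t \<and> cell m \<gamma> t w = c)" for c t w
  define I where "I c t w = (of_bool (m \<le> t \<and> cell m \<gamma> t w = c) :: real)" for c t w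
  have IF: "I c t \<in> borel_measurable (past (int (Suc t)))" for c t
  proof (cases "m \<le> t")
    case True
    have [measurable]: "Measurable.pred (past (int (Suc t))) (\<lambda>w. cell m \<gamma> t w = c)"
      using cell_past[OF True, of \<gamma> c] by (simp add: pred_def)
    show ?thesis unfolding I_def by measurable
  qed (simp add: I_def[abs_def])
  have DI: "D c t = (\<lambda>w. eps (int (Suc t)) w * I c t w)" for c t by (simp add: D_def I_def fun_eq_iff)
  have IM [measurable]: "I c t \<in> borel_measurable M" for c t by (rule measurable_from_subalg[OF subalgebra_past IF])
  have DM [measurable]: "D c t \<in> borel_measurable M" for c t unfolding DI by measurable
  have I01: "I c t w = 0 \<or> I c t w = 1" for c t w by (simp add: I_def)
  have Dle: "(D c t w)\<^sup>2 \<le> (eps (int (Suc t)) w)\<^sup>2" for c t w using I01[of c t w] by (auto simp: DI)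
  have D2: "integrable M (\<lambda>w. (D c t w)\<^sup>2)" for c t
    by (rule Bochner_Integration.integrable_bound[OF eps_moments(3)[of "int (Suc t)"]])
       (use Dle in \<open>auto intro!: AE_I2 simp del: of_nat_Suc\<close>)
  have Di: "integrable M (D c t)" for c t
    by (rule square_integrable_imp_integrable[OF _ D2]) simp
  have Dpast: "D c t \<in> borel_measurable (past (int (Suc (Suc t))))" for c t
    unfolding DI by (intro borel_measurable_times eps_past measurable_past_mono[OF IF]) auto
  have cond: "AE w in M. real_cond_exp M (past (int (Suc t))) (D c t) w = 0" for c t
  proof -
    interpret sigma_finite_subalgebra M "past (int (Suc t))" by (rule sigma_finite_past)
    have "AE w in M. real_cond_exp M (past (int (Suc t))) (\<lambda>w. I c t w * eps (int (Suc t)) w) w =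
       I c t w * real_cond_exp M (past (int (Suc t))) (eps (int (Suc t))) w"
      using IF Di[of c t] by (intro real_cond_exp_mult) (auto simp: DI mult.commute)
    with cond_exp_eps[of "int (Suc t)"] show ?thesis
      by eventually_elim (simp add: DI mult.commute)
  qed
  have sq: "integrable M (\<lambda>w. (\<Sum>t<n. D c t w)\<^sup>2) \<and>
      expectation (\<lambda>w. (\<Sum>t<n. D c t w)\<^sup>2) = (\<Sum>t<n. expectation (\<lambda>w. (D c t w)\<^sup>2))" for c
    by (rule shifted.martingale_difference_sum_square[OF Dpast cond D2])
  have cs: "cell_sum m \<gamma> n c w = (\<Sum>t<n. D c t w)" for c w by (simp add: cell_sum_def D_def)
  have csM [measurable]: "cell_sum m \<gamma> n c \<in> borel_measurable M" for c unfolding cs[abs_def] by measurable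
  have csi: "integrable M (cell_sum m \<gamma> n c)" for c unfolding cs[abs_def] using Di by simp
  have cs2i: "integrable M (\<lambda>w. (cell_sum m \<gamma> n c w)\<^sup>2)" for c unfolding cs using sq by blast
  show i: "integrable M (\<lambda>w. \<Sum>c\<in>?C. \<bar>cell_sum m \<gamma> n c w\<bar>)"
    using csi by (intro Bochner_Integration.integrable_sum integrable_abs)
  have ineq: "\<bar>x\<bar> \<le> a * x\<^sup>2 + 1 / a" for x :: real
  proof -
    have "\<bar>(a * x) * 1\<bar> \<le> (a * x)\<^sup>2 + 1\<^sup>2" by (rule abs_mult_le_sum_squares)
    then have "a * \<bar>x\<bar> \<le> a * (a * x\<^sup>2 + 1 / a)" using a by (simp add: abs_mult power2_eq_square algebra_simps)
    then show ?thesis using a by simp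
  qed
  have "expectation (\<lambda>w. \<Sum>c\<in>?C. \<bar>cell_sum m \<gamma> n c w\<bar>) \<le> expectation (\<lambda>w. \<Sum>c\<in>?C. a * (cell_sum m \<gamma> n c w)\<^sup>2 + 1 / a)"
  proof (rule integral_mono[OF i])
    show "integrable M (\<lambda>w. \<Sum>c\<in>?C. a * (cell_sum m \<gamma> n c w)\<^sup>2 + 1 / a)"
      using cs2i by (intro Bochner_Integration.integrable_sum Bochner_Integration.integrable_add integrable_mult_right) auto
  qed (intro sum_mono ineq)
  also have "\<dots> = (\<Sum>c\<in>?C. a * expectation (\<lambda>w. (cell_sum m \<gamma> n c w)\<^sup>2) + 1 / a)"
    using cs2i by (simp add: prob_space)
  also have "\<dots> = a * (\<Sum>c\<in>?C. \<Sum>t<n. expectation (\<lambda>w. (D c t w)\<^sup>2)) + real (card ?C) / a"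
    unfolding cs using sq by (simp add: sum.distrib sum_distrib_left)
  also have "(\<Sum>c\<in>?C. \<Sum>t<n. expectation (\<lambda>w. (D c t w)\<^sup>2)) = (\<Sum>t<n. \<Sum>c\<in>?C. expectation (\<lambda>w. (D c t w)\<^sup>2))"
    by (rule sum.swap)
  also have "\<dots> \<le> (\<Sum>t<n. mu 2)"
  proof (rule sum_mono)
    fix t
    have "(\<Sum>c\<in>?C. expectation (\<lambda>w. (D c t w)\<^sup>2)) = expectation (\<lambda>w. \<Sum>c\<in>?C. (D c t w)\<^sup>2)"
      using D2 by simp
    also have "\<dots> \<le> expectation (\<lambda>w. (eps (int (Suc t)) w)\<^sup>2)"
    proof (rule integral_mono)
      fix w
      \<comment> \<open>At most one summand survives, the one of the cell occupied at
        \<open>t\<close>.\<close>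
      have "(\<Sum>c\<in>?C. (D c t w)\<^sup>2) = (\<Sum>c\<in>?C. if c = cell m \<gamma> t w then (D c t w)\<^sup>2 else 0)"
        by (intro sum.cong) (auto simp: D_def)
      also have "\<dots> \<le> (eps (int (Suc t)) w)\<^sup>2"
        using finite_cells Dle by (simp add: sum.delta)
      finally show "(\<Sum>c\<in>?C. (D c t w)\<^sup>2) \<le> (eps (int (Suc t)) w)\<^sup>2" .
    qed (use D2 eps_moments in auto)
    also have "\<dots> \<le> mu 2" by (rule eps_moments)
    finally show "(\<Sum>c\<in>?C. expectation (\<lambda>w. (D c t w)\<^sup>2)) \<le> mu 2" .
  qed
  finally show "expectation (\<lambda>w. \<Sum>c\<in>?C. \<bar>cell_sum m \<gamma> n c w\<bar>) \<le> a * (real n * mu 2) + real (card ?C) / a"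
    using a by simp
qed

end

section \<open>The plug-in intensities\<close>

locale plug_in = poisson_autoregression M "f \<theta>0" \<kappa>1 \<kappa>2 N lam
  for M :: "'w measure" and f :: "'a::euclidean_space \<Rightarrow> real \<Rightarrow> nat \<Rightarrow> real" and \<theta>0 \<kappa>1 \<kappa>2 N lam +
  fixes \<Theta> :: "'a set" and \<delta> C :: real and \<theta>hat :: "nat \<Rightarrow> 'w \<Rightarrow> 'a" and lhat1 :: "'w \<Rightarrow> real"
  assumes f_nonneg_Theta: "\<And>\<theta> l y. \<theta> \<in> \<Theta> \<Longrightarrow> 0 \<le> l \<Longrightarrow> 0 \<le> f \<theta> l y"
    and f_meas: "\<And>y. (\<lambda>(\<theta>, l). f \<theta> l y) \<in> borel_measurable (restrict_space borel (\<Theta> \<times> {0..}))"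
    and delta: "0 < \<delta>"
    and lip: "\<And>\<theta> l y. \<theta> \<in> \<Theta> \<Longrightarrow> norm (\<theta> - \<theta>0) \<le> \<delta> \<Longrightarrow> 0 \<le> l \<Longrightarrow>
        \<bar>f \<theta> l y - f \<theta>0 l y\<bar> \<le> C * norm (\<theta> - \<theta>0) * (l + real y + 1)"
    and contr_Theta: "\<And>\<theta> l l' y. \<theta> \<in> \<Theta> \<Longrightarrow> norm (\<theta> - \<theta>0) \<le> \<delta> \<Longrightarrow> 0 \<le> l \<Longrightarrow> 0 \<le> l' \<Longrightarrow>
        \<bar>f \<theta> l y - f \<theta> l' y\<bar> \<le> \<kappa>1 * \<bar>l - l'\<bar>"
    and \<theta>hat_meas [measurable]: "\<And>n. \<theta>hat n \<in> borel_measurable M"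
    and \<theta>hat_in: "\<And>n w. w \<in> space M \<Longrightarrow> \<theta>hat n w \<in> \<Theta>"
    and \<theta>hat_rate: "bounded_in_prob M (\<lambda>n w. sqrt (real n) * norm (\<theta>hat n w - \<theta>0))"
    and lhat1_meas [measurable]: "lhat1 \<in> borel_measurable M"
    and lhat1_nonneg: "\<And>w. w \<in> space M \<Longrightarrow> 0 \<le> lhat1 w"
begin

section \<open>The error of the plug-in intensity\<close>

definition lh :: "nat \<Rightarrow> nat \<Rightarrow> 'w \<Rightarrow> real" where
  "lh n t w = lhat f (\<theta>hat n w) (lhat1 w) (\<lambda>t. N t w) t"

definition d :: "nat \<Rightarrow> nat \<Rightarrow> 'w \<Rightarrow> real" where
  "d n t w = lh n t w - lam (int t) w"

lemma lh_nonneg: "w \<in> space M \<Longrightarrow> 0 \<le> lh n t w"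
  unfolding lh_def by (rule lhat_nonneg) (auto intro: f_nonneg_Theta \<theta>hat_in lhat1_nonneg)

text \<open>Joint measurability in parameter and intensity is assumed for each fixed count; as
  counts are countably many, the composition is measurable.\<close>

lemma lh_measurable [measurable]: "lh n t \<in> borel_measurable M"
proof (induction t)
  case 0
  show ?case by (simp add: lh_def[abs_def])
next
  case (Suc t)
  show ?case
  proof (cases "t = 0")
    case True
    then show ?thesis by (simp add: lh_def[abs_def])
  next
    case False
    have eq: "lh n (Suc t) = (\<lambda>w. f (\<theta>hat n w) (lh n t w) (N (int t) w))"
      using lhat_Suc[of t f] False by (simp add: lh_def fun_eq_iff)
    have pair: "(\<lambda>w. (\<theta>hat n w, lh n t w)) \<in> measurable M (restrict_space borel (\<Theta> \<times> {0..}))"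
      using Suc.IH by (intro measurable_restrict_space2) (auto simp: \<theta>hat_in lh_nonneg)
    have "(\<lambda>w. f (\<theta>hat n w) (lh n t w) y) \<in> borel_measurable M" for y
      using measurable_compose[OF pair f_meas[of y]] by simp
    then show ?thesis unfolding eq by (rule measurable_compose_countable[OF _ N_measurable])
  qed
qed

text \<open>The event behind all pathwise estimates: it puts the estimator into the
  \<open>\<delta>\<close>-ball at distance at most \<open>K / sqrt n\<close> and bounds the initial
  error by \<open>K\<close>.\<close>

definition good :: "real \<Rightarrow> nat \<Rightarrow> 'w \<Rightarrow> bool" where
  "good K n w \<longleftrightarrow> w \<in> space M \<and> 0 \<le> K \<and> 0 < n \<and> K / sqrt (real n) \<le> \<delta> \<and>
     sqrt (real n) * norm (\<theta>hat n w - \<theta>0) \<le> K \<and> lhat1 w + lam 1 w \<le> K"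

lemma mostly_good:
  assumes e: "0 < e"
  obtains K where "0 < K" "mostly M e (good K)"
proof -
  have e2: "e / 2 > 0" using e by simp
  from \<theta>hat_rate[unfolded bounded_in_prob_def, rule_format, OF e2] obtain K1 n0 where
    K1: "\<And>n. n \<ge> n0 \<Longrightarrow> prob {w \<in> space M. \<bar>sqrt (real n) * norm (\<theta>hat n w - \<theta>0)\<bar> > K1} < e / 2" by blast
  obtain K2 where K2: "0 < K2" "prob {w \<in> space M. K2 < lhat1 w + lam 1 w} < e / 2"
    by (rule prob_tail_less[of "\<lambda>w. lhat1 w + lam 1 w" "e / 2"]) (use e in auto)
  define K where "K = max K1 K2"
  have K: "0 < K" "K1 \<le> K" "K2 \<le> K" using K2 by (auto simp: K_def)
  have "mostly M (e / 2) (\<lambda>n w. sqrt (real n) * norm (\<theta>hat n w - \<theta>0) \<le> K1)"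
    unfolding mostly_def
  proof (rule eventually_mono[OF eventually_ge_at_top[of n0]])
    fix n assume "n0 \<le> n"
    from K1[OF this] show "\<exists>B\<in>events. prob B < e / 2 \<and> (\<forall>w\<in>space M - B. sqrt (real n) * norm (\<theta>hat n w - \<theta>0) \<le> K1)"
      by (intro bexI[of _ "{w \<in> space M. \<bar>sqrt (real n) * norm (\<theta>hat n w - \<theta>0)\<bar> > K1}"]) auto
  qed
  moreover have "mostly M (e / 2) (\<lambda>n w. lhat1 w + lam 1 w \<le> K2)"
    unfolding mostly_def using K2(2)
    by (intro always_eventually allI bexI[of _ "{w \<in> space M. K2 < lhat1 w + lam 1 w}"]) auto
  ultimately have both: "mostly M e (\<lambda>n w. sqrt (real n) * norm (\<theta>hat n w - \<theta>0) \<le> K1 \<and> lhat1 w + lam 1 w \<le> K2)"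
    by (rule mostly_conj)
  have "((\<lambda>n. K / sqrt (real n)) \<longlongrightarrow> 0) sequentially" by real_asymp
  then have "\<forall>\<^sub>F n in sequentially. K / sqrt (real n) < \<delta>" using delta by (rule order_tendstoD)
  then have "\<forall>\<^sub>F n in sequentially. \<forall>w\<in>space M.
      sqrt (real n) * norm (\<theta>hat n w - \<theta>0) \<le> K1 \<and> lhat1 w + lam 1 w \<le> K2 \<longrightarrow> good K n w"
    using eventually_gt_at_top[of 0] by eventually_elim (use K in \<open>auto simp: good_def\<close>)
  with both have "mostly M e (good K)" by (rule mostly_mono[OF _ order_refl])
  with K(1) show thesis by (rule that)
qed

lemma good_norm:
  assumes "good K n w"
  shows "norm (\<theta>hat n w - \<theta>0) \<le> K / sqrt (real n)" "norm (\<theta>hat n w - \<theta>0) \<le> \<delta>"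
proof -
  show "norm (\<theta>hat n w - \<theta>0) \<le> K / sqrt (real n)"
    using assms by (simp add: good_def field_simps)
  then show "norm (\<theta>hat n w - \<theta>0) \<le> \<delta>" using assms by (simp add: good_def)
qed

lemma good_lip:
  assumes g: "good K n w" and l: "0 \<le> l"
  shows "\<bar>f (\<theta>hat n w) l y - f \<theta>0 l y\<bar> \<le> (\<bar>C\<bar> * K / sqrt (real n)) * (l + real y + 1)"
proof -
  have w: "w \<in> space M" using g by (simp add: good_def)
  have "\<bar>f (\<theta>hat n w) l y - f \<theta>0 l y\<bar> \<le> C * norm (\<theta>hat n w - \<theta>0) * (l + real y + 1)"
    by (rule lip[OF \<theta>hat_in[OF w] good_norm(2)[OF g] l])
  also have "\<dots> \<le> \<bar>C\<bar> * (K / sqrt (real n)) * (l + real y + 1)"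
    using good_norm(1)[OF g] l by (intro mult_right_mono mult_mono) auto
  finally show ?thesis by simp
qed

text \<open>Compare through \<open>f (\<theta>hat n w)\<close> at the true intensity: the old error
  is contracted by \<open>\<kappa>1\<close>, the change of parameter adds a multiple of
  \<open>Y\<close>. The initial error decays geometrically, the rest accumulates in
  \<open>W\<close>.\<close>

lemma d_bound:
  assumes g: "good K n w"
  shows "\<bar>d n (Suc t) w\<bar> \<le> \<kappa>1 ^ t * K + (\<bar>C\<bar> * K / sqrt (real n)) * W (Suc t) w"
proof (induction t)
  case 0
  have w: "w \<in> space M" and K: "0 \<le> K" and n: "0 < n" using g by (auto simp: good_def)
  have "\<bar>d n 1 w\<bar> \<le> lhat1 w + lam 1 w"
    using lhat1_nonneg[OF w] lam_nonneg[OF w, of 1] by (simp add: d_def lh_def)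
  also have "\<dots> \<le> K" using g by (simp add: good_def)
  moreover have "0 \<le> (\<bar>C\<bar> * K / sqrt (real n)) * W 1 w"
    using K W_nonneg[OF w, of 1] by (intro mult_nonneg_nonneg divide_nonneg_nonneg) auto
  ultimately show ?case by (simp del: W.simps)
next
  case (Suc t)
  have w: "w \<in> space M" using g by (auto simp: good_def)
  let ?c = "\<bar>C\<bar> * K / sqrt (real n)"
  let ?s = "int (Suc t)"
  have l: "0 \<le> lam ?s w" "0 \<le> lh n (Suc t) w" using lam_nonneg[OF w] lh_nonneg[OF w] by auto
  have 1: "lh n (Suc (Suc t)) w = f (\<theta>hat n w) (lh n (Suc t) w) (N ?s w)"
    using lhat_Suc[of "Suc t" f] by (simp add: lh_def)
  have 2: "lam (int (Suc (Suc t))) w = f \<theta>0 (lam ?s w) (N ?s w)"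
    using recursion[OF w, of "int (Suc (Suc t))"] by simp
  have "\<bar>d n (Suc (Suc t)) w\<bar> \<le> \<bar>f (\<theta>hat n w) (lh n (Suc t) w) (N ?s w) - f (\<theta>hat n w) (lam ?s w) (N ?s w)\<bar>
      + \<bar>f (\<theta>hat n w) (lam ?s w) (N ?s w) - f \<theta>0 (lam ?s w) (N ?s w)\<bar>"
    unfolding d_def 1 2 by linarith
  also have "\<dots> \<le> \<kappa>1 * \<bar>d n (Suc t) w\<bar> + ?c * Y ?s w"
    unfolding d_def Y_def
    by (intro add_mono contr_Theta[OF \<theta>hat_in[OF w] good_norm(2)[OF g] l(2,1)] good_lip[OF g l(1)])
  also have "\<dots> \<le> \<kappa>1 * (\<kappa>1 ^ t * K + ?c * W (Suc t) w) + ?c * Y ?s w"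
    using Suc.IH kappa1 by (intro add_right_mono mult_left_mono)
  also have "\<dots> = \<kappa>1 ^ Suc t * K + ?c * (\<kappa>1 * W (Suc t) w + Y ?s w)" by (simp add: algebra_simps del: W.simps)
  finally show ?case by (simp only: W.simps(2)[of "Suc t"])
qed

text \<open>The squared transients form a convergent geometric series; the parametric part
  contributes \<open>n\<close> terms of order \<open>1 / n\<close> with bounded second
  moments.\<close>

lemma d_square_tight: "tight_in_prob M (\<lambda>n w. \<Sum>t<n. (d n (Suc t) w)\<^sup>2)"
proof (rule tight_in_probI)
  fix e :: real assume "0 < e"
  then obtain K where K: "0 < K" "mostly M e (good K)"
    by (rule mostly_good)
  define A where "A = 2 * K\<^sup>2 / (1 - \<kappa>1) + 2 * (C * K)\<^sup>2 * (mu 2 / (1 - \<kappa>1)\<^sup>2)"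
  define Q where "Q n w = 2 * K\<^sup>2 / (1 - \<kappa>1) + 2 * (C * K)\<^sup>2 * ((\<Sum>t<n. (W (Suc t) w)\<^sup>2) / real n)" for n w
  have "\<forall>\<^sub>F n in sequentially. integrable M (Q n) \<and> (\<forall>w\<in>space M. 0 \<le> Q n w) \<and> expectation (Q n) \<le> A"
    using eventually_gt_at_top[of 0]
  proof (eventually_elim, intro conjI ballI)
    fix n :: nat assume n: "0 < n"
    have W2: "integrable M (\<lambda>w. (W t w)\<^sup>2)" "expectation (\<lambda>w. (W t w)\<^sup>2) \<le> mu 2 / (1 - \<kappa>1)\<^sup>2" for t
      using W_power[of 2 t] by auto
    show "integrable M (Q n)" unfolding Q_def using W2 by (simp del: W.simps)
    show "0 \<le> Q n w" if "w \<in> space M" for w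
      unfolding Q_def using kappa1 by (intro add_nonneg_nonneg mult_nonneg_nonneg divide_nonneg_nonneg sum_nonneg) auto
    have "expectation (Q n) = 2 * K\<^sup>2 / (1 - \<kappa>1) + 2 * (C * K)\<^sup>2 * ((\<Sum>t<n. expectation (\<lambda>w. (W (Suc t) w)\<^sup>2)) / real n)"
      unfolding Q_def using W2 by (simp add: prob_space del: W.simps)
    also have "\<dots> \<le> 2 * K\<^sup>2 / (1 - \<kappa>1) + 2 * (C * K)\<^sup>2 * ((\<Sum>t<n. mu 2 / (1 - \<kappa>1)\<^sup>2) / real n)"
      using W2 by (intro add_left_mono mult_left_mono divide_right_mono sum_mono) (auto simp del: W.simps)
    also have "\<dots> = A" using n by (simp add: A_def)
    finally show "expectation (Q n) \<le> A" .
  qed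
  moreover have "mostly M e (\<lambda>n w. \<bar>\<Sum>t<n. (d n (Suc t) w)\<^sup>2\<bar> \<le> Q n w)"
  proof (rule mostly_imp[OF K(2)])
    fix n w assume g: "good K n w"
    then have n: "0 < n" by (simp add: good_def)
    let ?c = "\<bar>C\<bar> * K / sqrt (real n)"
    have "(d n (Suc t) w)\<^sup>2 \<le> 2 * K\<^sup>2 * \<kappa>1 ^ t + 2 * ?c\<^sup>2 * (W (Suc t) w)\<^sup>2" for t
    proof -
      have "(d n (Suc t) w)\<^sup>2 = \<bar>d n (Suc t) w\<bar>\<^sup>2" by simp
      also have "\<dots> \<le> (\<kappa>1 ^ t * K + ?c * W (Suc t) w)\<^sup>2" by (rule power_mono[OF d_bound[OF g]]) simp
      also have "\<dots> \<le> 2 * (\<kappa>1 ^ t * K)\<^sup>2 + 2 * (?c * W (Suc t) w)\<^sup>2"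
        using sum_squares_bound[of "\<kappa>1 ^ t * K" "?c * W (Suc t) w"] by (simp add: power2_sum del: W.simps)
      also have "(\<kappa>1 ^ t * K)\<^sup>2 \<le> K\<^sup>2 * \<kappa>1 ^ t"
      proof -
        have "\<kappa>1 ^ t * \<kappa>1 ^ t \<le> \<kappa>1 ^ t * 1" using kappa1 by (intro mult_left_mono power_le_one) auto
        then have "K\<^sup>2 * (\<kappa>1 ^ t * \<kappa>1 ^ t) \<le> K\<^sup>2 * \<kappa>1 ^ t" by (intro mult_left_mono) auto
        then show ?thesis by (simp add: power2_eq_square ac_simps)
      qed
      finally show ?thesis by (simp only: power_mult_distrib mult.assoc)
    qed
    then have "(\<Sum>t<n. (d n (Suc t) w)\<^sup>2) \<le> (\<Sum>t<n. 2 * K\<^sup>2 * \<kappa>1 ^ t + 2 * ?c\<^sup>2 * (W (Suc t) w)\<^sup>2)"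
      by (intro sum_mono)
    also have "\<dots> = 2 * K\<^sup>2 * (\<Sum>t<n. \<kappa>1 ^ t) + 2 * ?c\<^sup>2 * (\<Sum>t<n. (W (Suc t) w)\<^sup>2)"
      by (simp add: sum.distrib sum_distrib_left del: W.simps)
    also have "\<dots> \<le> 2 * K\<^sup>2 * (1 / (1 - \<kappa>1)) + 2 * ?c\<^sup>2 * (\<Sum>t<n. (W (Suc t) w)\<^sup>2)"
      by (intro add_right_mono mult_left_mono geometric_sum_le kappa1) auto
    also have "\<dots> = Q n w" using n by (simp add: Q_def power_mult_distrib power_divide del: W.simps)
    finally show "\<bar>\<Sum>t<n. (d n (Suc t) w)\<^sup>2\<bar> \<le> Q n w" by (simp add: sum_nonneg)
  qed
  ultimately show "\<exists>A Q. mostly M e (\<lambda>n w. \<bar>\<Sum>t<n. (d n (Suc t) w)\<^sup>2\<bar> \<le> Q n w) \<and>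
     (\<forall>\<^sub>F n in sequentially. integrable M (Q n) \<and> (\<forall>w\<in>space M. 0 \<le> Q n w) \<and> expectation (Q n) \<le> A)" by blast
qed


text \<open>Both recursions start from the lower grid point of the cell and use its counts, so their
  difference is due to the parameter alone. It depends on the whole sample through the
  estimator.\<close>

definition cell_error :: "nat \<Rightarrow> real \<Rightarrow> 'w \<Rightarrow> nat \<times> nat list \<Rightarrow> real" where
  "cell_error n \<gamma> w c =
     fold (\<lambda>y l. f (\<theta>hat n w) l y) (snd c) (\<gamma> * real (fst c)) - fold (\<lambda>y l. f \<theta>0 l y) (snd c) (\<gamma> * real (fst c))"

text \<open>The lower bound on \<open>L\<close> makes \<open>[0, L]\<close> invariant under the true
  recursion: \<open>f \<theta>0 0 0 + (\<kappa>1 + \<kappa>2) * L \<le> L\<close>. The perturbation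
  estimate then holds for every cell at once.\<close>

lemma abs_cell_error_le:
  assumes g: "good K n w" and \<gamma>: "0 < \<gamma>" and L: "f \<theta>0 0 0 / (1 - \<kappa>1 - \<kappa>2) \<le> real L" and c: "c \<in> cells m \<gamma> L"
  shows "\<bar>cell_error n \<gamma> w c\<bar> \<le> (\<bar>C\<bar> * K / sqrt (real n)) * (2 * real L + 1) / (1 - \<kappa>1)"
proof -
  have w: "w \<in> space M" and K: "0 \<le> K" using g by (auto simp: good_def)
  let ?c = "\<bar>C\<bar> * K / sqrt (real n)"
  have c0: "0 \<le> ?c" using K by simp
  have i: "fst c \<le> nat \<lfloor>real L / \<gamma>\<rfloor>" and ns: "set (snd c) \<subseteq> {..L}"
    using c by (auto simp: cells_def)
  have "real (fst c) \<le> real (nat \<lfloor>real L / \<gamma>\<rfloor>)" using i by simp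
  also have "\<dots> \<le> real L / \<gamma>" using \<gamma> by (simp add: of_nat_nat)
  finally have iL: "\<gamma> * real (fst c) \<le> real L" using \<gamma> by (simp add: field_simps)
  have f0: "0 \<le> f \<theta>0 l y \<and> f \<theta>0 l y \<le> real L" if "0 \<le> l" "l \<le> real L" "real y \<le> real L" for l y
  proof -
    have "f \<theta>0 l y \<le> f \<theta>0 0 0 + \<kappa>1 * l + \<kappa>2 * real y" by (rule f_growth[OF that(1)])
    also have "\<dots> \<le> f \<theta>0 0 0 + \<kappa>1 * real L + \<kappa>2 * real L"
      using that kappa by (intro add_mono mult_left_mono) auto
    also have "f \<theta>0 0 0 \<le> real L * (1 - \<kappa>1 - \<kappa>2)" using L kappa by (simp add: pos_divide_le_eq)
    also have "real L * (1 - \<kappa>1 - \<kappa>2) + \<kappa>1 * real L + \<kappa>2 * real L = real L" by (simp add: algebra_simps)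
    finally show ?thesis using f_nonneg[OF that(1)] by simp
  qed
  show ?thesis
    unfolding cell_error_def
  proof (rule fold_perturbation[where a=\<kappa>1 and L="real L"])
    show "0 \<le> f (\<theta>hat n w) l y" if "0 \<le> l" for l y using f_nonneg_Theta[OF \<theta>hat_in[OF w] that] .
    show "\<bar>f (\<theta>hat n w) l y - f (\<theta>hat n w) l' y\<bar> \<le> \<kappa>1 * \<bar>l - l'\<bar>" if "0 \<le> l" "0 \<le> l'" for l l' y
      by (rule contr_Theta[OF \<theta>hat_in[OF w] good_norm(2)[OF g] that])
    show "\<bar>f (\<theta>hat n w) l y - f \<theta>0 l y\<bar> \<le> ?c * (l + real y + 1)" if "0 \<le> l" for l y
      by (rule good_lip[OF g that])
    show "\<bar>\<gamma> * real (fst c) - \<gamma> * real (fst c)\<bar> \<le> ?c * (2 * real L + 1) / (1 - \<kappa>1)"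
    proof -
      have "0 \<le> ?c * (2 * real L + 1) / (1 - \<kappa>1)"
        using c0 kappa1 by (intro divide_nonneg_nonneg mult_nonneg_nonneg[OF c0]) auto
      then show ?thesis by simp
    qed
    show "\<forall>y\<in>set (snd c). real y \<le> real L" using ns by auto
  qed (use c0 kappa1 iL \<gamma> f0 in auto)
qed

text \<open>Starting the estimated recursion from the true intensity \<open>m\<close> steps back
  changes its endpoint by at most \<open>\<kappa>1 ^ m\<close> times the error there; rounding this
  start costs at most \<open>\<gamma>\<close> in either recursion.\<close>

lemma cell_approximation:
  assumes g: "good K n w" and \<gamma>: "0 < \<gamma>" and mt: "m \<le> t"
  shows "\<bar>d n (Suc t) w - cell_error n \<gamma> w (cell m \<gamma> t w)\<bar> \<le> \<kappa>1 ^ m * \<bar>d n (Suc t - m) w\<bar> + 2 * \<gamma>"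
proof -
  have w: "w \<in> space M" using g by (simp add: good_def)
  define s where "s = Suc t - m"
  have s: "1 \<le> s" "s + m = Suc t" using mt by (auto simp: s_def)
  define ns where "ns = recent m s w"
  have len: "length ns = m" by (simp add: ns_def recent_def)
  let ?F = "\<lambda>x. fold (\<lambda>y l. f (\<theta>hat n w) l y) ns x"
  let ?G = "\<lambda>x. fold (\<lambda>y l. f \<theta>0 l y) ns x"
  define x where "x = lam (int s) w"
  define i where "i = nat \<lfloor>x / \<gamma>\<rfloor>"
  have x: "0 \<le> x" using lam_nonneg[OF w] by (simp add: x_def)
  have xi: "0 \<le> \<gamma> * real i" "\<bar>x - \<gamma> * real i\<bar> \<le> \<gamma>"
  proof -
    have "0 \<le> x / \<gamma>" using x \<gamma> by simp
    then have i: "real i = of_int \<lfloor>x / \<gamma>\<rfloor>" by (simp add: i_def)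
    have "real i \<le> x / \<gamma>" "x / \<gamma> < real i + 1" unfolding i by linarith+
    then have "\<gamma> * real i \<le> x" "x < \<gamma> * real i + \<gamma>" using \<gamma> by (simp_all add: field_simps)
    then show "0 \<le> \<gamma> * real i" "\<bar>x - \<gamma> * real i\<bar> \<le> \<gamma>" using \<gamma> by auto
  qed
  have lh: "lh n (Suc t) w = ?F (lh n s w)"
    using lhat_fold[OF s(1), of f "\<theta>hat n w" "lhat1 w" "\<lambda>t. N t w" m] s(2)
    by (simp add: lh_def ns_def recent_def)
  have la: "lam (int (Suc t)) w = ?G x"
    using lam_fold[OF w, of s m] s(2) by (simp add: ns_def x_def)
  have ce: "cell_error n \<gamma> w (cell m \<gamma> t w) = ?F (\<gamma> * real i) - ?G (\<gamma> * real i)"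
    by (simp add: cell_error_def cell_def i_def x_def ns_def s_def)
  have c1: "\<bar>?F a - ?F b\<bar> \<le> \<kappa>1 ^ m * \<bar>a - b\<bar>" if "0 \<le> a" "0 \<le> b" for a b
    using fold_contraction[of "f (\<theta>hat n w)" \<kappa>1 a b ns] that kappa1 len
      f_nonneg_Theta[OF \<theta>hat_in[OF w]] contr_Theta[OF \<theta>hat_in[OF w] good_norm(2)[OF g]] by simp
  have c2: "\<bar>?G a - ?G b\<bar> \<le> \<kappa>1 ^ m * \<bar>a - b\<bar>" if "0 \<le> a" "0 \<le> b" for a b
    using fold_contraction[of "f \<theta>0" \<kappa>1 a b ns] that kappa1 len f_nonneg contraction[of _ _ y y for y] by simp
  have "\<kappa>1 ^ m * \<bar>x - \<gamma> * real i\<bar> \<le> 1 * \<gamma>"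
    using xi kappa1 \<gamma> by (intro mult_mono power_le_one) auto
  then have le1: "\<kappa>1 ^ m * \<bar>x - \<gamma> * real i\<bar> \<le> \<gamma>" by simp
  have b1: "\<bar>?F (lh n s w) - ?F x\<bar> \<le> \<kappa>1 ^ m * \<bar>lh n s w - x\<bar>" by (rule c1[OF lh_nonneg[OF w] x])
  have b2: "\<bar>?F x - ?F (\<gamma> * real i)\<bar> \<le> \<gamma>" by (rule order_trans[OF c1[OF x xi(1)] le1])
  have b3: "\<bar>?G x - ?G (\<gamma> * real i)\<bar> \<le> \<gamma>" by (rule order_trans[OF c2[OF x xi(1)] le1])
  have triangle: "\<bar>a - b - (c - e)\<bar> \<le> r + 2 * \<gamma>" if "\<bar>a - q\<bar> \<le> r" "\<bar>q - c\<bar> \<le> \<gamma>" "\<bar>b - e\<bar> \<le> \<gamma>" for a b c e q r :: real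
    using that by linarith
  have dx: "d n (Suc t - m) w = lh n s w - x" by (simp add: d_def x_def s_def)
  show ?thesis
    unfolding dx d_def[of n "Suc t"] lh la ce by (rule triangle[OF b1 b2 b3])
qed

text \<open>Transient and rounding errors; then the parametric error from \<open>m\<close> steps
  back, damped by \<open>\<kappa>1 ^ m\<close>; then the full parametric error where no cell is
  available, at early times or outside the truncation, the latter indicated by a sum of
  \<open>Y\<close> over \<open>L\<close>.\<close>

definition remainder :: "real \<Rightarrow> nat \<Rightarrow> real \<Rightarrow> nat \<Rightarrow> nat \<Rightarrow> nat \<Rightarrow> 'w \<Rightarrow> real" where
  "remainder K m \<gamma> L n t w = (\<kappa>1 ^ t * K + 2 * \<gamma>) * \<bar>eps (int (Suc t)) w\<bar>
     + \<kappa>1 ^ m * (\<bar>C\<bar> * K / sqrt (real n)) * (\<bar>eps (int (Suc t)) w\<bar> * W (Suc t - m) w)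
     + (\<bar>C\<bar> * K / sqrt (real n)) * (of_bool (t < m) * (\<bar>eps (int (Suc t)) w\<bar> * W (Suc t) w)
         + (\<Sum>j<m. \<bar>eps (int (Suc t)) w\<bar> * W (Suc t) w * Y (int (Suc t - m + j)) w) / real L)"

text \<open>Leaving the truncated cells forces some \<open>Y\<close> in the window above
  \<open>L\<close>. The linear bound replaces the indicator by something whose product moments are
  known.\<close>

lemma outside_cells:
  assumes w: "w \<in> space M" and \<gamma>: "0 < \<gamma>" and m: "0 < m" and mt: "m \<le> t" and L: "0 < L" and out: "cell m \<gamma> t w \<notin> cells m \<gamma> L"
  shows "1 \<le> (\<Sum>j<m. Y (int (Suc t - m + j)) w) / real L"
proof -
  define s where "s = Suc t - m"
  have Y0: "0 \<le> Y r w" for r by (rule Y_ge(5)[OF w])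
  have "\<exists>j<m. real L < Y (int (s + j)) w"
  proof (rule ccontr)
    assume "\<not> ?thesis"
    then have all: "Y (int (s + j)) w \<le> real L" if "j < m" for j using that by force
    have "lam (int s) w \<le> real L" using all[of 0] m Y_ge(2)[OF w, of "int s"] by simp
    then have "lam (int s) w / \<gamma> \<le> real L / \<gamma>" using \<gamma> by (intro divide_right_mono) auto
    then have "nat \<lfloor>lam (int s) w / \<gamma>\<rfloor> \<le> nat \<lfloor>real L / \<gamma>\<rfloor>" by (intro nat_mono floor_mono)
    moreover have "N (int (s + j)) w \<le> L" if "j < m" for j
      using all[OF that] Y_ge(3)[OF w, of "int (s + j)"] by simp
    ultimately have "cell m \<gamma> t w \<in> cells m \<gamma> L"
      by (auto simp: cell_def cells_def recent_def s_def)
    with out show False by simp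
  qed
  then obtain j where j: "j < m" "real L < Y (int (s + j)) w" by blast
  have "Y (int (s + j)) w \<le> (\<Sum>j<m. Y (int (s + j)) w)"
    using j Y0 by (intro member_le_sum) auto
  with j L show ?thesis by (simp add: s_def)
qed

text \<open>At early times and outside the cells the subtracted term is 0 and \<open>d_bound\<close>
  is used directly; on a cell, \<open>cell_approximation\<close> is combined with
  \<open>d_bound\<close> at the start of the window.\<close>

lemma cross_step:
  assumes g: "good K n w" and \<gamma>: "0 < \<gamma>" and m: "0 < m" and L: "0 < L"
  shows "\<bar>eps (int (Suc t)) w * d n (Suc t) w -
      of_bool (m \<le> t \<and> cell m \<gamma> t w \<in> cells m \<gamma> L) * (eps (int (Suc t)) w * cell_error n \<gamma> w (cell m \<gamma> t w))\<bar>
     \<le> remainder K m \<gamma> L n t w"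
proof -
  have w: "w \<in> space M" and K: "0 \<le> K" using g by (auto simp: good_def)
  define c where "c = \<bar>C\<bar> * K / sqrt (real n)"
  define a where "a = \<bar>eps (int (Suc t)) w\<bar>"
  define S where "S = (\<Sum>j<m. Y (int (Suc t - m + j)) w) / real L"
  have c: "0 \<le> c" using K by (simp add: c_def)
  have a: "0 \<le> a" by (simp add: a_def)
  have Wn: "0 \<le> W r w" for r by (rule W_nonneg[OF w])
  have S: "0 \<le> S" unfolding S_def using Y_ge(5)[OF w] by (intro divide_nonneg_nonneg sum_nonneg) auto
  have kt: "0 \<le> \<kappa>1 ^ r" for r using kappa1 by simp
  have R: "remainder K m \<gamma> L n t w = a * (\<kappa>1 ^ t * K + 2 * \<gamma> + \<kappa>1 ^ m * c * W (Suc t - m) w + c * W (Suc t) w * (of_bool (t < m) + S))"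
    unfolding remainder_def S_def a_def[symmetric] c_def[symmetric] sum_distrib_left[symmetric]
    by (simp add: algebra_simps)
  have dt: "\<bar>d n (Suc t) w\<bar> \<le> \<kappa>1 ^ t * K + c * W (Suc t) w"
    unfolding c_def by (rule d_bound[OF g])
  consider "t < m" | "m \<le> t" "cell m \<gamma> t w \<in> cells m \<gamma> L" | "m \<le> t" "cell m \<gamma> t w \<notin> cells m \<gamma> L" by linarith
  then show ?thesis
  proof cases
    case 1
    have "\<bar>d n (Suc t) w\<bar> \<le> \<kappa>1 ^ t * K + 2 * \<gamma> + \<kappa>1 ^ m * c * W (Suc t - m) w + c * W (Suc t) w * (1 + S)"
    proof -
      have "0 \<le> \<kappa>1 ^ m * c * W (Suc t - m) w" using kt c Wn by (intro mult_nonneg_nonneg)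
      moreover have "0 \<le> c * W (Suc t) w * S" using c Wn S by (intro mult_nonneg_nonneg)
      ultimately show ?thesis using dt \<gamma> unfolding distrib_left mult_1_right by linarith
    qed
    with a have "a * \<bar>d n (Suc t) w\<bar> \<le> a * (\<kappa>1 ^ t * K + 2 * \<gamma> + \<kappa>1 ^ m * c * W (Suc t - m) w + c * W (Suc t) w * (1 + S))"
      by (intro mult_left_mono)
    with 1 show ?thesis unfolding R by (simp add: a_def abs_mult del: W.simps)
  next
    case 2
    define s where "s = Suc t - m"
    have s: "s = Suc (t - m)" using 2 by (simp add: s_def)
    have "\<bar>d n s w\<bar> \<le> \<kappa>1 ^ (t - m) * K + c * W s w"
      unfolding s c_def by (rule d_bound[OF g])
    then have "\<kappa>1 ^ m * \<bar>d n s w\<bar> \<le> \<kappa>1 ^ m * (\<kappa>1 ^ (t - m) * K + c * W s w)" by (intro mult_left_mono kt)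
    also have "\<dots> = \<kappa>1 ^ t * K + \<kappa>1 ^ m * c * W s w"
      using 2 by (simp add: algebra_simps flip: power_add)
    finally have "\<bar>d n (Suc t) w - cell_error n \<gamma> w (cell m \<gamma> t w)\<bar> \<le> \<kappa>1 ^ t * K + \<kappa>1 ^ m * c * W s w + 2 * \<gamma>"
      using cell_approximation[OF g \<gamma> 2(1)] by (simp add: s_def)
    moreover have "0 \<le> c * W (Suc t) w * (of_bool (t < m) + S)" using c Wn S by (intro mult_nonneg_nonneg add_nonneg_nonneg) (auto simp del: W.simps)
    ultimately have "\<bar>d n (Suc t) w - cell_error n \<gamma> w (cell m \<gamma> t w)\<bar> \<le>
       \<kappa>1 ^ t * K + 2 * \<gamma> + \<kappa>1 ^ m * c * W (Suc t - m) w + c * W (Suc t) w * (of_bool (t < m) + S)"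
      by (simp add: s_def del: W.simps)
    then have "a * \<bar>d n (Suc t) w - cell_error n \<gamma> w (cell m \<gamma> t w)\<bar> \<le> remainder K m \<gamma> L n t w"
      unfolding R by (intro mult_left_mono a)
    with 2 show ?thesis by (simp add: a_def algebra_simps flip: abs_mult)
  next
    case 3
    have "1 \<le> S" unfolding S_def by (rule outside_cells[OF w \<gamma> m 3(1) L 3(2)])
    have "\<bar>d n (Suc t) w\<bar> \<le> \<kappa>1 ^ t * K + 2 * \<gamma> + \<kappa>1 ^ m * c * W (Suc t - m) w + c * W (Suc t) w * S"
    proof -
      have "0 \<le> \<kappa>1 ^ m * c * W (Suc t - m) w" using kt c Wn by (intro mult_nonneg_nonneg)
      moreover have "c * W (Suc t) w * 1 \<le> c * W (Suc t) w * S"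
        using c Wn \<open>1 \<le> S\<close> by (intro mult_left_mono mult_nonneg_nonneg)
      ultimately show ?thesis using dt \<gamma> by linarith
    qed
    with a have "a * \<bar>d n (Suc t) w\<bar> \<le> a * (\<kappa>1 ^ t * K + 2 * \<gamma> + \<kappa>1 ^ m * c * W (Suc t - m) w + c * W (Suc t) w * S)"
      by (intro mult_left_mono)
    with 3 show ?thesis unfolding R by (simp add: a_def abs_mult del: W.simps)
  qed
qed

text \<open>Exchanging the sums over time and cells pulls the anticipating factor
  \<open>cell_error\<close> out of the time sum. A bound uniform in the cells then suffices, and
  what remains are genuine martingales.\<close>

lemma cross_bound:
  assumes g: "good K n w" and \<gamma>: "0 < \<gamma>" and m: "0 < m" and L: "0 < L" "f \<theta>0 0 0 / (1 - \<kappa>1 - \<kappa>2) \<le> real L"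
  shows "\<bar>\<Sum>t<n. eps (int (Suc t)) w * d n (Suc t) w\<bar> \<le>
     (\<Sum>t<n. remainder K m \<gamma> L n t w)
     + (\<bar>C\<bar> * K / sqrt (real n)) * (2 * real L + 1) / (1 - \<kappa>1) * (\<Sum>c\<in>cells m \<gamma> L. \<bar>cell_sum m \<gamma> n c w\<bar>)"
proof -
  let ?C = "cells m \<gamma> L"
  let ?G = "cell_error n \<gamma> w"
  let ?b = "(\<bar>C\<bar> * K / sqrt (real n)) * (2 * real L + 1) / (1 - \<kappa>1)"
  define h where "h t = of_bool (m \<le> t \<and> cell m \<gamma> t w \<in> ?C) * (eps (int (Suc t)) w * ?G (cell m \<gamma> t w))" for t
  have h: "h t = (\<Sum>c\<in>?C. ?G c * (eps (int (Suc t)) w * of_bool (m \<le> t \<and> cell m \<gamma> t w = c)))" for t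
  proof -
    have "(\<Sum>c\<in>?C. ?G c * (eps (int (Suc t)) w * of_bool (m \<le> t \<and> cell m \<gamma> t w = c))) =
        (\<Sum>c\<in>?C. if c = cell m \<gamma> t w then ?G c * (eps (int (Suc t)) w * of_bool (m \<le> t)) else 0)"
      by (intro sum.cong) auto
    also have "\<dots> = h t" using finite_cells[of m \<gamma> L] by (simp add: sum.delta h_def)
    finally show ?thesis by simp
  qed
  have "(\<Sum>t<n. h t) = (\<Sum>c\<in>?C. ?G c * cell_sum m \<gamma> n c w)"
    unfolding h cell_sum_def sum_distrib_left by (rule sum.swap)
  also have "\<bar>\<dots>\<bar> \<le> (\<Sum>c\<in>?C. ?b * \<bar>cell_sum m \<gamma> n c w\<bar>)"
    by (rule order_trans[OF sum_abs sum_mono]) (simp only: abs_mult mult_right_mono[OF abs_cell_error_le[OF g \<gamma> L(2)] abs_ge_zero])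
  also have "\<dots> = ?b * (\<Sum>c\<in>?C. \<bar>cell_sum m \<gamma> n c w\<bar>)" by (rule sum_distrib_left[symmetric])
  finally have H: "\<bar>\<Sum>t<n. h t\<bar> \<le> ?b * (\<Sum>c\<in>?C. \<bar>cell_sum m \<gamma> n c w\<bar>)" .
  have "\<bar>\<Sum>t<n. eps (int (Suc t)) w * d n (Suc t) w - h t\<bar> \<le> (\<Sum>t<n. remainder K m \<gamma> L n t w)"
    unfolding h_def by (rule order_trans[OF sum_abs sum_mono[OF cross_step[OF g \<gamma> m L(1)]]])
  with H show ?thesis unfolding sum_subtractf by linarith
qed

lemma remainder_L1:
  assumes K: "0 \<le> K" and \<gamma>: "0 < \<gamma>" and L: "0 < L"
  shows "integrable M (remainder K m \<gamma> L n t)"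
    "expectation (remainder K m \<gamma> L n t) \<le> (\<kappa>1 ^ t * K + 2 * \<gamma>) * mu 1
      + (\<bar>C\<bar> * K / sqrt (real n)) * nu * (\<kappa>1 ^ m + of_bool (t < m) + real m / real L)"
    "w \<in> space M \<Longrightarrow> 0 \<le> remainder K m \<gamma> L n t w"
proof -
  define c where "c = \<bar>C\<bar> * K / sqrt (real n)"
  have c: "0 \<le> c" using K by (simp add: c_def)
  note i = eps_moments(1)[of "int (Suc t)"] double_product(1)[of "int (Suc t)" "Suc t - m"]
    double_product(1)[of "int (Suc t)" "Suc t"] triple_product(1)[of "int (Suc t)" "Suc t"]
  show "integrable M (remainder K m \<gamma> L n t)"
    unfolding remainder_def[abs_def] c_def[symmetric] using i by (simp del: W.simps of_nat_Suc of_nat_add)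
  have "expectation (remainder K m \<gamma> L n t) = (\<kappa>1 ^ t * K + 2 * \<gamma>) * expectation (\<lambda>w. \<bar>eps (int (Suc t)) w\<bar>)
     + \<kappa>1 ^ m * c * expectation (\<lambda>w. \<bar>eps (int (Suc t)) w\<bar> * W (Suc t - m) w)
     + c * (of_bool (t < m) * expectation (\<lambda>w. \<bar>eps (int (Suc t)) w\<bar> * W (Suc t) w)
         + (\<Sum>j<m. expectation (\<lambda>w. \<bar>eps (int (Suc t)) w\<bar> * W (Suc t) w * Y (int (Suc t - m + j)) w)) / real L)"
    unfolding remainder_def[abs_def] c_def[symmetric] using i by (simp del: W.simps of_nat_Suc of_nat_add)
  also have "\<dots> \<le> (\<kappa>1 ^ t * K + 2 * \<gamma>) * mu 1 + \<kappa>1 ^ m * c * nu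
     + c * (of_bool (t < m) * nu + (\<Sum>j<m. nu) / real L)"
    using K \<gamma> c kappa1
    by (intro add_mono mult_left_mono divide_right_mono sum_mono eps_moments double_product triple_product
        mult_nonneg_nonneg) auto
  also have "\<dots> = (\<kappa>1 ^ t * K + 2 * \<gamma>) * mu 1 + c * nu * (\<kappa>1 ^ m + of_bool (t < m) + real m / real L)"
    by (simp add: distrib_left ac_simps)
  finally show "expectation (remainder K m \<gamma> L n t) \<le> (\<kappa>1 ^ t * K + 2 * \<gamma>) * mu 1
      + (\<bar>C\<bar> * K / sqrt (real n)) * nu * (\<kappa>1 ^ m + of_bool (t < m) + real m / real L)"
    by (simp only: c_def)
  show "0 \<le> remainder K m \<gamma> L n t w" if w: "w \<in> space M"
    unfolding remainder_def c_def[symmetric]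
    using K \<gamma> c kappa1 W_nonneg[OF w] Y_ge(5)[OF w]
    by (intro add_nonneg_nonneg mult_nonneg_nonneg divide_nonneg_nonneg sum_nonneg) auto
qed

text \<open>Transients sum geometrically and vanish after division by \<open>sqrt n\<close>;
  rounding leaves \<open>\<gamma> * sqrt n\<close>, constant for the chosen mesh; early times leave
  \<open>m / n\<close>. The parts with \<open>\<kappa>1 ^ m\<close> and \<open>m / L\<close> do not
  vanish with \<open>n\<close> and must be made small by the choice of \<open>m\<close> and
  \<open>L\<close>.\<close>

lemma remainder_sum_L1:
  assumes K: "0 \<le> K" and \<gamma>: "0 < \<gamma>" and L: "0 < L" and n: "0 < n"
  shows "expectation (\<lambda>w. (\<Sum>t<n. remainder K m \<gamma> L n t w) / sqrt (real n)) \<le>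
     K * mu 1 / (1 - \<kappa>1) / sqrt (real n) + 2 * (\<gamma> * sqrt (real n)) * mu 1
     + \<bar>C\<bar> * K * nu * (\<kappa>1 ^ m + real m / real n + real m / real L)"
proof -
  define h where "h = sqrt (real n)"
  have h: "0 < h" "real n = h * h" using n by (auto simp: h_def)
  define c where "c = \<bar>C\<bar> * K"
  have c: "0 \<le> c" using K by (simp add: c_def)
  have "expectation (\<lambda>w. (\<Sum>t<n. remainder K m \<gamma> L n t w) / h) = (\<Sum>t<n. expectation (remainder K m \<gamma> L n t)) / h"
    using remainder_L1(1)[OF K \<gamma> L] by simp
  also have "\<dots> \<le> (\<Sum>t<n. (\<kappa>1 ^ t * K + 2 * \<gamma>) * mu 1 + (c / h) * nu * (\<kappa>1 ^ m + of_bool (t < m) + real m / real L)) / h"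
    unfolding c_def h_def using remainder_L1(2)[OF K \<gamma> L] n by (intro divide_right_mono sum_mono) auto
  also have "(\<Sum>t<n. (\<kappa>1 ^ t * K + 2 * \<gamma>) * mu 1 + (c / h) * nu * (\<kappa>1 ^ m + of_bool (t < m) + real m / real L)) =
     (K * (\<Sum>t<n. \<kappa>1 ^ t) + real n * (2 * \<gamma>)) * mu 1
     + (c / h) * nu * (real n * \<kappa>1 ^ m + (\<Sum>t<n. of_bool (t < m)) + real n * (real m / real L))"
    by (simp add: sum.distrib sum_distrib_left sum_distrib_right algebra_simps sum_divide_distrib del: sum_of_bool_eq)
  also have "\<dots> \<le> (K * (1 / (1 - \<kappa>1)) + real n * (2 * \<gamma>)) * mu 1
     + (c / h) * nu * (real n * \<kappa>1 ^ m + real m + real n * (real m / real L))"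
  proof -
    have "(\<Sum>t<n. of_bool (t < m) :: real) = real (card ({..<n} \<inter> {t. t < m}))"
      by (simp add: of_bool_def sum.If_cases)
    also have "card ({..<n} \<inter> {t. t < m}) \<le> card {..<m}" by (intro card_mono) auto
    finally have b: "(\<Sum>t<n. of_bool (t < m) :: real) \<le> real m" by simp
    show ?thesis
      using K c nu_nonneg mu_nonneg[of 1] h b geometric_sum_le[OF kappa1, of n]
      by (intro add_mono mult_right_mono mult_left_mono order_refl) auto
  qed
  finally have "expectation (\<lambda>w. (\<Sum>t<n. remainder K m \<gamma> L n t w) / h) \<le>
    ((K * (1 / (1 - \<kappa>1)) + real n * (2 * \<gamma>)) * mu 1
     + (c / h) * nu * (real n * \<kappa>1 ^ m + real m + real n * (real m / real L))) / h"
    using h by (simp add: divide_right_mono)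
  also have "\<dots> = K * mu 1 / (1 - \<kappa>1) / h + 2 * (\<gamma> * h) * mu 1 + c * nu * (\<kappa>1 ^ m + real m / real n + real m / real L)"
    unfolding h(2) using h(1) by (simp add: add_divide_distrib distrib_left distrib_right)
  finally show ?thesis by (simp add: h_def c_def)
qed

end

section \<open>The limit of the test statistic\<close>

context plug_in
begin

text \<open>The bound of \<open>cell_sum_L1\<close> for \<open>a = n\<^sup>-\<^sup>1\<^sup>/\<^sup>4\<close> and mesh \<open>\<eta> / \<surd>n\<close>, divided by \<open>n\<close>.\<close>

definition cell_rate :: "real \<Rightarrow> nat \<Rightarrow> nat \<Rightarrow> nat \<Rightarrow> real" where
  "cell_rate \<eta> m L n = (1 / sqrt (sqrt (real n)) * (real n * mu 2)
      + ((real L / (\<eta> / sqrt (real n)) + 1) * (real L + 1) ^ m) / (1 / sqrt (sqrt (real n)))) / real n"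

text \<open>For fixed \<open>m\<close>, \<open>L\<close> and \<open>\<eta>\<close> both summands are
  O(n^(-1/4)): the weight balances the second moments against O(sqrt n) cells.\<close>

lemma cell_rate_tendsto_0: "cell_rate \<eta> m L \<longlonglongrightarrow> 0"
proof -
  define b where "b = real L / \<eta>"
  let ?r = "\<lambda>n. mu 2 * (1 / sqrt (sqrt (real n))) + (real L + 1) ^ m * ((b * sqrt (real n) + 1) * sqrt (sqrt (real n)) / real n)"
  have "?r \<longlonglongrightarrow> mu 2 * 0 + (real L + 1) ^ m * 0"
    by (intro tendsto_add tendsto_mult tendsto_const; real_asymp)
  then have "?r \<longlonglongrightarrow> 0" by simp
  then show ?thesis
    by (rule Lim_transform_eventually, use eventually_gt_at_top[of 0] in eventually_elim)
       (simp add: cell_rate_def b_def add_divide_distrib)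
qed

text \<open>The tolerance is split into \<open>e / 6\<close> each for forgetting, truncation and
  rounding, and \<open>e / 2\<close> for everything that vanishes as \<open>n\<close> grows.\<close>

lemma cross_small:
  "small_in_prob M (\<lambda>n w. (\<Sum>t<n. eps (int (Suc t)) w * d n (Suc t) w) / sqrt (real n))"
proof (rule small_in_probI)
  fix e :: real assume e: "0 < e"
  then obtain K where K: "0 < K" "mostly M e (good K)"
    by (rule mostly_good)
  define A where "A = \<bar>C\<bar> * K * nu"
  have A: "0 \<le> A" using K nu_nonneg by (simp add: A_def)
  define q where "q = e / 6 / (A + 1)"
  have q: "0 < q" "q * (A + 1) = e / 6"
    using e A by (simp add: q_def, intro iffD1[OF nonzero_eq_divide_eq q_def]) simp
  obtain m0 where m0: "\<kappa>1 ^ m0 < q"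
    using real_arch_pow_inv[OF q(1) kappa1(2)] by blast
  \<comment> \<open>The successor ensures a nonempty window, as the estimate outside the cells
    requires.\<close>
  define m where "m = Suc m0"
  have km: "A * \<kappa>1 ^ m \<le> e / 6"
  proof -
    have "\<kappa>1 ^ m \<le> \<kappa>1 ^ m0" unfolding m_def using kappa1 by (intro power_decreasing) auto
    then have "\<kappa>1 ^ m * A \<le> q * (A + 1)" using m0 A kappa1 q by (intro mult_mono) auto
    then show ?thesis using q by (simp add: mult.commute)
  qed
  \<comment> \<open>\<open>L\<close> comes after \<open>m\<close>, since the chance that some term
    of a window is large grows with \<open>m\<close>; the first entry of the maximum is for
    invariance of \<open>[0, L]\<close>.\<close>
  obtain L :: nat where L: "max (f \<theta>0 0 0 / (1 - \<kappa>1 - \<kappa>2)) (max 1 (6 * A * real m / e)) \<le> real L"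
    using real_arch_simple by blast
  then have L1: "f \<theta>0 0 0 / (1 - \<kappa>1 - \<kappa>2) \<le> real L" "0 < L" "6 * A * real m / e \<le> real L" by auto
  have Lm: "A * (real m / real L) \<le> e / 6"
    using L1(2,3) e by (simp add: field_simps)
  \<comment> \<open>Rounding leaves \<open>2 * \<eta> * mu 1\<close> in the limit;
    \<open>mu 1 + 1\<close> avoids a separate argument for positivity of the denominator.\<close>
  define \<eta> where "\<eta> = e / 12 / (mu 1 + 1)"
  have eta: "0 < \<eta>" using e mu_nonneg[of 1] by (simp add: \<eta>_def)
  have eta1: "\<eta> * (mu 1 + 1) = e / 12"
    using mu_nonneg[of 1] by (intro iffD1[OF nonzero_eq_divide_eq \<eta>_def]) simp
  have em: "2 * \<eta> * mu 1 \<le> e / 6"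
  proof -
    have "\<eta> * mu 1 \<le> \<eta> * (mu 1 + 1)" using eta by simp
    then show ?thesis using eta1 by simp
  qed
  define G where "G = \<bar>C\<bar> * K * (2 * real L + 1) / (1 - \<kappa>1)"
  have G: "0 \<le> G" using K kappa1 by (simp add: G_def)
  define u where "u n = K * mu 1 / (1 - \<kappa>1) / sqrt (real n) + A * (real m / real n) + G * cell_rate \<eta> m L n" for n :: nat
  have "(u \<longlongrightarrow> 0 + A * 0 + G * 0) sequentially"
    unfolding u_def
  proof (intro tendsto_add tendsto_mult tendsto_const cell_rate_tendsto_0)
    define b where "b = K * mu 1 / (1 - \<kappa>1)"
    show "(\<lambda>n. K * mu 1 / (1 - \<kappa>1) / sqrt (real n)) \<longlonglongrightarrow> 0" unfolding b_def[symmetric] by real_asymp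
    show "(\<lambda>n. real m / real n) \<longlonglongrightarrow> 0" by real_asymp
  qed
  then have "(u \<longlongrightarrow> 0) sequentially" by simp
  then have u: "\<forall>\<^sub>F n in sequentially. u n < e / 2" using e by (intro order_tendstoD) auto
  define \<gamma> where "\<gamma> n = \<eta> / sqrt (real n)" for n :: nat
  have \<gamma>: "0 < \<gamma> n" if "0 < n" for n using eta that by (simp add: \<gamma>_def)
  have K0: "0 \<le> K" and m: "0 < m" using K by (auto simp: m_def)
  let ?S = "\<lambda>n w. \<Sum>c\<in>cells m (\<gamma> n) L. \<bar>cell_sum m (\<gamma> n) n c w\<bar>"
  let ?R = "\<lambda>n w. (\<Sum>t<n. remainder K m (\<gamma> n) L n t w) / sqrt (real n)"
  define Q where "Q n w = ?R n w + G * (?S n w / real n)" for n w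
  have "mostly M e (\<lambda>n w. \<bar>(\<Sum>t<n. eps (int (Suc t)) w * d n (Suc t) w) / sqrt (real n)\<bar> \<le> Q n w)"
  proof (rule mostly_imp[OF K(2)])
    fix n w assume g: "good K n w"
    then have n: "0 < n" by (simp add: good_def)
    have "\<bar>\<Sum>t<n. eps (int (Suc t)) w * d n (Suc t) w\<bar> / sqrt (real n) \<le>
      ((\<Sum>t<n. remainder K m (\<gamma> n) L n t w) + (\<bar>C\<bar> * K / sqrt (real n)) * (2 * real L + 1) / (1 - \<kappa>1) * ?S n w) / sqrt (real n)"
      by (intro divide_right_mono cross_bound[OF g \<gamma>[OF n] m L1(2,1)]) simp
    also have "\<dots> = ?R n w + G * (?S n w / (sqrt (real n) * sqrt (real n)))"
      by (simp add: add_divide_distrib G_def)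
    also have "\<dots> = Q n w" by (simp add: Q_def)
    finally show "\<bar>(\<Sum>t<n. eps (int (Suc t)) w * d n (Suc t) w) / sqrt (real n)\<bar> \<le> Q n w" by (simp add: abs_divide)
  qed
  moreover have "\<forall>\<^sub>F n in sequentially. integrable M (Q n) \<and> (\<forall>w\<in>space M. 0 \<le> Q n w) \<and> expectation (Q n) \<le> e"
    using u eventually_gt_at_top[of 0]
  proof (eventually_elim, intro conjI ballI)
    fix n :: nat assume n: "0 < n" and un: "u n < e / 2"
    note g = \<gamma>[OF n]
    have Ri: "integrable M (?R n)" using remainder_L1(1)[OF K0 g L1(2)] by simp
    have a: "0 < 1 / sqrt (sqrt (real n))" using n by simp
    have Si: "integrable M (\<lambda>w. ?S n w / real n)" using cell_sum_L1(1)[OF a] by simp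
    show "integrable M (Q n)" unfolding Q_def using Ri Si by (intro Bochner_Integration.integrable_add integrable_mult_right)
    show "0 \<le> Q n w" if w: "w \<in> space M" for w
      unfolding Q_def using remainder_L1(3)[OF K0 g L1(2) w] G
      by (intro add_nonneg_nonneg mult_nonneg_nonneg divide_nonneg_nonneg sum_nonneg) auto
    have "expectation (Q n) = expectation (?R n) + expectation (\<lambda>w. G * (?S n w / real n))"
      unfolding Q_def using Ri Si by (intro Bochner_Integration.integral_add integrable_mult_right)
    also have "expectation (\<lambda>w. G * (?S n w / real n)) = G * (expectation (?S n) / real n)"
      by (simp only: integral_mult_right_zero integral_divide_zero)
    also have "expectation (?R n) + G * (expectation (?S n) / real n) \<le>
       (K * mu 1 / (1 - \<kappa>1) / sqrt (real n) + 2 * (\<gamma> n * sqrt (real n)) * mu 1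
       + A * (\<kappa>1 ^ m + real m / real n + real m / real L)) + G * cell_rate \<eta> m L n"
      unfolding cell_rate_def \<gamma>_def[symmetric]
    proof (intro add_mono mult_left_mono divide_right_mono G)
      show "expectation (?R n) \<le> K * mu 1 / (1 - \<kappa>1) / sqrt (real n) + 2 * (\<gamma> n * sqrt (real n)) * mu 1
         + A * (\<kappa>1 ^ m + real m / real n + real m / real L)"
        unfolding A_def by (rule remainder_sum_L1[OF K0 g L1(2) n])
      have "expectation (?S n) \<le> 1 / sqrt (sqrt (real n)) * (real n * mu 2) + real (card (cells m (\<gamma> n) L)) / (1 / sqrt (sqrt (real n)))"
        by (rule cell_sum_L1(2)[OF a])
      also have "real (card (cells m (\<gamma> n) L)) / (1 / sqrt (sqrt (real n))) \<le> ((real L / \<gamma> n + 1) * (real L + 1) ^ m) / (1 / sqrt (sqrt (real n)))"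
        using card_cells[OF g] by (intro divide_right_mono) auto
      finally show "expectation (?S n) \<le> 1 / sqrt (sqrt (real n)) * (real n * mu 2) + ((real L / \<gamma> n + 1) * (real L + 1) ^ m) / (1 / sqrt (sqrt (real n)))"
        by simp
    qed simp
    also have "\<dots> = u n + 2 * \<eta> * mu 1 + A * \<kappa>1 ^ m + A * (real m / real L)"
    proof -
      have "\<gamma> n * sqrt (real n) = \<eta>" using n by (simp add: \<gamma>_def)
      then show ?thesis unfolding u_def by (simp add: distrib_left)
    qed
    also have "\<dots> \<le> e" using un em km Lm by linarith
    finally show "expectation (Q n) \<le> e" .
  qed
  ultimately show "\<exists>Q. mostly M e (\<lambda>n w. \<bar>(\<Sum>t<n. eps (int (Suc t)) w * d n (Suc t) w) / sqrt (real n)\<bar> \<le> Q n w) \<and>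
     (\<forall>\<^sub>F n in sequentially. integrable M (Q n) \<and> (\<forall>w\<in>space M. 0 \<le> Q n w) \<and> expectation (Q n) \<le> e)" by blast
qed

text \<open>The difference of the squares is \<open>2 * lam * d + d\<^sup>2\<close>. Weighting the
  mixed term by \<open>h = sqrt n\<close> leaves, after averaging, \<open>1 / sqrt n\<close> times
  two tight quantities.\<close>

lemma lh_square_small:
  "small_in_prob M (\<lambda>n w. (2 / real n) * (\<Sum>t=1..n. (lh n t w)\<^sup>2) - v)"
proof -
  let ?l = "\<lambda>n w. (\<Sum>t<n. (lam (int (Suc t)) w)\<^sup>2) / real n"
  let ?D = "\<lambda>n w. \<Sum>t<n. (d n (Suc t) w)\<^sup>2"
  have Lt: "tight_in_prob M ?l"
  proof (rule tight_in_prob_L1[where Q="?l" and c="mu 2"])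
    have i: "integrable M (\<lambda>w. (lam t w)\<^sup>2)" for t by (rule integrable_lam_power)
    have le: "expectation (\<lambda>w. (lam t w)\<^sup>2) \<le> mu 2" for t
      unfolding expectation_Y_power[of t, symmetric] by (rule integral_mono[OF i integrable_Y_power lam_square_le])
    show "integrable M (?l n)" for n using i by simp
    show "expectation (?l n) \<le> mu 2" for n
    proof -
      have "expectation (?l n) = (\<Sum>t<n. expectation (\<lambda>w. (lam (int (Suc t)) w)\<^sup>2)) / real n" using i by simp
      also have "\<dots> \<le> (\<Sum>t<n. mu 2) / real n" using le by (intro divide_right_mono sum_mono) auto
      also have "\<dots> \<le> mu 2" using mu_nonneg by simp
      finally show ?thesis .
    qed
  qed (simp add: sum_nonneg)
  have s0: "small_in_prob M (\<lambda>n w. 1 / sqrt (real n))" by (rule small_in_prob_deterministic) real_asymp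
  have b: "small_in_prob M (\<lambda>n w. 2 * (1 / sqrt (real n) * ?l n w) + 4 * (1 / sqrt (real n) * ?D n w))"
    by (intro small_in_prob_add small_in_prob_cmult small_in_prob_mult_tight[OF s0] Lt d_square_tight)
  have rem: "small_in_prob M (\<lambda>n w. (2 / real n) * (\<Sum>t<n. (lh n (Suc t) w)\<^sup>2) - 2 * ?l n w)"
  proof (rule small_in_prob_mono[OF b])
    show "\<forall>\<^sub>F n in sequentially. \<forall>w\<in>space M. \<bar>(2 / real n) * (\<Sum>t<n. (lh n (Suc t) w)\<^sup>2) - 2 * ?l n w\<bar> \<le>
        \<bar>2 * (1 / sqrt (real n) * ?l n w) + 4 * (1 / sqrt (real n) * ?D n w)\<bar>"
      using eventually_gt_at_top[of 0]
    proof (eventually_elim, intro ballI)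
      fix n :: nat and w assume n: "0 < n"
      define h where "h = sqrt (real n)"
      have h: "0 < h" "1 \<le> h" "real n = h * h" using n by (auto simp: h_def)
      let ?L = "\<Sum>t<n. (lam (int (Suc t)) w)\<^sup>2"
      have each: "\<bar>(lh n (Suc t) w)\<^sup>2 - (lam (int (Suc t)) w)\<^sup>2\<bar> \<le> (lam (int (Suc t)) w)\<^sup>2 / h + 2 * h * (d n (Suc t) w)\<^sup>2" for t
      proof -
        define x where "x = lam (int (Suc t)) w"
        define y where "y = d n (Suc t) w"
        have lh: "lh n (Suc t) w = x + y" by (simp add: x_def y_def d_def)
        have "2 * \<bar>x\<bar> * \<bar>h * y\<bar> \<le> \<bar>x\<bar>\<^sup>2 + \<bar>h * y\<bar>\<^sup>2" by (rule sum_squares_bound)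
        then have "2 * \<bar>x * y\<bar> * h \<le> x\<^sup>2 + h\<^sup>2 * y\<^sup>2" using h by (simp add: abs_mult power_mult_distrib ac_simps)
        then have "2 * \<bar>x * y\<bar> * h / h \<le> (x\<^sup>2 + h\<^sup>2 * y\<^sup>2) / h" using h by (intro divide_right_mono) auto
        then have xy: "2 * \<bar>x * y\<bar> \<le> x\<^sup>2 / h + h * y\<^sup>2" using h by (simp add: add_divide_distrib power2_eq_square)
        have "y\<^sup>2 \<le> h * y\<^sup>2" using mult_right_mono[OF h(2), of "y\<^sup>2"] by simp
        moreover have "\<bar>(x + y)\<^sup>2 - x\<^sup>2\<bar> \<le> 2 * \<bar>x * y\<bar> + y\<^sup>2"
        proof -
          have "(x + y)\<^sup>2 - x\<^sup>2 = 2 * (x * y) + y\<^sup>2" by (simp add: power2_sum)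
          also have "\<bar>\<dots>\<bar> \<le> \<bar>2 * (x * y)\<bar> + \<bar>y\<^sup>2\<bar>" by (rule abs_triangle_ineq)
          finally show ?thesis by (simp add: abs_mult)
        qed
        ultimately have "\<bar>(x + y)\<^sup>2 - x\<^sup>2\<bar> \<le> x\<^sup>2 / h + 2 * h * y\<^sup>2" using xy by simp
        then show ?thesis unfolding lh x_def[symmetric] y_def[symmetric] .
      qed
      have "(2 / real n) * (\<Sum>t<n. (lh n (Suc t) w)\<^sup>2) - 2 * ?l n w =
          (2 / real n) * (\<Sum>t<n. (lh n (Suc t) w)\<^sup>2 - (lam (int (Suc t)) w)\<^sup>2)"
        by (simp add: sum_subtractf right_diff_distrib)
      also have "\<bar>\<dots>\<bar> = (2 / real n) * \<bar>\<Sum>t<n. (lh n (Suc t) w)\<^sup>2 - (lam (int (Suc t)) w)\<^sup>2\<bar>"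
        by (simp only: abs_mult) simp
      also have "\<dots> \<le> (2 / real n) * (\<Sum>t<n. (lam (int (Suc t)) w)\<^sup>2 / h + 2 * h * (d n (Suc t) w)\<^sup>2)"
        by (intro mult_left_mono order_trans[OF sum_abs sum_mono[OF each]]) simp
      also have "(\<Sum>t<n. (lam (int (Suc t)) w)\<^sup>2 / h + 2 * h * (d n (Suc t) w)\<^sup>2) = ?L / h + 2 * h * ?D n w"
        by (simp add: sum.distrib sum_divide_distrib sum_distrib_left)
      also have "(2 / real n) * (?L / h + 2 * h * ?D n w) = 2 * (1 / h * (?L / real n)) + 4 * (1 / h * ?D n w)"
        unfolding h(3) using h(1) by (simp add: distrib_left)
      finally show "\<bar>(2 / real n) * (\<Sum>t<n. (lh n (Suc t) w)\<^sup>2) - 2 * ?l n w\<bar> \<le>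
        \<bar>2 * (1 / sqrt (real n) * ?l n w) + 4 * (1 / sqrt (real n) * ?D n w)\<bar>"
        unfolding h_def by linarith
    qed
  qed
  have "small_in_prob M (\<lambda>n w. ((2 / real n) * (\<Sum>t<n. (lh n (Suc t) w)\<^sup>2) - 2 * ?l n w) + 2 * (?l n w - expectation (\<lambda>w. (lam 0 w)\<^sup>2)))"
    by (intro small_in_prob_add rem small_in_prob_cmult lln_lam_square)
  then show ?thesis
    by (simp add: sum.atLeast1_atMost_eq v_def right_diff_distrib)
qed

text \<open>With plug-in error \<open>d\<close> each summand becomes
  \<open>X - 2 * eps * d + d\<^sup>2\<close>; the linear term is the cross term, the quadratic one
  is tight and divided by \<open>sqrt n\<close>.\<close>

lemma That_small:
  "small_in_prob M (\<lambda>n w. That n (\<lambda>t. N t w) (\<lambda>t. lh n t w) - T n w)"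
proof -
  have s0: "small_in_prob M (\<lambda>n w. 1 / sqrt (real n))" by (rule small_in_prob_deterministic) real_asymp
  have "small_in_prob M (\<lambda>n w. (- 2) * ((\<Sum>t<n. eps (int (Suc t)) w * d n (Suc t) w) / sqrt (real n))
      + 1 / sqrt (real n) * (\<Sum>t<n. (d n (Suc t) w)\<^sup>2))"
    by (intro small_in_prob_add small_in_prob_cmult cross_small small_in_prob_mult_tight[OF s0] d_square_tight)
  moreover have "(- 2) * ((\<Sum>t<n. eps (int (Suc t)) w * d n (Suc t) w) / sqrt (real n))
      + 1 / sqrt (real n) * (\<Sum>t<n. (d n (Suc t) w)\<^sup>2) = That n (\<lambda>t. N t w) (\<lambda>t. lh n t w) - T n w" for n w
  proof -
    have "(real (N (int (Suc t)) w) - lh n (Suc t) w)\<^sup>2 - real (N (int (Suc t)) w) =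
      X (int (Suc t)) w - 2 * (eps (int (Suc t)) w * d n (Suc t) w) + (d n (Suc t) w)\<^sup>2" for t
      by (simp add: X_def eps_def d_def power2_eq_square algebra_simps)
    then have "That n (\<lambda>t. N t w) (\<lambda>t. lh n t w) = (\<Sum>t<n. X (int (Suc t)) w - 2 * (eps (int (Suc t)) w * d n (Suc t) w)
        + (d n (Suc t) w)\<^sup>2) / sqrt (real n)"
      unfolding That_def One_nat_def sum.atLeast1_atMost_eq by (simp only:)
    then show ?thesis
      by (simp add: T_def sum.distrib sum_subtractf add_divide_distrib diff_divide_distrib
          flip: sum_distrib_left del: of_nat_Suc)
  qed
  ultimately show ?thesis by simp
qed

definition statistic :: "nat \<Rightarrow> 'w \<Rightarrow> real" where
  "statistic n w = Shat n (\<lambda>t. N t w) (lhat f (\<theta>hat n w) (lhat1 w) (\<lambda>t. N t w))"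

lemma statistic_lh: "statistic n w = ((2 / real n) * (\<Sum>t=1..n. (lh n t w)\<^sup>2)) powr (-1/2) * That n (\<lambda>t. N t w) (\<lambda>t. lh n t w)"
  by (simp add: statistic_def Shat_def lh_def)

lemma statistic_measurable [measurable]: "statistic n \<in> borel_measurable M"
proof -
  have [measurable]: "(\<lambda>w. \<Sum>t=1..n. (lh n t w)\<^sup>2) \<in> borel_measurable M" by measurable
  have [measurable]: "(\<lambda>w. That n (\<lambda>t. N t w) (\<lambda>t. lh n t w)) \<in> borel_measurable M"
    unfolding That_def by measurable
  show ?thesis unfolding statistic_lh[abs_def] by measurable
qed

text \<open>Slutsky: the random normalisation converges because the power is continuous at
  \<open>v > 0\<close>, and the statistic it multiplies is tight.\<close>

lemma statistic_small: "small_in_prob M (\<lambda>n w. statistic n w - v powr (-1/2) * T n w)"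
proof -
  let ?V = "\<lambda>n w. (2 / real n) * (\<Sum>t=1..n. (lh n t w)\<^sup>2)"
  let ?T = "\<lambda>n w. That n (\<lambda>t. N t w) (\<lambda>t. lh n t w)"
  have V: "small_in_prob M (\<lambda>n w. ?V n w powr (-1/2) - v powr (-1/2))"
    by (rule small_in_prob_continuous[OF lh_square_small, where g="\<lambda>x. x powr (-1/2)"])
       (use v_pos in \<open>auto intro!: continuous_intros\<close>)
  have "tight_in_prob M (\<lambda>n w. (?T n w - T n w) + T n w)"
    by (rule tight_in_prob_small_add[OF That_small T_tight])
  then have Tt: "tight_in_prob M ?T" by simp
  have "small_in_prob M (\<lambda>n w. (?V n w powr (-1/2) - v powr (-1/2)) * ?T n w + v powr (-1/2) * (?T n w - T n w))"
    by (intro small_in_prob_add small_in_prob_mult_tight[OF V Tt] small_in_prob_cmult That_small)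
  then show ?thesis by (simp add: statistic_lh algebra_simps)
qed

theorem statistic_weak_conv: "weak_conv_m (\<lambda>n. distr M borel (statistic n)) std_normal_distribution"
proof (rule levy_continuity)
  show "real_distribution (distr M borel (statistic n))" for n by simp
  show "real_distribution std_normal_distribution" by (rule real_dist_normal_dist)
  fix u :: real
  define a where "a = v powr (-1/2)"
  \<comment> \<open>The scaling by \<open>a\<close> moves into the argument of the characteristic
    function, where it cancels the variance \<open>v\<close>.\<close>
  have a2: "a\<^sup>2 * v = 1"
  proof -
    have "a\<^sup>2 = v powr (-1)" unfolding a_def using v_pos by (simp add: power2_eq_square flip: powr_add)
    then show ?thesis using v_pos by (simp add: powr_minus)
  qed
  have "(\<lambda>n. char (distr M borel (T n)) (a * u)) \<longlonglongrightarrow> complex_of_real (exp (- ((a * u)\<^sup>2 * v / 2)))"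
    by (rule T_char)
  moreover have "(a * u)\<^sup>2 * v = u\<^sup>2" using a2 by (simp add: power_mult_distrib ac_simps)
  moreover have "char (distr M borel (T n)) (a * u) = char (distr M borel (\<lambda>w. a * T n w)) u" for n
    unfolding char_def by (simp add: integral_distr ac_simps)
  ultimately have lim: "(\<lambda>n. char (distr M borel (\<lambda>w. a * T n w)) u) \<longlonglongrightarrow> complex_of_real (exp (- (u\<^sup>2) / 2))"
    by simp
  have "(\<lambda>n. char (distr M borel (statistic n)) u) \<longlonglongrightarrow> complex_of_real (exp (- (u\<^sup>2) / 2))"
    by (rule char_distr_small_diff[OF _ _ _ lim]) (use statistic_small in \<open>simp_all add: a_def\<close>)
  then show "(\<lambda>n. char (distr M borel (statistic n)) u) \<longlonglongrightarrow> char std_normal_distribution u"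
    by (simp add: char_std_normal_distribution)
qed

end

section \<open>Normal quantiles and the level of the test\<close>

lemma std_normal_AE_singleton: "measure std_normal_distribution {x} = 0"
proof -
  have "emeasure std_normal_distribution {x} = 0"
    by (simp add: emeasure_density nn_integral_0_iff_AE AE_lborel_singleton)
  then show ?thesis by (simp add: measure_def)
qed

lemma isCont_Phi: "isCont (cdf std_normal_distribution) x"
proof -
  interpret real_distribution std_normal_distribution by (rule real_dist_normal_dist)
  show ?thesis by (simp add: isCont_cdf std_normal_AE_singleton)
qed

text \<open>The density is positive everywhere, so an interval without normal mass would be a
  Lebesgue null set.\<close>

lemma Phi_strict_mono:
  assumes "x < y"
  shows "Phi x < Phi y"
proof -
  interpret real_distribution std_normal_distribution by (rule real_dist_normal_dist)
  have "Phi y - Phi x = measure std_normal_distribution {x<..y}"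
    unfolding Phi_def by (rule cdf_diff_eq[OF assms])
  moreover have "measure std_normal_distribution {x<..y} \<noteq> 0"
  proof
    assume "measure std_normal_distribution {x<..y} = 0"
    then have "emeasure std_normal_distribution {x<..y} = 0" by (simp add: emeasure_eq_measure)
    moreover have "0 < std_normal_density z" for z by (rule normal_density_pos) simp
    then have "std_normal_density z \<noteq> 0" for z by (metis less_irrefl)
    ultimately have "AE z in lborel. z \<notin> {x<..y}"
      by (subst (asm) emeasure_density)
         (auto simp: nn_integral_0_iff_AE elim!: eventually_mono split: split_indicator_asm)
    then have "emeasure lborel {x<..y} = 0"
      by (subst (asm) AE_iff_measurable[of "{x<..y}"]) auto
    with assms show False by simp
  qed
  ultimately show ?thesis using measure_nonneg[of std_normal_distribution "{x<..y}"] by linarith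
qed

text \<open>\<open>Phi_inv\<close> is a definite description: existence comes from the intermediate
  value theorem between the limits 0 and 1, uniqueness from strict monotonicity.\<close>

lemma Phi_Phi_inv:
  assumes "0 < p" "p < 1"
  shows "Phi (Phi_inv p) = p"
proof -
  interpret real_distribution std_normal_distribution by (rule real_dist_normal_dist)
  have "\<forall>\<^sub>F x in at_bot. Phi x < p" unfolding Phi_def using order_tendstoD(2)[OF cdf_lim_at_bot assms(1)] .
  then obtain a where a: "Phi a < p" using eventually_happens'[OF trivial_limit_at_bot_linorder] by blast
  have "\<forall>\<^sub>F x in at_top. p < Phi x" unfolding Phi_def using order_tendstoD(1)[OF cdf_lim_at_top_prob assms(2)] .
  then obtain b where b: "p < Phi b" using eventually_happens'[OF trivial_limit_at_top_linorder] by blast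
  have "a \<le> b" using a b Phi_strict_mono[of b a] by (cases "b < a") auto
  then obtain u where u: "Phi u = p"
    using IVT[of Phi a p b] a b isCont_Phi unfolding Phi_def by auto
  have unique: "u' = u" if "Phi u' = p" for u'
    using that u Phi_strict_mono[of u u'] Phi_strict_mono[of u' u] by (cases u u' rule: linorder_cases) auto
  have "Phi_inv p = u" unfolding Phi_inv_def using u unique by (rule the_equality)
  with u show ?thesis by simp
qed

text \<open>Weak convergence yields convergence of the distribution functions at the quantile
  because the normal limit has no atom there; then pass to complements.\<close>

lemma (in prob_space) upper_tail_tendsto:
  assumes [measurable]: "\<And>n. S n \<in> borel_measurable M"
    and conv: "weak_conv_m (\<lambda>n. distr M borel (S n)) std_normal_distribution" and \<alpha>: "0 < \<alpha>" "\<alpha> < 1"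
  shows "(\<lambda>n. prob {w \<in> space M. Phi_inv (1 - \<alpha>) < S n w}) \<longlonglongrightarrow> \<alpha>"
proof -
  let ?u = "Phi_inv (1 - \<alpha>)"
  have "(\<lambda>n. cdf (distr M borel (S n)) ?u) \<longlonglongrightarrow> cdf std_normal_distribution ?u"
    using conv isCont_Phi unfolding weak_conv_m_def weak_conv_def by blast
  also have "cdf std_normal_distribution ?u = 1 - \<alpha>"
    using Phi_Phi_inv[of "1 - \<alpha>"] \<alpha> by (simp add: Phi_def)
  finally have "(\<lambda>n. 1 - cdf (distr M borel (S n)) ?u) \<longlonglongrightarrow> 1 - (1 - \<alpha>)"
    by (intro tendsto_diff tendsto_const)
  moreover have "1 - cdf (distr M borel (S n)) ?u = prob {w \<in> space M. ?u < S n w}" for n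
  proof -
    have "cdf (distr M borel (S n)) ?u = prob {w \<in> space M. S n w \<le> ?u}"
      by (simp add: cdf_def measure_distr vimage_def Int_def conj_commute)
    moreover have "prob (space M - {w \<in> space M. S n w \<le> ?u}) = 1 - prob {w \<in> space M. S n w \<le> ?u}"
      by (rule prob_compl) measurable
    moreover have "space M - {w \<in> space M. S n w \<le> ?u} = {w \<in> space M. ?u < S n w}" by auto
    ultimately show ?thesis by simp
  qed
  ultimately show ?thesis by simp
qed

theorem theorem4p5:
  fixes M :: "'w measure"
    and \<Theta> :: "'a::euclidean_space set"
    and f :: "'a \<Rightarrow> real \<Rightarrow> nat \<Rightarrow> real"
    and \<theta>0 :: 'a
    and \<delta> C \<kappa>1 \<kappa>2 \<alpha> :: real
    and N :: "int \<Rightarrow> 'w \<Rightarrow> nat"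
    and lam :: "int \<Rightarrow> 'w \<Rightarrow> real"
    and \<theta>hat :: "nat \<Rightarrow> 'w \<Rightarrow> 'a"
    and lhat1 :: "'w \<Rightarrow> real"
  assumes M: "prob_space M"
    and \<theta>0: "\<theta>0 \<in> \<Theta>"
    and f_nonneg: "\<forall>\<theta>\<in>\<Theta>. \<forall>l\<ge>0. \<forall>y. f \<theta> l y \<ge> 0"
    and f_meas: "\<forall>y. (\<lambda>(\<theta>, l). f \<theta> l y) \<in> borel_measurable (restrict_space borel (\<Theta> \<times> {0..}))"
    and \<delta>: "\<delta> > 0"
    and \<kappa>: "\<kappa>1 \<ge> 0" "\<kappa>2 \<ge> 0" "\<kappa>1 + \<kappa>2 < 1"
    and lip_\<theta>: "\<forall>\<theta>'\<in>\<Theta>. norm (\<theta>' - \<theta>0) \<le> \<delta> \<longrightarrow> (\<forall>l\<ge>0. \<forall>y.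
               \<bar>f \<theta>' l y - f \<theta>0 l y\<bar> \<le> C * norm (\<theta>' - \<theta>0) * (l + real y + 1))"
    and contr: "\<forall>\<theta>'\<in>\<Theta>. norm (\<theta>' - \<theta>0) \<le> \<delta> \<longrightarrow> (\<forall>l\<ge>0. \<forall>l'\<ge>0. \<forall>y y'.
               \<bar>f \<theta>' l y - f \<theta>' l' y'\<bar> \<le> \<kappa>1 * \<bar>l - l'\<bar> + \<kappa>2 * \<bar>real y - real y'\<bar>)"
    and N_meas: "\<forall>t. N t \<in> measurable M (count_space UNIV)"
    and lam_meas: "\<forall>t. lam t \<in> borel_measurable M"
    and lam_nonneg: "\<forall>t. \<forall>w\<in>space M. lam t w \<ge> 0"
    and stat: "strictly_stationary M (\<lambda>t w. (lam t w, real (N t w)))"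
    and poisson: "\<forall>t k. \<forall>A\<in>past_sets M lam N t.
               measure M ({w \<in> space M. N t w = k} \<inter> A)
             = (\<integral>w. indicator A w * poisson_prob (lam t w) k \<partial>M)"
    and recursion: "\<forall>t. \<forall>w\<in>space M. lam t w = f \<theta>0 (lam (t - 1) w) (N (t - 1) w)"
    and \<theta>hat_meas: "\<forall>n. \<theta>hat n \<in> borel_measurable M"
    and \<theta>hat_in: "\<forall>n. \<forall>w\<in>space M. \<theta>hat n w \<in> \<Theta>"
    and \<theta>hat_rate: "bounded_in_prob M (\<lambda>n w. sqrt (real n) * norm (\<theta>hat n w - \<theta>0))"
    and lhat1_meas: "lhat1 \<in> borel_measurable M"
    and lhat1_nonneg: "\<forall>w\<in>space M. lhat1 w \<ge> 0"
    and f00: "f \<theta>0 0 0 > 0"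
    and \<alpha>: "0 < \<alpha>" "\<alpha> < 1"
  shows "weak_conv_m
           (\<lambda>n. distr M borel (\<lambda>w. Shat n (\<lambda>t. N t w) (lhat f (\<theta>hat n w) (lhat1 w) (\<lambda>t. N t w))))
           std_normal_distribution
       \<and> ((\<lambda>n. measure M {w \<in> space M.
              (if Shat n (\<lambda>t. N t w) (lhat f (\<theta>hat n w) (lhat1 w) (\<lambda>t. N t w)) > Phi_inv (1 - \<alpha>)
               then 1 else 0 :: nat) = 1}) \<longlonglongrightarrow> \<alpha>)"
proof -
  interpret prob_space M by (rule M)
  interpret plug_in M f \<theta>0 \<kappa>1 \<kappa>2 N lam \<Theta> \<delta> C \<theta>hat lhat1
  proof unfold_locales
    show "0 \<le> f \<theta>0 l y" if "0 \<le> l" for l y using f_nonneg \<theta>0 that by blast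
    show "0 \<le> \<kappa>1" "0 \<le> \<kappa>2" "\<kappa>1 + \<kappa>2 < 1" by (rule \<kappa>)+
    \<comment> \<open>\<open>\<theta>0\<close> lies in its own \<open>\<delta>\<close>-ball, so the
      contraction is available at the true parameter.\<close>
    show "\<bar>f \<theta>0 l y - f \<theta>0 l' y'\<bar> \<le> \<kappa>1 * \<bar>l - l'\<bar> + \<kappa>2 * \<bar>real y - real y'\<bar>" if "0 \<le> l" "0 \<le> l'" for l l' y y'
      using contr[rule_format, OF \<theta>0 _ that] \<delta> by simp
    show "N t \<in> measurable M (count_space UNIV)" for t using N_meas by blast
    show "lam t \<in> borel_measurable M" for t using lam_meas by blast
    show "0 \<le> lam t w" if "w \<in> space M" for t w using lam_nonneg that by blast
    show "strictly_stationary M (\<lambda>t w. (lam t w, real (N t w)))" by (rule stat)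
    show "prob ({w \<in> space M. N t w = k} \<inter> A) = expectation (\<lambda>w. indicator A w * poisson_prob (lam t w) k)"
      if "A \<in> past_sets M lam N t" for t k A using poisson that by blast
    show "lam t w = f \<theta>0 (lam (t - 1) w) (N (t - 1) w)" if "w \<in> space M" for t w using recursion that by blast
    show "0 < f \<theta>0 0 0" by (rule f00)
    show "0 \<le> f \<theta> l y" if "\<theta> \<in> \<Theta>" "0 \<le> l" for \<theta> l y using f_nonneg that by blast
    show "(\<lambda>(\<theta>, l). f \<theta> l y) \<in> borel_measurable (restrict_space borel (\<Theta> \<times> {0..}))" for y using f_meas by blast
    show "0 < \<delta>" by (rule \<delta>)
    show "\<bar>f \<theta> l y - f \<theta>0 l y\<bar> \<le> C * norm (\<theta> - \<theta>0) * (l + real y + 1)"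
      if "\<theta> \<in> \<Theta>" "norm (\<theta> - \<theta>0) \<le> \<delta>" "0 \<le> l" for \<theta> l y using lip_\<theta> that by blast
    show "\<bar>f \<theta> l y - f \<theta> l' y\<bar> \<le> \<kappa>1 * \<bar>l - l'\<bar>" if "\<theta> \<in> \<Theta>" "norm (\<theta> - \<theta>0) \<le> \<delta>" "0 \<le> l" "0 \<le> l'" for \<theta> l l' y
      using contr[rule_format, OF that, of y y] by simp
    show "\<theta>hat n \<in> borel_measurable M" for n using \<theta>hat_meas by blast
    show "\<theta>hat n w \<in> \<Theta>" if "w \<in> space M" for n w using \<theta>hat_in that by blast
    show "bounded_in_prob M (\<lambda>n w. sqrt (real n) * norm (\<theta>hat n w - \<theta>0))" by (rule \<theta>hat_rate)
    show "lhat1 \<in> borel_measurable M" by (rule lhat1_meas)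
    show "0 \<le> lhat1 w" if "w \<in> space M" for w using lhat1_nonneg that by blast
  qed
  have stat_eq: "Shat n (\<lambda>t. N t w) (lhat f (\<theta>hat n w) (lhat1 w) (\<lambda>t. N t w)) = statistic n w" for n w
    by (simp only: statistic_def)
  have event: "{w \<in> space M. (if Phi_inv (1 - \<alpha>) < statistic n w then 1 else 0 :: nat) = 1} =
      {w \<in> space M. Phi_inv (1 - \<alpha>) < statistic n w}" for n
    by (rule Collect_cong) simp
  show ?thesis
    unfolding stat_eq event
    by (intro conjI statistic_weak_conv upper_tail_tendsto[OF statistic_measurable statistic_weak_conv \<alpha>])
qed

end
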